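(* Let $K$ be a finite h-regular CW-complex and let $M$ be an admissible Morse matching on (the Hasse diagram of) its face poset $\mathcal{X}(K)$. Then $K$ is homotopy equivalent to a CW-complex with exactly one $p$-cell for each critical $p$-cell of $K$ (for every $p\ge 0$).
   Context: All complexes and posets are finite. A CW-complex $K$ is h-regular if the closed cells $\overline{e^n}$ are subcomplexes of $K$ and the attaching map of each cell $e^n$ is a homotopy equivalence onto its image $\dot e^n$; equivalently, if the closed cells are contractible subcomplexes. The face poset $\mathcal{X}(K)$ is the poset of (closed) cells of $K$ ordered by inclusion. For a poset $X$ and $x\in X$, $\hat U_x=\{y\in X: y<x\}$. The order complex $\mathcal{K}(X)$ is the simplicial complex of non-empty chains of $X$. Write $x\prec y$ if $x<y$ and there is no $z$ with $x<z<y$. The Hasse diagram $\mathcal{H}(X)$ is the directed graph with vertex set $X$ and edges the pairs $(x,y)$ with $x\prec y$ (directed from $x$ to $y$). An edge $(x,y)$ is admissible if $\mathcal{K}(\hat U_y\setminus\{x\})$ is contractible. A matching $M$ on $\mathcal{H}(X)$ is a set of edges no two of which share a vertex. $\mathcal{H}_M(X)$ is the directed graph obtained from $\mathcal{H}(X)$ by reversing the orientation of the edges not in $M$. $M$ is a Morse matching if $\mathcal{H}_M(X)$ has no directed cycles; a Morse matching is admissible if every edge in $M$ is admissible. Critical points (here: critical cells of $K$) are the elements not incident to any edge of $M$. *)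

theory Defs
  imports "HOL-Analysis.Analysis" "HOL-Library.Equipollence"
begin

text \<open>Disks, open disks and spheres in the coordinates of \<^const>\<open>Euclidean_space\<close>. Here
  \<open>bounding_sphere n\<close> is the boundary \<open>S\<^sup>n\<^sup>-\<^sup>1\<close> of the \<open>n\<close>-disk (not \<open>nsphere n\<close>, which is
  \<open>S\<^sup>n\<close>), so that it is empty for \<open>n = 0\<close>.\<close>

definition closed_disk :: "nat \<Rightarrow> (nat \<Rightarrow> real) topology" where
  "closed_disk n = subtopology (Euclidean_space n) {x. (\<Sum>i<n. (x i)\<^sup>2) \<le> 1}"

definition open_disk :: "nat \<Rightarrow> (nat \<Rightarrow> real) topology" where
  "open_disk n = subtopology (Euclidean_space n) {x. (\<Sum>i<n. (x i)\<^sup>2) < 1}"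

definition bounding_sphere :: "nat \<Rightarrow> (nat \<Rightarrow> real) topology" where
  "bounding_sphere n = subtopology (Euclidean_space n) {x. (\<Sum>i<n. (x i)\<^sup>2) = 1}"

text \<open>A cell structure on a space: \<open>cells K n\<close> is the set of open \<open>n\<close>-cells, and
  \<open>char_map K e\<close> is the characteristic map of the open cell \<open>e\<close>.\<close>

record 'a cell_structure =
  space_of :: "'a topology"
  cells :: "nat \<Rightarrow> 'a set set"
  char_map :: "'a set \<Rightarrow> (nat \<Rightarrow> real) \<Rightarrow> 'a"

abbreviation closed_cell :: "('a, 'x) cell_structure_scheme \<Rightarrow> 'a set \<Rightarrow> 'a set" where
  "closed_cell K e \<equiv> space_of K closure_of e"

text \<open>The finite set \<open>F\<close> expresses closure-finiteness; the last clause is the weak topology.\<close>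

definition cw_complex :: "('a, 'x) cell_structure_scheme \<Rightarrow> bool" where
  "cw_complex K \<longleftrightarrow>
     Hausdorff_space (space_of K) \<and>
     topspace (space_of K) = (\<Union>n. \<Union>(cells K n)) \<and>
     (\<forall>m n. \<forall>e\<in>cells K m. \<forall>e'\<in>cells K n. (m, e) \<noteq> (n, e') \<longrightarrow> disjnt e e') \<and>
     (\<forall>n. \<forall>e\<in>cells K n.
        continuous_map (closed_disk n) (space_of K) (char_map K e) \<and>
        homeomorphic_map (open_disk n) (subtopology (space_of K) e) (char_map K e) \<and>
        (\<exists>F. finite F \<and> F \<subseteq> (\<Union>m<n. cells K m) \<and>
             char_map K e ` topspace (bounding_sphere n) \<subseteq> \<Union>F)) \<and>
     (\<forall>A\<subseteq>topspace (space_of K).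
        closedin (space_of K) A \<longleftrightarrow>
        (\<forall>n. \<forall>e\<in>cells K n. closedin (space_of K) (A \<inter> closed_cell K e)))"

definition finite_cw_complex :: "('a, 'x) cell_structure_scheme \<Rightarrow> bool" where
  "finite_cw_complex K \<longleftrightarrow> cw_complex K \<and> finite (\<Union>n. cells K n)"

definition subcomplex :: "('a, 'x) cell_structure_scheme \<Rightarrow> 'a set \<Rightarrow> bool" where
  "subcomplex K A \<longleftrightarrow>
     (\<exists>F. F \<subseteq> (\<Union>n. cells K n) \<and> A = \<Union>F \<and> (\<forall>e\<in>F. closed_cell K e \<subseteq> A))"

definition homotopy_equivalence :: "'a topology \<Rightarrow> 'b topology \<Rightarrow> ('a \<Rightarrow> 'b) \<Rightarrow> bool" where
  "homotopy_equivalence X Y f \<longleftrightarrow>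
     continuous_map X Y f \<and>
     (\<exists>g. continuous_map Y X g \<and>
          homotopic_with (\<lambda>_. True) X X (g \<circ> f) id \<and>
          homotopic_with (\<lambda>_. True) Y Y (f \<circ> g) id)"

text \<open>The attaching map of a cell is the restriction of its characteristic map to the bounding
  sphere.\<close>

definition h_regular :: "('a, 'x) cell_structure_scheme \<Rightarrow> bool" where
  "h_regular K \<longleftrightarrow>
     (\<forall>n. \<forall>e\<in>cells K n.
        subcomplex K (closed_cell K e) \<and>
        homotopy_equivalence (bounding_sphere n)
          (subtopology (space_of K) (char_map K e ` topspace (bounding_sphere n)))
          (char_map K e))"

text \<open>The elements of the face poset are the closed cells; its order is the inclusion order of the
  type of sets.\<close>

definition face_poset :: "('a, 'x) cell_structure_scheme \<Rightarrow> 'a set set" where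
  "face_poset K = (\<Union>n. closed_cell K ` cells K n)"

text \<open>A poset is a set of elements of a type of class \<^class>\<open>order\<close>, with the order of that type.\<close>

definition order_complex :: "'b::order set \<Rightarrow> 'b set set" where
  "order_complex P = {C. C \<subseteq> P \<and> C \<noteq> {} \<and> finite C \<and> Complete_Partial_Order.chain (\<le>) C}"

text \<open>The geometric realization in barycentric coordinates. For complexes with finitely many
  vertices, the only ones considered here, the topology of pointwise convergence is the usual
  topology of the realization.\<close>

definition geometric_realization :: "'b set set \<Rightarrow> ('b \<Rightarrow> real) topology" where
  "geometric_realization S =
     subtopology (powertop_real UNIV)
       {t. (\<forall>v. 0 \<le> t v) \<and> {v. t v \<noteq> 0} \<in> S \<and> (\<Sum>v | t v \<noteq> 0. t v) = 1}"

text \<open>Non-emptiness is required separately, since the empty space satisfies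
  \<^const>\<open>contractible_space\<close>.\<close>

definition contractible_complex :: "'b set set \<Rightarrow> bool" where
  "contractible_complex S \<longleftrightarrow>
     topspace (geometric_realization S) \<noteq> {} \<and> contractible_space (geometric_realization S)"

definition strictly_below :: "'b::order set \<Rightarrow> 'b \<Rightarrow> 'b set" where
  "strictly_below P y = {z \<in> P. z < y}"

definition hasse_edges :: "'b::order set \<Rightarrow> ('b \<times> 'b) set" where
  "hasse_edges P = {(x, y). x \<in> P \<and> y \<in> P \<and> x < y \<and> \<not> (\<exists>z\<in>P. x < z \<and> z < y)}"

definition admissible_edge :: "'b::order set \<Rightarrow> 'b \<times> 'b \<Rightarrow> bool" where
  "admissible_edge P = (\<lambda>(x, y). contractible_complex (order_complex (strictly_below P y - {x})))"

definition matching :: "'b::order set \<Rightarrow> ('b \<times> 'b) set \<Rightarrow> bool" where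
  "matching P M \<longleftrightarrow>
     M \<subseteq> hasse_edges P \<and>
     (\<forall>(x, y)\<in>M. \<forall>(x', y')\<in>M. (x, y) \<noteq> (x', y') \<longrightarrow> disjnt {x, y} {x', y'})"

text \<open>Hasse edges point upwards, so here matched edges point upwards and all others downwards.\<close>

definition modified_hasse :: "'b::order set \<Rightarrow> ('b \<times> 'b) set \<Rightarrow> ('b \<times> 'b) set" where
  "modified_hasse P M = M \<union> (hasse_edges P - M)\<inverse>"

definition morse_matching :: "'b::order set \<Rightarrow> ('b \<times> 'b) set \<Rightarrow> bool" where
  "morse_matching P M \<longleftrightarrow> matching P M \<and> acyclic (modified_hasse P M)"

definition admissible_morse_matching :: "'b::order set \<Rightarrow> ('b \<times> 'b) set \<Rightarrow> bool" where
  "admissible_morse_matching P M \<longleftrightarrow> morse_matching P M \<and> (\<forall>a\<in>M. admissible_edge P a)"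

definition critical_points :: "'b::order set \<Rightarrow> ('b \<times> 'b) set \<Rightarrow> 'b set" where
  "critical_points P M = {x \<in> P. \<forall>(y, z)\<in>M. x \<noteq> y \<and> x \<noteq> z}"

definition critical_cells ::
  "('a, 'x) cell_structure_scheme \<Rightarrow> ('a set \<times> 'a set) set \<Rightarrow> nat \<Rightarrow> 'a set set" where
  "critical_cells K M p = {e \<in> cells K p. closed_cell K e \<in> critical_points (face_poset K) M}"

end

theory Submission
  imports Defs "HOL-Homology.Brouwer_Degree"
begin

text \<open>Build \<open>K\<close> from the empty complex by adding cells in an order refining the face order. A matched
  pair \<open>(x, y)\<close> whose proper faces other than \<open>x\<close> are present is added without changing the homotopy
  type: the part \<open>A\<close> of the boundary of \<open>y\<close> outside the open cell \<open>x\<close> is contractible, because it is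
  homotopy dominated by its order complex (an acyclic carrier argument, using that closed cells are
  contractible), and maps into the contractible sets \<open>A\<close> and \<open>y\<close> extend over cells. A critical cell
  is matched by a cell of the same dimension in the model, since homotopy equivalences extend over
  attached cells. Admissible pairs have consecutive dimensions: otherwise the identity of a sphere
  would factor, up to homotopy, through a sphere of smaller dimension. Acyclicity therefore allows
  the order to be chosen such that every critical \<open>p\<close>-cell is attached when all cells of the model
  that meet its boundary have dimension less than \<open>p\<close>, and the model is again a CW complex.\<close>

text \<open>Two obstacles shape the development. First, no quotient spaces are formed: a space with
  one more cell is recognised intrinsically by \<open>attached\<close>, where compactness of the
  disk and the Hausdorff property supply the adjunction topology, and the models are subsets of
  Euclidean spaces, so that all of them live in the one type \<open>nat \<Rightarrow> real\<close>.
  Second, the model must be a genuine CW complex, so each attaching map has to land strictly below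
  the dimension of its cell, although a homotopy equivalence need not respect skeleta. This is why
  the pairs with upper cell of dimension \<open>p\<close> are added before the critical
  \<open>p\<close>-cells, and why the jump of dimension in a pair must be known to be 1:
  h-regularity and admissibility speak only of homotopy types, so homology of spheres has to exclude
  larger jumps. Extension over cells rests on one tool, the retraction \<open>rho\<close> of the
  cylinder over a disk onto its bottom and side: it extends homotopies, and it compares two
  extensions relative to the sphere.\<close>

section \<open>Homotopy extension for the pair of disk and sphere\<close>

text \<open>As an introduction rule this would split every map into a function space.\<close>

declare continuous_on_coordinatewise_then_product [continuous_intros del]

text \<open>\<open>L2_set\<close> replaces the sums of squares so that scaling and the triangle
  inequality are at hand. The sphere \<open>sph n\<close> bounds \<open>disk n\<close> and is empty
  for \<open>n = 0\<close>.\<close>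

definition disk :: "nat \<Rightarrow> (nat \<Rightarrow> real) set" where
  "disk n = {x. (\<forall>i\<ge>n. x i = 0) \<and> L2_set x {..<n} \<le> 1}"

definition odisk :: "nat \<Rightarrow> (nat \<Rightarrow> real) set" where
  "odisk n = {x. (\<forall>i\<ge>n. x i = 0) \<and> L2_set x {..<n} < 1}"

definition sph :: "nat \<Rightarrow> (nat \<Rightarrow> real) set" where
  "sph n = {x. (\<forall>i\<ge>n. x i = 0) \<and> L2_set x {..<n} = 1}"

definition scl :: "real \<Rightarrow> (nat \<Rightarrow> real) \<Rightarrow> nat \<Rightarrow> real" where
  "scl c x = (\<lambda>i. c * x i)"

abbreviation D_top :: "nat \<Rightarrow> (nat \<Rightarrow> real) topology" where
  "D_top n \<equiv> top_of_set (disk n)"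

abbreviation S_top :: "nat \<Rightarrow> (nat \<Rightarrow> real) topology" where
  "S_top n \<equiv> top_of_set (sph n)"

abbreviation ID_top :: "nat \<Rightarrow> (real \<times> (nat \<Rightarrow> real)) topology" where
  "ID_top n \<equiv> top_of_set ({0..1} \<times> disk n)"

abbreviation IS_top :: "nat \<Rightarrow> (real \<times> (nat \<Rightarrow> real)) topology" where
  "IS_top n \<equiv> top_of_set ({0..1} \<times> sph n)"

lemma L2_set_le_1_iff: "L2_set x A \<le> 1 \<longleftrightarrow> (\<Sum>i\<in>A. (x i)\<^sup>2) \<le> 1"
  by (simp add: L2_set_def)

lemma L2_set_less_1_iff: "L2_set x A < 1 \<longleftrightarrow> (\<Sum>i\<in>A. (x i)\<^sup>2) < 1"
  by (simp add: L2_set_def)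

lemma L2_set_eq_1_iff: "L2_set x A = 1 \<longleftrightarrow> (\<Sum>i\<in>A. (x i)\<^sup>2) = 1"
  by (simp add: L2_set_def)

lemma closed_disk_eq: "closed_disk n = D_top n"
  by (simp add: closed_disk_def Euclidean_space_def subtopology_subtopology disk_def L2_set_le_1_iff
      euclidean_product_topology Collect_conj_eq)

lemma open_disk_eq: "open_disk n = top_of_set (odisk n)"
  by (simp add: open_disk_def Euclidean_space_def subtopology_subtopology odisk_def L2_set_less_1_iff
      euclidean_product_topology Collect_conj_eq)

lemma bounding_sphere_eq: "bounding_sphere n = S_top n"
  by (simp add: bounding_sphere_def Euclidean_space_def subtopology_subtopology sph_def L2_set_eq_1_iff
      euclidean_product_topology Collect_conj_eq)

lemma nsphere_eq: "nsphere n = S_top (Suc n)"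
  by (simp add: nsphere Int_commute Suc_le_eq Euclidean_space_def subtopology_subtopology sph_def L2_set_eq_1_iff
      euclidean_product_topology Collect_conj_eq lessThan_Suc_atMost)

lemma disk_Un: "disk n = odisk n \<union> sph n"
  by (auto simp: disk_def odisk_def sph_def)

lemma odisk_subset: "odisk n \<subseteq> disk n" and sph_subset: "sph n \<subseteq> disk n"
  by (auto simp: disk_Un)

lemma zero_in_odisk: "(\<lambda>_. 0) \<in> odisk n"
  by (simp add: odisk_def L2_set_def)

lemma zero_in_disk: "(\<lambda>_. 0) \<in> disk n"
  using zero_in_odisk odisk_subset by blast

lemma L2_set_scl: "L2_set (scl c x) A = \<bar>c\<bar> * L2_set x A"
proof -
  have "L2_set (scl c x) A = sqrt (c\<^sup>2 * (\<Sum>i\<in>A. (x i)\<^sup>2))"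
    by (simp add: L2_set_def scl_def power_mult_distrib sum_distrib_left)
  then show ?thesis
    by (simp add: L2_set_def real_sqrt_mult)
qed

lemma scl_in_disk: "x \<in> disk n \<Longrightarrow> \<bar>c\<bar> \<le> 1 \<Longrightarrow> scl c x \<in> disk n"
  unfolding disk_def by (simp add: L2_set_scl) (simp add: scl_def mult_le_one)

lemma scl_normalize: "(\<forall>i\<ge>n. x i = 0) \<Longrightarrow> L2_set x {..<n} > 0 \<Longrightarrow> scl (1 / L2_set x {..<n}) x \<in> sph n"
  unfolding sph_def by (simp add: L2_set_scl) (simp add: scl_def)

lemma scl_1 [simp]: "scl 1 x = x"
  by (simp add: scl_def)

lemma scl_0 [simp]: "scl 0 x = (\<lambda>_. 0)"
  by (simp add: scl_def)

lemma continuous_on_scl [continuous_intros]: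
  assumes "continuous_on S c" "continuous_on S f"
  shows "continuous_on S (\<lambda>x. scl (c x) (f x))"
  unfolding scl_def
  by (intro continuous_on_coordinatewise_then_product continuous_intros assms
       continuous_on_product_then_coordinatewise[OF assms(2)])

lemma continuous_on_L2_set [continuous_intros]:
  fixes f :: "'a::topological_space \<Rightarrow> nat \<Rightarrow> real"
  assumes "continuous_on S f"
  shows "continuous_on S (\<lambda>x. L2_set (f x) A)"
  unfolding L2_set_def
  by (intro continuous_intros continuous_on_product_then_coordinatewise[OF assms])

lemma compact_disk: "compact (disk n)"
proof -
  have "compactin (powertop_real UNIV) (PiE UNIV (\<lambda>i. if i < n then {-1..1} else {0}))"
    by (subst compactin_PiE) auto
  then have c: "compact (PiE UNIV (\<lambda>i. if i < n then {-1..1::real} else {0}))"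
    by (simp add: euclidean_product_topology)
  have sub: "disk n \<subseteq> PiE UNIV (\<lambda>i. if i < n then {-1..1::real} else {0})"
  proof
    fix x assume x: "x \<in> disk n"
    have "\<bar>x i\<bar> \<le> 1" if "i < n" for i
    proof -
      have "L2_set (\<lambda>i. \<bar>x i\<bar>) {..<n} \<le> 1" using x by (simp add: disk_def L2_set_def)
      moreover have "\<bar>x i\<bar> \<le> L2_set (\<lambda>i. \<bar>x i\<bar>) {..<n}"
        using that by (intro member_le_L2_set) auto
      ultimately show ?thesis by linarith
    qed
    then show "x \<in> PiE UNIV (\<lambda>i. if i < n then {-1..1::real} else {0})"
      using x by (force simp: disk_def abs_le_iff)
  qed
  have "continuous_on UNIV (\<lambda>x::nat\<Rightarrow>real. L2_set x {..<n})"
    by (intro continuous_intros)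
  then have "closed {x::nat\<Rightarrow>real. L2_set x {..<n} \<le> 1}"
    by (intro closed_Collect_le) (auto intro: continuous_intros)
  moreover have "closed {x::nat\<Rightarrow>real. \<forall>i\<ge>n. x i = 0}"
    by (intro closed_Collect_all closed_Collect_imp open_Collect_const closed_Collect_eq)
      (auto intro!: continuous_intros)
  ultimately have "closed (disk n)"
    unfolding disk_def Collect_conj_eq by blast
  then show ?thesis
    by (metis c sub compact_Int_closed inf.absorb_iff2)
qed

lemma closed_sph: "closed (sph n)"
proof -
  have "closed {x::nat\<Rightarrow>real. L2_set x {..<n} = 1}"
    by (intro closed_Collect_eq) (auto intro!: continuous_intros)
  then have "closed (disk n \<inter> {x::nat\<Rightarrow>real. L2_set x {..<n} = 1})"
    using compact_disk compact_imp_closed by blast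
  moreover have "disk n \<inter> {x::nat\<Rightarrow>real. L2_set x {..<n} = 1} = sph n"
    by (auto simp: disk_def sph_def)
  ultimately show ?thesis by simp
qed

text \<open>Points are approached by shrinking them radially. This makes the closure of an open cell
  equal to the image of the closed disk.\<close>

lemma odisk_dense: "disk n \<subseteq> closure (odisk n)"
proof
  fix x assume x: "x \<in> disk n"
  have "(\<lambda>k. scl (1 - 1 / real (Suc k)) x) \<longlonglongrightarrow> scl (1 - 0) x"
  proof -
    have c: "continuous_on UNIV (\<lambda>c. scl c x)" by (intro continuous_intros)
    have "(\<lambda>k. 1 - 1 / real (Suc k)) \<longlonglongrightarrow> 1 - 0"
      by (intro tendsto_intros LIMSEQ_Suc[OF lim_1_over_n])
    then show ?thesis
      using continuous_on_tendsto_compose[OF c, of "\<lambda>k. 1 - 1 / real (Suc k)" "1-0"] by simp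
  qed
  moreover have "scl (1 - 1 / real (Suc k)) x \<in> odisk n" for k
  proof -
    have "\<bar>1 - 1 / real (Suc k)\<bar> * L2_set x {..<n} \<le> \<bar>1 - 1 / real (Suc k)\<bar> * 1"
      using x by (intro mult_left_mono) (auto simp: disk_def)
    also have "\<dots> < 1" by (simp add: field_simps)
    finally show ?thesis using x by (simp add: odisk_def L2_set_scl disk_def) (simp add: scl_def)
  qed
  ultimately show "x \<in> closure (odisk n)"
    unfolding closure_sequential
    by (intro exI[of _ "\<lambda>k. scl (1 - 1 / real (Suc k)) x"]) simp
qed

text \<open>The preimage of a closed set is the union of a closed part of \<open>B\<close> and the
  \<open>q\<close>-image of a closed part of \<open>W\<close>. The closed map \<open>q\<close> plays
  the part of a quotient map, so continuity on a cell can be checked on the disk.\<close>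

lemma continuous_map_pieces:
  assumes B: "closedin Z B" and q: "closed_map W Z q" and cover: "topspace Z \<subseteq> B \<union> q ` topspace W"
    and F: "continuous_map (subtopology Z B) Y F" and Fq: "continuous_map W Y (\<lambda>w. F (q w))"
  shows "continuous_map Z Y F"
  unfolding continuous_map_closedin
proof (intro conjI ballI allI impI)
  have qZ: "q ` topspace W \<subseteq> topspace Z"
    using q closed_map_imp_subset_topspace by blast
  have BZ: "B \<subseteq> topspace Z" using B closedin_subset by blast
  show "F \<in> topspace Z \<rightarrow> topspace Y"
  proof (rule funcsetI)
    fix x assume "x \<in> topspace Z"
    then consider "x \<in> B" | w where "w \<in> topspace W" "x = q w" using cover by blast
    then show "F x \<in> topspace Y"
      by cases (use F Fq BZ in \<open>auto simp: continuous_map_def Pi_iff\<close>)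
  qed
  fix C assume C: "closedin Y C"
  have 1: "closedin Z {x \<in> B. F x \<in> C}"
  proof -
    have "closedin (subtopology Z B) {x \<in> topspace (subtopology Z B). F x \<in> C}"
      using F C by (simp add: continuous_map_closedin)
    moreover have "{x \<in> topspace (subtopology Z B). F x \<in> C} = {x \<in> B. F x \<in> C}" using BZ by auto
    ultimately show ?thesis using B closedin_trans_full by metis
  qed
  have 2: "closedin Z (q ` {w \<in> topspace W. F (q w) \<in> C})"
    using q Fq C unfolding closed_map_def continuous_map_closedin by blast
  have "{x \<in> topspace Z. F x \<in> C} = {x \<in> B. F x \<in> C} \<union> q ` {w \<in> topspace W. F (q w) \<in> C}"
    using cover qZ BZ by auto
  then show "closedin Z {x \<in> topspace Z. F x \<in> C}"
    using closedin_Un[OF 1 2] by simp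
qed

text \<open>Radial projection of the cylinder onto its bottom and side from the point at height 2
  above the centre. The ray through \<open>(t, p)\<close> meets the bottom when
  \<open>L2_set p {..<n} + t / 2 \<le> 1\<close> and the side otherwise, which explains the
  constants.\<close>

definition rho :: "nat \<Rightarrow> real \<times> (nat \<Rightarrow> real) \<Rightarrow> real \<times> (nat \<Rightarrow> real)" where
  "rho n = (\<lambda>(t, p). if L2_set p {..<n} + t / 2 \<le> 1 then (0, scl (2 / (2 - t)) p)
     else (2 - (2 - t) / L2_set p {..<n}, scl (1 / L2_set p {..<n}) p))"

lemma continuous_on_rho: "continuous_on ({0..1} \<times> disk n) (rho n)"
proof -
  have "continuous_on ({0..1} \<times> disk n)
     (\<lambda>x. if L2_set (snd x) {..<n} + fst x / 2 \<le> 1 then (0, scl (2 / (2 - fst x)) (snd x))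
     else (2 - (2 - fst x) / L2_set (snd x) {..<n}, scl (1 / L2_set (snd x) {..<n}) (snd x)))"
  proof (rule continuous_on_cases_le)
    fix x :: "real \<times> (nat \<Rightarrow> real)"
    assume x: "x \<in> {0..1} \<times> disk n" "L2_set (snd x) {..<n} + fst x / 2 = 1"
    then have e: "L2_set (snd x) {..<n} = (2 - fst x) / 2" and ne: "2 - fst x \<noteq> 0"
      by (auto simp: field_simps)
    then show "(0, scl (2 / (2 - fst x)) (snd x))
      = (2 - (2 - fst x) / L2_set (snd x) {..<n}, scl (1 / L2_set (snd x) {..<n}) (snd x))"
      unfolding e using ne by (simp add: divide_simps)
  qed (auto intro!: continuous_intros)
  then show ?thesis by (simp add: rho_def case_prod_unfold)
qed

lemma rho_in:
  assumes "x \<in> {0..1} \<times> disk n"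
  shows "rho n x \<in> {0} \<times> disk n \<union> {0..1} \<times> sph n"
proof -
  obtain t p where x: "x = (t, p)" "0 \<le> t" "t \<le> 1" "p \<in> disk n" using assms by auto
  show ?thesis
  proof (cases "L2_set p {..<n} + t / 2 \<le> 1")
    case True
    have "\<bar>2 / (2 - t)\<bar> * L2_set p {..<n} \<le> 1" using True x by (simp add: field_simps)
    then have "scl (2 / (2 - t)) p \<in> disk n"
      using x by (simp add: disk_def L2_set_scl) (simp add: scl_def)
    then show ?thesis using True x by (simp add: rho_def)
  next
    case False
    then have pos: "L2_set p {..<n} > 0" "L2_set p {..<n} \<le> 1" using x by (auto simp: disk_def)
    then have "scl (1 / L2_set p {..<n}) p \<in> sph n"
      using x by (intro scl_normalize) (auto simp: disk_def)
    moreover have "2 - (2 - t) / L2_set p {..<n} \<ge> 0" using False pos by (simp add: field_simps)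
    moreover have "2 - (2 - t) / L2_set p {..<n} \<le> 1"
      using pos x by (simp add: field_simps)
    ultimately show ?thesis using False x by (simp add: rho_def)
  qed
qed

lemma rho_id: "x \<in> {0} \<times> disk n \<union> {0..1} \<times> sph n \<Longrightarrow> rho n x = x"
  by (auto simp: rho_def disk_def sph_def)

text \<open>The bottom map and the side map fit together on their union, and composing with the
  retraction \<open>rho n\<close> fills the cylinder.\<close>

theorem hep_disk:
  assumes G: "continuous_map (D_top n) Y G" and H: "continuous_map (IS_top n) Y H"
    and GH: "\<And>s. s \<in> sph n \<Longrightarrow> H (0, s) = G s"
  obtains E where "continuous_map (ID_top n) Y E"
    "\<And>p. p \<in> disk n \<Longrightarrow> E (0, p) = G p"
    "\<And>t s. 0 \<le> t \<Longrightarrow> t \<le> 1 \<Longrightarrow> s \<in> sph n \<Longrightarrow> E (t, s) = H (t, s)"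
proof -
  let ?B = "{0::real} \<times> disk n \<union> {0..1} \<times> sph n"
  define F where "F = (\<lambda>x. if snd x \<in> sph n then H x else G (snd x))"
  have F0: "F (0, p) = G p" if "p \<in> disk n" for p
    using GH by (simp add: F_def)
  have F1: "F (t, s) = H (t, s)" if "s \<in> sph n" for t s
    using that by (simp add: F_def)
  have "continuous_map (top_of_set ?B) Y F"
  proof (rule continuous_map_pieces)
    show "closedin (top_of_set ?B) ({0::real} \<times> disk n)"
      using compact_disk[of n] by (intro closed_subset closed_Times closed_singleton) (auto simp: compact_imp_closed)
    show "closed_map (IS_top n) (top_of_set ?B) id"
    proof -
      have "closedin (top_of_set ?B) ({0..1} \<times> sph n)"
        using closed_sph[of n] by (intro closed_subset closed_Times) auto
      moreover have "?B \<inter> ({0..1} \<times> sph n) = {0..1} \<times> sph n" by auto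
      ultimately show ?thesis
        using closed_map_inclusion[of "top_of_set ?B" "{0..1} \<times> sph n"]
        by (simp add: subtopology_subtopology)
    qed
    show "topspace (top_of_set ?B) \<subseteq> {0} \<times> disk n \<union> id ` topspace (IS_top n)" by auto
    have "?B \<inter> ({0} \<times> disk n) = {0} \<times> disk n" by auto
    then have e: "subtopology (top_of_set ?B) ({0} \<times> disk n) = top_of_set ({0} \<times> disk n)"
      by (simp add: subtopology_subtopology)
    have "continuous_map (top_of_set ({0::real} \<times> disk n)) (D_top n) snd"
      by (auto intro!: continuous_intros)
    then have "continuous_map (top_of_set ({0::real} \<times> disk n)) Y (G \<circ> snd)"
      using G continuous_map_compose by blast
    then show "continuous_map (subtopology (top_of_set ?B) ({0} \<times> disk n)) Y F"
      unfolding e by (rule continuous_map_eq) (use F0 in auto)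
    show "continuous_map (IS_top n) Y (\<lambda>w. F (id w))"
      using H by (rule continuous_map_eq) (use F1 in auto)
  qed
  moreover have "continuous_map (ID_top n) (top_of_set ?B) (rho n)"
    using continuous_on_rho rho_in by auto
  ultimately have "continuous_map (ID_top n) Y (F \<circ> rho n)"
    using continuous_map_compose by blast
  then show thesis
  proof (rule that)
    show "(F \<circ> rho n) (0, p) = G p" if "p \<in> disk n" for p
      using that F0 rho_id[of "(0,p)" n] by auto
    show "(F \<circ> rho n) (t, s) = H (t, s)" if "0 \<le> t" "t \<le> 1" "s \<in> sph n" for t s
      using that F1 rho_id[of "(t,s)" n] by auto
  qed
qed

definition seg :: "real \<Rightarrow> (nat \<Rightarrow> real) \<Rightarrow> (nat \<Rightarrow> real) \<Rightarrow> nat \<Rightarrow> real" where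
  "seg u p q = (\<lambda>i. (1 - u) * p i + u * q i)"

lemma seg_in_disk:
  assumes "p \<in> disk n" "q \<in> disk n" "0 \<le> u" "u \<le> 1"
  shows "seg u p q \<in> disk n"
proof -
  have "L2_set (\<lambda>i. scl (1-u) p i + scl u q i) {..<n} \<le> L2_set (scl (1-u) p) {..<n} + L2_set (scl u q) {..<n}"
    by (rule L2_set_triangle_ineq)
  also have "\<dots> = (1-u) * L2_set p {..<n} + u * L2_set q {..<n}"
    using assms by (simp add: L2_set_scl)
  also have "\<dots> \<le> (1-u) * 1 + u * 1"
    using assms by (intro add_mono mult_left_mono) (auto simp: disk_def)
  finally show ?thesis
    using assms by (simp add: disk_def seg_def scl_def)
qed

lemma continuous_on_seg [continuous_intros]:
  assumes "continuous_on S c" "continuous_on S f" "continuous_on S g"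
  shows "continuous_on S (\<lambda>x. seg (c x) (f x) (g x))"
  unfolding seg_def
  by (intro continuous_on_coordinatewise_then_product continuous_intros assms
       continuous_on_product_then_coordinatewise[OF assms(2)] continuous_on_product_then_coordinatewise[OF assms(3)])

lemma seg_0 [simp]: "seg 0 p q = p"
  by (simp add: seg_def)

lemma seg_1 [simp]: "seg 1 p q = q"
  by (simp add: seg_def)

lemma seg_same [simp]: "seg u p p = p"
  by (simp add: seg_def algebra_simps)

text \<open>The cylinder is convex, so the segment from \<open>(1, p)\<close> to
  \<open>rho n (1, p)\<close> stays in it, and it is constant over the sphere because
  \<open>rho n\<close> fixes the side. Hence the top of \<open>E\<close> is determined, up to
  homotopy relative to the sphere, by the bottom and the side.\<close>

lemma hep_disk_end:
  assumes E: "continuous_map (ID_top n) Y E"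
  shows "homotopic_with (\<lambda>k. \<forall>s\<in>sph n. k s = E (1, s)) (D_top n) Y (\<lambda>p. E (1, p)) (\<lambda>p. E (rho n (1, p)))"
proof -
  let ?h = "\<lambda>x. ((1 - fst x) * 1 + fst x * fst (rho n (1, snd x)), seg (fst x) (snd x) (snd (rho n (1, snd x))))"
  have r: "rho n (1, p) \<in> {0..1} \<times> disk n" if "p \<in> disk n" for p
    using rho_in[of "(1,p)" n] that sph_subset by fastforce
  have rs: "rho n (1, p) = (1, p)" if "p \<in> sph n" for p
    using rho_id[of "(1,p)" n] that by auto
  have cr: "continuous_on ({0..1::real} \<times> disk n) (\<lambda>x. rho n (1, snd x))"
    by (rule continuous_on_compose2[OF continuous_on_rho]) (auto intro!: continuous_intros)
  have "continuous_on ({0..1} \<times> disk n) ?h"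
    by (intro continuous_intros cr)
  moreover have "?h x \<in> {0..1} \<times> disk n" if "x \<in> {0..1} \<times> disk n" for x
  proof -
    have "(1 - fst x) * 1 + fst x * fst (rho n (1, snd x)) \<le> (1 - fst x) * 1 + fst x * 1"
      using that r[of "snd x"] by (intro add_mono mult_left_mono) (auto simp: mem_Times_iff)
    moreover have "(1 - fst x) * 1 + fst x * fst (rho n (1, snd x)) \<ge> 0"
      using that r[of "snd x"] by (auto simp: mem_Times_iff)
    moreover have "seg (fst x) (snd x) (snd (rho n (1, snd x))) \<in> disk n"
      using that r[of "snd x"] by (intro seg_in_disk) (auto simp: mem_Times_iff)
    ultimately show ?thesis by simp
  qed
  ultimately have "continuous_map (ID_top n) (ID_top n) ?h"
    by (auto simp: Pi_iff)
  then have "continuous_map (ID_top n) Y (E \<circ> ?h)"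
    using E continuous_map_compose by blast
  then show ?thesis
    unfolding homotopic_with_def
    by (intro exI[of _ "E \<circ> ?h"]) (auto simp: rs)
qed

theorem hep_disk_unique:
  assumes E: "continuous_map (ID_top n) Y E" and E': "continuous_map (ID_top n) Y E'"
    and 0: "\<And>p. p \<in> disk n \<Longrightarrow> E (0, p) = E' (0, p)"
    and tr: "\<And>t s. 0 \<le> t \<Longrightarrow> t \<le> 1 \<Longrightarrow> s \<in> sph n \<Longrightarrow> E (t, s) = E' (t, s)"
  shows "homotopic_with (\<lambda>k. \<forall>s\<in>sph n. k s = E (1, s)) (D_top n) Y (\<lambda>p. E (1, p)) (\<lambda>p. E' (1, p))"
proof -
  have eq: "E (rho n (1, p)) = E' (rho n (1, p))" if "p \<in> disk n" for p
    using rho_in[of "(1,p)" n] that 0 tr by auto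
  have "homotopic_with (\<lambda>k. \<forall>s\<in>sph n. k s = E (1, s)) (D_top n) Y (\<lambda>p. E' (1, p)) (\<lambda>p. E' (rho n (1, p)))"
    by (rule homotopic_with_mono[OF hep_disk_end[OF E']]) (use tr in auto)
  then have "homotopic_with (\<lambda>k. \<forall>s\<in>sph n. k s = E (1, s)) (D_top n) Y (\<lambda>p. E (rho n (1, p))) (\<lambda>p. E' (1, p))"
    by (rule homotopic_with_eq[OF homotopic_with_symD])
      (use eq sph_subset in \<open>auto simp: subset_iff\<close>)
  then show ?thesis
    using homotopic_with_trans[OF hep_disk_end[OF E]] by blast
qed

text \<open>Reversing time exchanges bottom and top. This form compares two maps of the disk through
  homotopies that end in the same map and agree on the sphere, for instance two contractions to one
  point.\<close>

theorem hep_disk_unique_rev: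
  assumes E: "continuous_map (ID_top n) Y E" and E': "continuous_map (ID_top n) Y E'"
    and 1: "\<And>p. p \<in> disk n \<Longrightarrow> E (1, p) = E' (1, p)"
    and tr: "\<And>t s. 0 \<le> t \<Longrightarrow> t \<le> 1 \<Longrightarrow> s \<in> sph n \<Longrightarrow> E (t, s) = E' (t, s)"
  shows "homotopic_with (\<lambda>k. \<forall>s\<in>sph n. k s = E (0, s)) (D_top n) Y (\<lambda>p. E (0, p)) (\<lambda>p. E' (0, p))"
proof -
  have c: "continuous_map (ID_top n) (ID_top n) (\<lambda>x. (1 - fst x, snd x))"
    by (auto intro!: continuous_intros)
  have "homotopic_with (\<lambda>k. \<forall>s\<in>sph n. k s = (E \<circ> (\<lambda>x. (1 - fst x, snd x))) (1, s)) (D_top n) Y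
     (\<lambda>p. (E \<circ> (\<lambda>x. (1 - fst x, snd x))) (1, p)) (\<lambda>p. (E' \<circ> (\<lambda>x. (1 - fst x, snd x))) (1, p))"
    by (rule hep_disk_unique[OF continuous_map_compose[OF c E] continuous_map_compose[OF c E']])
      (use 1 tr in auto)
  then show ?thesis by simp
qed

section \<open>Attaching a cell\<close>

abbreviation I_top :: "real topology" where
  "I_top \<equiv> top_of_set {0..1}"

lemmas continuous_map_compose' = continuous_map_compose[unfolded o_def]

text \<open>\<open>X\<close> is \<open>A\<close> with one \<open>n\<close>-cell attached, expressed
  without a quotient. Since the disk is compact and \<open>X\<close> is Hausdorff, \<open>c\<close>
  is a closed map, so the adjunction topology is automatic.\<close>

definition attached :: "'a topology \<Rightarrow> 'a set \<Rightarrow> nat \<Rightarrow> ((nat \<Rightarrow> real) \<Rightarrow> 'a) \<Rightarrow> bool" where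
  "attached X A n c \<longleftrightarrow> Hausdorff_space X \<and> closedin X A \<and> continuous_map (D_top n) X c \<and>
     c ` sph n \<subseteq> A \<and> inj_on c (odisk n) \<and> c ` odisk n = topspace X - A"

lemma attachedD:
  assumes "attached X A n c"
  shows "Hausdorff_space X" "closedin X A" "A \<subseteq> topspace X" "continuous_map (D_top n) X c"
    "\<And>s. s \<in> sph n \<Longrightarrow> c s \<in> A" "inj_on c (odisk n)" "c ` odisk n = topspace X - A"
    "\<And>p. p \<in> odisk n \<Longrightarrow> c p \<notin> A" "\<And>p. p \<in> disk n \<Longrightarrow> c p \<in> topspace X"
  using assms closedin_subset[of X A] by (auto simp: attached_def continuous_map_def Pi_iff)

lemma attached_cases:
  assumes "attached X A n c" "x \<in> topspace X"
  obtains "x \<in> A" | p where "p \<in> odisk n" "x = c p" "x \<notin> A"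
  using attachedD(7)[OF assms(1)] assms(2) by blast

lemma attached_closed_map: "attached X A n c \<Longrightarrow> closed_map (D_top n) X c"
  by (intro continuous_imp_closed_map) (auto simp: attached_def compact_space_subtopology compact_disk)

text \<open>The cylinder over the disk is again compact, so homotopies on \<open>X\<close> are glued
  just like maps. This sidesteps the question whether a product of quotient maps is a quotient
  map.\<close>

lemma attached_closed_map_prod:
  assumes a: "attached X A n c"
  shows "closed_map (ID_top n) (prod_topology I_top X) (\<lambda>w. (fst w, c (snd w)))"
proof (rule continuous_imp_closed_map)
  show "continuous_map (ID_top n) (prod_topology I_top X) (\<lambda>w. (fst w, c (snd w)))"
  proof (rule continuous_map_pairedI)
    show "continuous_map (ID_top n) I_top fst"
      by (auto intro!: continuous_intros)
    have "continuous_map (ID_top n) (D_top n) snd"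
      by (auto intro!: continuous_intros)
    then show "continuous_map (ID_top n) X (\<lambda>w. c (snd w))"
      using attachedD(4)[OF a] by (rule continuous_map_compose')
  qed
  have "compact ({0..1::real} \<times> disk n)"
    using compact_disk by (intro compact_Times) auto
  then show "compact_space (ID_top n)"
    by (simp add: compact_space_subtopology)
  have "Hausdorff_space I_top" by (simp add: Hausdorff_space_subtopology)
  then show "Hausdorff_space (prod_topology I_top X)"
    using attachedD(1)[OF a] Hausdorff_space_prod_topology by blast
qed

text \<open>The inverse is taken on the open disk, where the characteristic map of an attached cell
  is injective. On the sphere \<open>c\<close> may identify points, but their images lie in
  \<open>A\<close> and are handled by \<open>f\<close>.\<close>

definition glue :: "nat \<Rightarrow> ((nat \<Rightarrow> real) \<Rightarrow> 'a) \<Rightarrow> 'a set \<Rightarrow> ('a \<Rightarrow> 'b) \<Rightarrow> ((nat \<Rightarrow> real) \<Rightarrow> 'b) \<Rightarrow> 'a \<Rightarrow> 'b" where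
  "glue n c A f g x = (if x \<in> A then f x else g (inv_into (odisk n) c x))"

lemma glue_base: "x \<in> A \<Longrightarrow> glue n c A f g x = f x"
  by (simp add: glue_def)

lemma glue_cell:
  assumes a: "attached X A n c" and fg: "\<And>s. s \<in> sph n \<Longrightarrow> f (c s) = g s" and p: "p \<in> disk n"
  shows "glue n c A f g (c p) = g p"
proof (cases "p \<in> sph n")
  case True
  then show ?thesis using attachedD(5)[OF a] fg by (simp add: glue_def)
next
  case False
  then have "p \<in> odisk n" using p disk_Un by blast
  then show ?thesis
    using attachedD(6,8)[OF a] by (simp add: glue_def inv_into_f_f)
qed

lemma continuous_map_attached:
  assumes a: "attached X A n c"
    and "continuous_map (subtopology X A) Y F" "continuous_map (D_top n) Y (\<lambda>p. F (c p))"
  shows "continuous_map X Y F"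
proof (rule continuous_map_pieces[OF attachedD(2)[OF a] attached_closed_map[OF a] _ assms(2,3)])
  show "topspace X \<subseteq> A \<union> c ` topspace (D_top n)"
    using attachedD(7)[OF a] odisk_subset by fastforce
qed

lemma continuous_map_glue:
  assumes a: "attached X A n c" and f: "continuous_map (subtopology X A) Y f"
    and g: "continuous_map (D_top n) Y g" and fg: "\<And>s. s \<in> sph n \<Longrightarrow> f (c s) = g s"
  shows "continuous_map X Y (glue n c A f g)"
proof (rule continuous_map_attached[OF a])
  show "continuous_map (subtopology X A) Y (glue n c A f g)"
    by (rule continuous_map_eq[OF f]) (simp add: glue_base)
  show "continuous_map (D_top n) Y (\<lambda>p. glue n c A f g (c p))"
    by (rule continuous_map_eq[OF g]) (simp add: glue_cell[where f = f and g = g, OF a fg])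
qed

lemma continuous_map_attached_prod:
  assumes a: "attached X A n c"
    and f: "continuous_map (prod_topology I_top (subtopology X A)) Y F"
    and g: "continuous_map (ID_top n) Y (\<lambda>w. F (fst w, c (snd w)))"
  shows "continuous_map (prod_topology I_top X) Y F"
proof (rule continuous_map_pieces[OF _ attached_closed_map_prod[OF a] _ _ g])
  show "closedin (prod_topology I_top X) ({0..1} \<times> A)"
    using attachedD(2)[OF a] by (simp add: closedin_prod_Times_iff)
  have "{0..1::real} \<times> topspace X \<subseteq> {0..1} \<times> A \<union> (\<lambda>w. (fst w, c (snd w))) ` ({0..1} \<times> disk n)"
  proof
    fix z assume z: "z \<in> {0..1::real} \<times> topspace X"
    show "z \<in> {0..1} \<times> A \<union> (\<lambda>w. (fst w, c (snd w))) ` ({0..1} \<times> disk n)"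
    proof (rule attached_cases[OF a, of "snd z"])
      fix p assume "p \<in> odisk n" "snd z = c p"
      then have "z = (\<lambda>w. (fst w, c (snd w))) (fst z, p)" "(fst z, p) \<in> {0..1} \<times> disk n"
        using z odisk_subset by (auto simp: prod_eq_iff)
      then show ?thesis by blast
    qed (use z in \<open>auto simp: mem_Times_iff\<close>)
  qed
  then show "topspace (prod_topology I_top X)
    \<subseteq> {0..1} \<times> A \<union> (\<lambda>w. (fst w, c (snd w))) ` topspace (ID_top n)" by simp
  have "subtopology (prod_topology I_top X) ({0..1} \<times> A) = prod_topology I_top (subtopology X A)"
    by (simp add: subtopology_Times subtopology_subtopology)
  then show "continuous_map (subtopology (prod_topology I_top X) ({0..1} \<times> A)) Y F"
    using f by simp
qed

lemma continuous_map_glue_prod: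
  assumes a: "attached X A n c" and f: "continuous_map (prod_topology I_top (subtopology X A)) Y f"
    and g: "continuous_map (ID_top n) Y g"
    and fg: "\<And>t s. 0 \<le> t \<Longrightarrow> t \<le> 1 \<Longrightarrow> s \<in> sph n \<Longrightarrow> f (t, c s) = g (t, s)"
  shows "continuous_map (prod_topology I_top X) Y
    (\<lambda>(t, x). glue n c A (\<lambda>x. f (t, x)) (\<lambda>p. g (t, p)) x)"
proof (rule continuous_map_attached_prod[OF a])
  show "continuous_map (prod_topology I_top (subtopology X A)) Y
      (\<lambda>(t, x). glue n c A (\<lambda>x. f (t, x)) (\<lambda>p. g (t, p)) x)"
    by (rule continuous_map_eq[OF f]) (auto simp: glue_base)
  show "continuous_map (ID_top n) Y
     (\<lambda>w. case (fst w, c (snd w)) of (t, x) \<Rightarrow> glue n c A (\<lambda>x. f (t, x)) (\<lambda>p. g (t, p)) x)"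
    by (rule continuous_map_eq[OF g])
      (use glue_cell[where f = "\<lambda>x. f (t, x)" and g = "\<lambda>p. g (t, p)" for t, OF a fg] in auto)
qed

text \<open>Filling the cylinder inside \<open>subtopology Y Z\<close> rather than in
  \<open>Y\<close> gives control over where the closed cell travels; the carrier arguments depend on
  this control.\<close>

theorem hep_attached:
  assumes a: "attached X A n c" and f: "continuous_map X Y f"
    and H: "continuous_map (prod_topology I_top (subtopology X A)) Y H"
    and H0: "\<And>x. x \<in> A \<Longrightarrow> H (0, x) = f x"
    and fZ: "\<And>p. p \<in> disk n \<Longrightarrow> f (c p) \<in> Z"
    and HZ: "\<And>t s. 0 \<le> t \<Longrightarrow> t \<le> 1 \<Longrightarrow> s \<in> sph n \<Longrightarrow> H (t, c s) \<in> Z"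
  obtains E where "continuous_map (prod_topology I_top X) Y E"
    "\<And>x. x \<in> topspace X \<Longrightarrow> E (0, x) = f x"
    "\<And>t x. 0 \<le> t \<Longrightarrow> t \<le> 1 \<Longrightarrow> x \<in> A \<Longrightarrow> E (t, x) = H (t, x)"
    "\<And>t p. 0 \<le> t \<Longrightarrow> t \<le> 1 \<Longrightarrow> p \<in> disk n \<Longrightarrow> E (t, c p) \<in> Z"
proof -
  have 1: "continuous_map (D_top n) (subtopology Y Z) (\<lambda>p. f (c p))"
    using continuous_map_compose[OF attachedD(4)[OF a] f] fZ
    by (auto simp: continuous_map_in_subtopology o_def)
  have 2: "continuous_map (IS_top n) (subtopology Y Z) (\<lambda>w. H (fst w, c (snd w)))"
  proof -
    have "continuous_map (IS_top n) (prod_topology I_top (subtopology X A)) (\<lambda>w. (fst w, c (snd w)))"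
    proof (rule continuous_map_pairedI)
      show "continuous_map (IS_top n) I_top fst"
        by (auto intro!: continuous_intros)
      have "continuous_map (IS_top n) (D_top n) snd"
        using sph_subset[of n] by (auto intro!: continuous_intros)
      then have "continuous_map (IS_top n) X (\<lambda>w. c (snd w))"
        using attachedD(4)[OF a] by (rule continuous_map_compose')
      then show "continuous_map (IS_top n) (subtopology X A) (\<lambda>w. c (snd w))"
        using attachedD(5)[OF a] by (auto simp: continuous_map_in_subtopology)
    qed
    then have "continuous_map (IS_top n) Y (\<lambda>w. H (fst w, c (snd w)))"
      using H by (rule continuous_map_compose')
    then show ?thesis
      using HZ by (auto simp: continuous_map_in_subtopology)
  qed
  obtain e where e: "continuous_map (ID_top n) (subtopology Y Z) e"
    and e0: "\<And>p. p \<in> disk n \<Longrightarrow> e (0, p) = f (c p)"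
    and es: "\<And>t s. 0 \<le> t \<Longrightarrow> t \<le> 1 \<Longrightarrow> s \<in> sph n \<Longrightarrow> e (t, s) = H (t, c s)"
    by (rule hep_disk[OF 1 2]) (use H0 attachedD(5)[OF a] in auto)
  let ?E = "\<lambda>(t, x). glue n c A (\<lambda>x. H (t, x)) (\<lambda>p. e (t, p)) x"
  have gc: "glue n c A (\<lambda>x. H (t, x)) (\<lambda>p. e (t, p)) (c p) = e (t, p)"
    if "0 \<le> t" "t \<le> 1" "p \<in> disk n" for t p
    by (rule glue_cell[OF a]) (use that es in auto)
  show thesis
  proof (rule that[of ?E])
    show "continuous_map (prod_topology I_top X) Y ?E"
      by (rule continuous_map_glue_prod[OF a H])
        (use e es in \<open>auto simp: continuous_map_in_subtopology\<close>)
    show "?E (0, x) = f x" if x: "x \<in> topspace X" for x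
      using x
    proof (cases rule: attached_cases[OF a x])
      case (2 p)
      then show ?thesis using gc[of 0 p] e0 odisk_subset by auto
    qed (simp add: glue_base H0)
    show "?E (t, x) = H (t, x)" if "x \<in> A" for t x
      using that by (simp add: glue_base)
    show "?E (t, c p) \<in> Z" if "0 \<le> t" "t \<le> 1" "p \<in> disk n" for t p
    proof -
      have "e (t, p) \<in> Z" using e that by (auto simp: continuous_map_def Pi_iff)
      then show ?thesis using gc that by simp
    qed
  qed
qed

text \<open>A homotopy of the disk that is fixed on the sphere extends by the constant homotopy on
  \<open>A\<close>.\<close>

theorem homotopic_rel_cell:
  assumes a: "attached X A n c" and f: "continuous_map X Y f"
    and fg: "\<And>x. x \<in> A \<Longrightarrow> f x = g x"
    and h: "homotopic_with (\<lambda>k. \<forall>s\<in>sph n. k s = f (c s)) (D_top n) (subtopology Y Z)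
       (\<lambda>p. f (c p)) (\<lambda>p. g (c p))"
  shows "homotopic_with (\<lambda>k. (\<forall>x\<in>A. k x = f x) \<and> (\<forall>x\<in>topspace X - A. k x \<in> Z)) X Y f g"
proof -
  obtain e where e: "continuous_map (ID_top n) (subtopology Y Z) e"
    and e0: "\<And>p. e (0, p) = f (c p)" and e1: "\<And>p. e (1, p) = g (c p)"
    and es: "\<And>t s. 0 \<le> t \<Longrightarrow> t \<le> 1 \<Longrightarrow> s \<in> sph n \<Longrightarrow> e (t, s) = f (c s)"
    using h unfolding homotopic_with_def by auto
  let ?E = "\<lambda>(t, x). glue n c A (\<lambda>x. f x) (\<lambda>p. e (t, p)) x"
  have gc: "glue n c A f (\<lambda>p. e (t, p)) (c p) = e (t, p)"
    if "0 \<le> t" "t \<le> 1" "p \<in> disk n" for t p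
    by (rule glue_cell[OF a]) (use that es in auto)
  have fA: "continuous_map (prod_topology I_top (subtopology X A)) Y (f \<circ> snd)"
    by (rule continuous_map_compose[OF continuous_map_snd continuous_map_from_subtopology[OF f]])
  have "continuous_map (prod_topology I_top X) Y
      (\<lambda>(t, x). glue n c A (\<lambda>x. (f \<circ> snd) (t, x)) (\<lambda>p. e (t, p)) x)"
    by (rule continuous_map_glue_prod[OF a fA])
      (use e es in \<open>auto simp: continuous_map_in_subtopology\<close>)
  then have E: "continuous_map (prod_topology I_top X) Y ?E" by simp
  have EZ: "?E (t, x) \<in> Z" if t: "0 \<le> t" "t \<le> 1" and x: "x \<in> topspace X - A" for t x
  proof -
    obtain p where p: "p \<in> odisk n" "x = c p" using x attachedD(7)[OF a] by blast
    then have "e (t, p) \<in> Z" using e t odisk_subset[of n] by (auto simp: continuous_map_def Pi_iff)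
    moreover have "p \<in> disk n" using p odisk_subset by blast
    ultimately show ?thesis using gc[OF t] p by simp
  qed
  have "\<exists>E. continuous_map (prod_topology I_top X) Y E \<and> (\<forall>x\<in>topspace X. E (0, x) = f x) \<and>
      (\<forall>x\<in>topspace X. E (1, x) = g x) \<and>
      (\<forall>t\<in>{0..1}. (\<forall>x\<in>A. E (t, x) = f x) \<and> (\<forall>x\<in>topspace X - A. E (t, x) \<in> Z))"
  proof (intro exI[of _ ?E] conjI ballI E)
    show "?E (0, x) = f x" if x: "x \<in> topspace X" for x
      using x by (cases rule: attached_cases[OF a x]) (use gc[of 0] e0 subsetD[OF odisk_subset] in \<open>auto simp: glue_base\<close>)
    show "?E (1, x) = g x" if x: "x \<in> topspace X" for x
      using x by (cases rule: attached_cases[OF a x]) (use gc[of 1] e1 fg subsetD[OF odisk_subset] in \<open>auto simp: glue_base\<close>)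
    show "?E (t, x) = f x" if "x \<in> A" for t x using that by (simp add: glue_base)
    show "?E (t, x) \<in> Z" if "t \<in> {0..1}" "x \<in> topspace X - A" for t x using EZ that by auto
  qed
  then show ?thesis
    by (subst homotopic_with) (use attachedD(3)[OF a] in \<open>auto simp: subset_iff\<close>)
qed

section \<open>Extension of maps and homotopies with contractible carriers\<close>

lemma disk_extension:
  assumes f: "continuous_map (S_top n) Y f" and Y: "contractible_space Y" "topspace Y \<noteq> {}"
  obtains g where "continuous_map (D_top n) Y g" "\<And>s. s \<in> sph n \<Longrightarrow> g s = f s"
proof -
  \<comment> \<open>The map \<open>f\<close> is homotopic to a constant, which extends over the
    disk, so homotopy extension applies. For \<open>n = 0\<close> the sphere is empty and only
    non-emptiness of \<open>Y\<close> provides the constant.\<close>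
  obtain y where y: "y \<in> topspace Y" using Y by blast
  have "homotopic_with (\<lambda>_. True) (S_top n) Y (\<lambda>_. y) f"
    by (rule homotopic_into_contractible_space) (use f y Y in auto)
  then obtain h where h: "continuous_map (IS_top n) Y h" "\<And>s. h (0, s) = y" "\<And>s. h (1, s) = f s"
    unfolding homotopic_with_def by auto
  obtain E where E: "continuous_map (ID_top n) Y E"
    "\<And>t s. 0 \<le> t \<Longrightarrow> t \<le> 1 \<Longrightarrow> s \<in> sph n \<Longrightarrow> E (t, s) = h (t, s)"
    by (rule hep_disk[where G = "\<lambda>_. y", OF _ h(1)]) (use y h in auto)
  have "continuous_map (D_top n) (ID_top n) (\<lambda>p. (1, p))"
    by (auto intro!: continuous_intros)
  then have "continuous_map (D_top n) Y (\<lambda>p. E (1, p))"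
    using E(1) by (rule continuous_map_compose')
  then show thesis
    by (rule that) (use E h in auto)
qed

text \<open>Inductive step for building a map subordinate to a carrier: the boundary of the new cell
  already goes into the contractible set \<open>Z\<close>, so the map extends over the disk within
  \<open>Z\<close>.\<close>

theorem carrier_extension:
  assumes a: "attached X A n c" and f: "continuous_map (subtopology X A) Y f"
    and Z: "contractible_space (subtopology Y Z)" "Z \<subseteq> topspace Y" "Z \<noteq> {}"
    and fZ: "\<And>s. s \<in> sph n \<Longrightarrow> f (c s) \<in> Z"
  obtains F where "continuous_map X Y F" "\<And>x. x \<in> A \<Longrightarrow> F x = f x"
    "\<And>x. x \<in> topspace X - A \<Longrightarrow> F x \<in> Z"
proof -
  have "continuous_map (S_top n) X c"
    using continuous_map_from_subtopology_mono[OF attachedD(4)[OF a] sph_subset] .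
  then have "continuous_map (S_top n) (subtopology X A) c"
    using attachedD(5)[OF a] by (auto simp: continuous_map_in_subtopology)
  then have "continuous_map (S_top n) Y (\<lambda>s. f (c s))"
    using f by (rule continuous_map_compose')
  then have "continuous_map (S_top n) (subtopology Y Z) (\<lambda>s. f (c s))"
    using fZ by (auto simp: continuous_map_in_subtopology)
  then obtain g where g: "continuous_map (D_top n) (subtopology Y Z) g" "\<And>s. s \<in> sph n \<Longrightarrow> g s = f (c s)"
    by (rule disk_extension) (use Z in auto)
  show thesis
  proof (rule that[of "glue n c A f g"])
    show "continuous_map X Y (glue n c A f g)"
      by (rule continuous_map_glue[OF a f]) (use g in \<open>auto simp: continuous_map_in_subtopology\<close>)
    show "glue n c A f g x = f x" if "x \<in> A" for x using that by (rule glue_base)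
    show "glue n c A f g x \<in> Z" if x: "x \<in> topspace X - A" for x
    proof -
      obtain p where p: "p \<in> odisk n" "x = c p" using x attachedD(7)[OF a] by blast
      then have "glue n c A f g x = g p"
        using glue_cell[where f = f and g = g, OF a] g odisk_subset by auto
      moreover have "g p \<in> Z" using g(1) p odisk_subset[of n] by (auto simp: continuous_map_def Pi_iff)
      ultimately show ?thesis by simp
    qed
  qed
qed

text \<open>Inductive step for homotopies: \<open>C\<close> prescribes the set in which each point
  must remain, with value \<open>Z\<close> on the new open cell. Extending the given homotopy over
  the cell replaces \<open>f\<close> by a map equal to \<open>g\<close> on \<open>A\<close>; the
  difference left on the cell is removed inside the contractible \<open>Z\<close>.\<close>

theorem carrier_homotopy:
  assumes a: "attached X A n c" and f: "continuous_map X Y f" and g: "continuous_map X Y g"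
    and h: "homotopic_with (\<lambda>k. \<forall>x\<in>A. k x \<in> C x) (subtopology X A) Y f g"
    and Z: "contractible_space (subtopology Y Z)"
    and CZ: "\<And>s. s \<in> sph n \<Longrightarrow> C (c s) \<subseteq> Z" "\<And>x. x \<in> topspace X - A \<Longrightarrow> C x = Z"
    and fgZ: "\<And>x. x \<in> topspace X - A \<Longrightarrow> f x \<in> Z" "\<And>x. x \<in> topspace X - A \<Longrightarrow> g x \<in> Z"
  shows "homotopic_with (\<lambda>k. \<forall>x\<in>topspace X. k x \<in> C x) X Y f g"
proof -
  have AX: "A \<subseteq> topspace X" using attachedD(3)[OF a] .
  obtain H where H: "continuous_map (prod_topology I_top (subtopology X A)) Y H"
    and H0: "\<And>x. x \<in> A \<Longrightarrow> H (0, x) = f x" and H1: "\<And>x. x \<in> A \<Longrightarrow> H (1, x) = g x"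
    and HC: "\<And>t x. 0 \<le> t \<Longrightarrow> t \<le> 1 \<Longrightarrow> x \<in> A \<Longrightarrow> H (t, x) \<in> C x"
    using h unfolding homotopic_with_def by auto
  have fZ: "f (c p) \<in> Z" if "p \<in> disk n" for p
  proof (cases "p \<in> sph n")
    case True
    then show ?thesis using HC[of 0 "c p"] H0 attachedD(5)[OF a] CZ by force
  next
    case False
    then show ?thesis using that disk_Un fgZ attachedD(7)[OF a] by blast
  qed
  have gZ: "g (c p) \<in> Z" if "p \<in> disk n" for p
  proof (cases "p \<in> sph n")
    case True
    then show ?thesis using HC[of 1 "c p"] H1 attachedD(5)[OF a] CZ by force
  next
    case False
    then show ?thesis using that disk_Un fgZ attachedD(7)[OF a] by blast
  qed
  have "H (t, c s) \<in> Z" if "0 \<le> t" "t \<le> 1" "s \<in> sph n" for t s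
    using HC[OF that(1,2) attachedD(5)[OF a that(3)]] CZ(1)[OF that(3)] by blast
  then obtain E where E: "continuous_map (prod_topology I_top X) Y E"
    and E0: "\<And>x. x \<in> topspace X \<Longrightarrow> E (0, x) = f x"
    and EA: "\<And>t x. 0 \<le> t \<Longrightarrow> t \<le> 1 \<Longrightarrow> x \<in> A \<Longrightarrow> E (t, x) = H (t, x)"
    and EZ: "\<And>t p. 0 \<le> t \<Longrightarrow> t \<le> 1 \<Longrightarrow> p \<in> disk n \<Longrightarrow> E (t, c p) \<in> Z"
    using hep_attached[where Z = Z, OF a f H H0 fZ] by (metis (no_types, lifting))
  have EC: "E (t, x) \<in> C x" if "0 \<le> t" "t \<le> 1" "x \<in> topspace X" for t x
    using that(3)
  proof (cases rule: attached_cases[OF a that(3)])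
    case 1
    then show ?thesis using EA HC that by auto
  next
    case (2 p)
    then show ?thesis using EZ[of t p] that CZ(2)[of x] odisk_subset by auto
  qed
  let ?f' = "\<lambda>x. E (1, x)"
  have ff': "homotopic_with (\<lambda>k. \<forall>x\<in>topspace X. k x \<in> C x) X Y f ?f'"
    by (subst homotopic_with) (use E E0 EC in \<open>auto intro!: exI[of _ E]\<close>)
  then have f': "continuous_map X Y ?f'"
    using homotopic_with_imp_continuous_maps by blast
  have cf: "continuous_map (D_top n) (subtopology Y Z) (\<lambda>p. ?f' (c p))"
    using continuous_map_compose[OF attachedD(4)[OF a] f'] EZ
    by (auto simp: continuous_map_in_subtopology o_def)
  have cg: "continuous_map (D_top n) (subtopology Y Z) (\<lambda>p. g (c p))"
    using continuous_map_compose[OF attachedD(4)[OF a] g] gZ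
    by (auto simp: continuous_map_in_subtopology o_def)
  obtain z h where h: "continuous_map (prod_topology I_top (subtopology Y Z)) (subtopology Y Z) h"
      "\<And>x. h (0, x) = x" "\<And>x. h (1, x) = z"
    using Z unfolding contractible_space_def homotopic_with_def by auto
  have ch: "continuous_map (ID_top n) (subtopology Y Z) (\<lambda>w. h (fst w, k (snd w)))"
    if "continuous_map (D_top n) (subtopology Y Z) k" for k
  proof -
    have 1: "continuous_map (ID_top n) (D_top n) snd" and 2: "continuous_map (ID_top n) I_top fst"
      by (auto intro!: continuous_intros)
    have "continuous_map (ID_top n) (prod_topology I_top (subtopology Y Z)) (\<lambda>w. (fst w, k (snd w)))"
      by (rule continuous_map_pairedI[OF 2 continuous_map_compose'[OF 1 that]])
    then show ?thesis using h(1) by (rule continuous_map_compose')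
  qed
  have fgs: "E (1, c s) = g (c s)" if "s \<in> sph n" for s
    using EA[of 1 "c s"] H1 attachedD(5)[OF a that] by simp
  \<comment> \<open>Following a contraction of \<open>Z\<close> gives homotopies from both maps to
    the same constant which agree on the sphere, so the maps themselves are homotopic relative to
    the sphere.\<close>
  have rel: "homotopic_with (\<lambda>k. \<forall>s\<in>sph n. k s = E (1, c s)) (D_top n) (subtopology Y Z)
       (\<lambda>p. E (1, c p)) (\<lambda>p. g (c p))"
    using hep_disk_unique_rev[OF ch[OF cf] ch[OF cg]] h fgs by auto
  have "homotopic_with (\<lambda>k. (\<forall>x\<in>A. k x = ?f' x) \<and> (\<forall>x\<in>topspace X - A. k x \<in> Z)) X Y ?f' g"
    by (rule homotopic_rel_cell[OF a f' _ rel]) (use EA H1 in auto)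
  then have "homotopic_with (\<lambda>k. \<forall>x\<in>topspace X. k x \<in> C x) X Y ?f' g"
    by (rule homotopic_with_mono) (metis CZ(2) DiffI EC order_refl zero_le_one)
  then show ?thesis using homotopic_with_trans[OF ff'] by blast
qed

section \<open>Mapping cones, expansions and gluing\<close>

lemma homotopic_withI:
  assumes "continuous_map (prod_topology I_top X) Y h"
    "\<And>x. x \<in> topspace X \<Longrightarrow> h (0, x) = f x" "\<And>x. x \<in> topspace X \<Longrightarrow> h (1, x) = g x"
  shows "homotopic_with (\<lambda>_. True) X Y f g"
  by (subst homotopic_with) (use assms in auto)

lemma continuous_map_ID_snd:
  "continuous_map (D_top n) Y k \<Longrightarrow> continuous_map (ID_top n) Y (\<lambda>w. k (snd w))"
  by (rule continuous_map_compose'[of _ "D_top n"]) (auto intro!: continuous_intros)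

text \<open>The null homotopy of the identity is built in three stages: make it constant on \<open>B\<close>,
  precompose with an extension of \<open>h \<circ> c\<close> to the disk, and contract the disk.\<close>

theorem contractible_attached:
  assumes a: "attached Z B n c" and he: "homotopy_equivalence (S_top n) (subtopology Z B) c"
  shows "contractible_space Z"
proof -
  have cS: "continuous_map (S_top n) (subtopology Z B) c"
    using he by (simp add: homotopy_equivalence_def)
  obtain h where h: "continuous_map (subtopology Z B) (S_top n) h"
    and hc: "homotopic_with (\<lambda>_. True) (S_top n) (S_top n) (h \<circ> c) id"
    and ch: "homotopic_with (\<lambda>_. True) (subtopology Z B) (subtopology Z B) (c \<circ> h) id"
    using he by (auto simp: homotopy_equivalence_def)
  have BZ: "B \<subseteq> topspace Z" using attachedD(3)[OF a] .
  have hS: "h b \<in> sph n" if "b \<in> B" for b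
    using h that BZ by (auto simp: continuous_map_def Pi_iff)
  let ?o = "c (\<lambda>_. 0)"
  have o: "?o \<in> topspace Z" using attachedD(9)[OF a] zero_in_disk by blast
  have hB: "continuous_map (prod_topology I_top (subtopology Z B)) (D_top n)
      (\<lambda>w. scl (1 - fst w) (h (snd w)))"
  proof -
    have 1: "continuous_map (prod_topology I_top (subtopology Z B)) (IS_top n) (\<lambda>w. (fst w, h (snd w)))"
      unfolding prod_topology_subtopology_eu[symmetric]
      by (intro continuous_map_pairedI continuous_map_fst continuous_map_compose'[OF continuous_map_snd h])
    have 2: "continuous_map (IS_top n) (D_top n) (\<lambda>v. scl (1 - fst v) (snd v))"
      using sph_subset[of n] by (auto intro!: continuous_intros scl_in_disk)
    show ?thesis using continuous_map_compose'[OF 1 2] by simp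
  qed
  \<comment> \<open>The identity of \<open>B\<close> deforms to \<open>c \<circ> h\<close>, which
    factors through the sphere and becomes null-homotopic in \<open>Z\<close> when the disk is
    shrunk to its centre.\<close>
  have "homotopic_with (\<lambda>_. True) (subtopology Z B) Z id (\<lambda>_. ?o)"
  proof -
    have "homotopic_with (\<lambda>_. True) (subtopology Z B) Z (c \<circ> h) id"
      using homotopic_with_compose_continuous_map_left[OF ch, of Z id "\<lambda>_. True"] by simp
    moreover have "homotopic_with (\<lambda>_. True) (subtopology Z B) Z (c \<circ> h) (\<lambda>_. ?o)"
      by (rule homotopic_withI[OF continuous_map_compose'[OF hB attachedD(4)[OF a]]]) auto
    ultimately show ?thesis using homotopic_with_trans homotopic_with_symD by metis
  qed
  then obtain H where H: "continuous_map (prod_topology I_top (subtopology Z B)) Z H"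
    "\<And>x. H (0, x) = x" "\<And>x. H (1, x) = ?o"
    unfolding homotopic_with_def by auto
  have HZ: "H (t, x) \<in> topspace Z" if "0 \<le> t" "t \<le> 1" "x \<in> B" for t x
    using H(1) that BZ by (auto simp: continuous_map_def Pi_iff)
  obtain E where E: "continuous_map (prod_topology I_top Z) Z E"
    "\<And>x. x \<in> topspace Z \<Longrightarrow> E (0, x) = x" "\<And>x. x \<in> B \<Longrightarrow> E (1, x) = ?o"
    by (rule hep_attached[where f = id and Z = "topspace Z", OF a _ H(1)])
      (use H HZ attachedD(5,9)[OF a] in auto)
  let ?g = "\<lambda>x. E (1, x)"
  have idg: "homotopic_with (\<lambda>_. True) Z Z id ?g"
    by (rule homotopic_withI[OF E(1)]) (use E in auto)
  then have g: "continuous_map Z Z ?g" using homotopic_with_imp_continuous_maps by blast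
  have gc: "continuous_map (D_top n) Z (\<lambda>p. ?g (c p))"
    using attachedD(4)[OF a] g by (rule continuous_map_compose')
  have gcs: "?g (c s) = ?o" if "s \<in> sph n" for s using E(3) attachedD(5)[OF a that] .
  obtain k where k: "continuous_map (IS_top n) (S_top n) k"
    "\<And>s. k (0, s) = s" "\<And>s. k (1, s) = h (c s)"
    using homotopic_with_symD[OF hc] unfolding homotopic_with_def by auto
  have kS: "k (t, s) \<in> sph n" if "0 \<le> t" "t \<le> 1" "s \<in> sph n" for t s
    using k(1) that by (auto simp: Pi_iff)
  have kD: "continuous_map (IS_top n) (D_top n) k"
    using k(1) sph_subset[of n] by auto
  obtain m where m: "continuous_map (ID_top n) (D_top n) m"
    "\<And>p. p \<in> disk n \<Longrightarrow> m (0, p) = p"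
    "\<And>t s. 0 \<le> t \<Longrightarrow> t \<le> 1 \<Longrightarrow> s \<in> sph n \<Longrightarrow> m (t, s) = k (t, s)"
    using hep_disk[where G = "\<lambda>p. p", OF _ kD] k by auto
  let ?q = "\<lambda>p. m (1, p)"
  have q: "continuous_map (D_top n) (D_top n) ?q"
    by (rule continuous_map_compose'[OF _ m(1)]) (auto intro!: continuous_intros)
  have qs: "?q s = h (c s)" if "s \<in> sph n" for s using m(3)[of 1 s] k that by simp
  \<comment> \<open>Since \<open>?g\<close> sends \<open>B\<close> to \<open>?o\<close>, the
    composite of \<open>c\<close> and \<open>?g\<close> may be reparametrised by \<open>?q\<close>
    within its homotopy class. The point of \<open>?q\<close> is that on the sphere it equals
    \<open>h \<circ> c\<close>, so it depends there only on the image in \<open>B\<close>.\<close>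
  let ?g' = "glue n c B (\<lambda>_. ?o) (\<lambda>p. ?g (c (?q p)))"
  have g'c: "?g' (c p) = ?g (c (?q p))" if "p \<in> disk n" for p
    by (rule glue_cell[where g = "\<lambda>p. ?g (c (?q p))", OF a _ that])
      (use qs gcs hS attachedD(5)[OF a] in auto)
  have gg': "homotopic_with (\<lambda>_. True) Z Z ?g ?g'"
  proof (rule homotopic_with_mono[OF homotopic_rel_cell[where Z = "topspace Z", OF a g]])
    show "?g x = ?g' x" if "x \<in> B" for x using that E by (simp add: glue_base)
    have "continuous_map (prod_topology I_top (D_top n)) Z (\<lambda>w. ?g (c (m w)))"
      using continuous_map_compose'[OF m(1) gc] by simp
    then show "homotopic_with (\<lambda>k. \<forall>s\<in>sph n. k s = E (1, c s)) (D_top n) (subtopology Z (topspace Z))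
      (\<lambda>p. E (1, c p)) (\<lambda>p. ?g' (c p))"
      by (subst homotopic_with)
        (use m g'c gcs kS sph_subset in \<open>auto simp: subset_iff intro!: exI[of _ "\<lambda>w. ?g (c (m w))"]\<close>)
  qed auto
  have "homotopic_with (\<lambda>_. True) Z Z ?g' (\<lambda>_. ?g ?o)"
  proof -
    \<comment> \<open>The disk is contracted, along \<open>h\<close> over \<open>B\<close> and along
      \<open>?q\<close> over the cell; the two match on the sphere since
      \<open>?q s = h (c s)\<close>. At time 0 the part over \<open>B\<close> is the constant
      \<open>?o\<close> because \<open>h\<close> takes values in the sphere.\<close>
    let ?f = "\<lambda>w. ?g (c (scl (1 - fst w) (h (snd w))))"
    let ?e = "\<lambda>w. ?g (c (scl (1 - fst w) (?q (snd w))))"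
    have f: "continuous_map (prod_topology I_top (subtopology Z B)) Z ?f"
      using continuous_map_compose'[OF hB gc] .
    have "continuous_map (ID_top n) (D_top n) (\<lambda>v. scl (1 - fst v) (snd v))"
      by (auto intro!: continuous_intros scl_in_disk)
    note m2 = this
    have m1: "continuous_map (ID_top n) (ID_top n) (\<lambda>w. (fst w, ?q (snd w)))"
    proof -
      have "continuous_map (ID_top n) I_top fst"
        by (auto intro!: continuous_intros)
      from continuous_map_pairedI[OF this continuous_map_ID_snd[OF q]] show ?thesis
        by (simp only: prod_topology_subtopology_eu)
    qed
    have "continuous_map (ID_top n) (D_top n) (\<lambda>w. scl (1 - fst w) (?q (snd w)))"
      using continuous_map_compose'[OF m1 m2] by (simp only: fst_conv snd_conv)
    then have e: "continuous_map (ID_top n) Z ?e" using gc by (rule continuous_map_compose')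
    let ?h = "\<lambda>(t, x). glue n c B (\<lambda>x. ?f (t, x)) (\<lambda>p. ?e (t, p)) x"
    have ag: "?f (t, c s) = ?e (t, s)" if "s \<in> sph n" for t s
      using qs that by simp
    have hc: "?h (t, c p) = ?e (t, p)" if "p \<in> disk n" for t p
      using glue_cell[where f = "\<lambda>x. ?f (t, x)" and g = "\<lambda>p. ?e (t, p)", OF a ag that] by simp
    show ?thesis
    proof (rule homotopic_withI)
      show "continuous_map (prod_topology I_top Z) Z ?h"
        by (rule continuous_map_glue_prod[OF a f e ag])
      show "?h (0, x) = ?g' x" if x: "x \<in> topspace Z" for x
        by (rule attached_cases[OF a x])
          (use hc[of _ 0] g'c gcs hS subsetD[OF odisk_subset] in \<open>auto simp: glue_base\<close>)
      show "?h (1, x) = ?g ?o" if x: "x \<in> topspace Z" for x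
        by (rule attached_cases[OF a x])
          (use hc[of _ 1] subsetD[OF odisk_subset] in \<open>auto simp: glue_base\<close>)
    qed
  qed
  then have "homotopic_with (\<lambda>_. True) Z Z id (\<lambda>_. ?g ?o)"
    using idg gg' homotopic_with_trans by metis
  then show ?thesis unfolding contractible_space_def by blast
qed

text \<open>Here \<open>A'\<close> is \<open>A\<close> with the lower cell and \<open>X\<close> is
  \<open>A'\<close> with the upper cell. A retraction onto \<open>A\<close> sends both cells into
  the contractible set \<open>T\<close>; it is homotopic to the identity because the new cells,
  their boundaries and their images all lie in the contractible set \<open>Z\<close>.\<close>

theorem elementary_expansion:
  assumes d: "attached X A' m d" and c: "attached (subtopology X A') A n c"
    and T: "contractible_space (subtopology X T)" "T \<noteq> {}" "T \<subseteq> A"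
    and Z: "contractible_space (subtopology X Z)" "T \<subseteq> Z" "topspace X - A \<subseteq> Z"
    and cT: "c ` sph n \<subseteq> T" and dT: "d ` sph m \<subseteq> T \<union> (A' - A)"
  shows "homotopy_equivalence (subtopology X A) X id"
proof -
  have A': "A' \<subseteq> topspace X" using attachedD(3)[OF d] .
  have AA': "A \<subseteq> A'" using attachedD(3)[OF c] by simp
  have top: "topspace (subtopology X A') = A'" using A' by auto
  have sub: "subtopology (subtopology X A') A = subtopology X A"
    using AA' by (simp add: subtopology_subtopology inf.absorb2)
  have subT: "subtopology (subtopology X A) T = subtopology X T"
    using T by (simp add: subtopology_subtopology inf.absorb2)
  obtain F1 where F1: "continuous_map (subtopology X A') (subtopology X A) F1"
    "\<And>x. x \<in> A \<Longrightarrow> F1 x = id x" "\<And>x. x \<in> A' - A \<Longrightarrow> F1 x \<in> T"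
  proof (rule carrier_extension[where f = id and Y = "subtopology X A" and Z = T, OF c])
    show "continuous_map (subtopology (subtopology X A') A) (subtopology X A) id"
      by (simp add: sub)
    show "T \<subseteq> topspace (subtopology X A)" using T A' AA' by auto
    fix F assume "continuous_map (subtopology X A') (subtopology X A) F" "\<And>x. x \<in> A \<Longrightarrow> F x = id x"
      "\<And>x. x \<in> topspace (subtopology X A') - A \<Longrightarrow> F x \<in> T"
    then show thesis by (intro that[of F]) (use A' in auto)
  qed (use T cT in \<open>auto simp: subT\<close>)
  obtain F where F: "continuous_map X (subtopology X A) F"
    "\<And>x. x \<in> A' \<Longrightarrow> F x = F1 x" "\<And>x. x \<in> topspace X - A' \<Longrightarrow> F x \<in> T"
  proof (rule carrier_extension[where f = F1 and Y = "subtopology X A" and Z = T, OF d F1(1)])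
    \<comment> \<open>A boundary point of the upper cell lies in \<open>T\<close>, where
      \<open>F1\<close> is the identity, or in the open lower cell, which \<open>F1\<close> sends
      into \<open>T\<close>.\<close>
    show "F1 (d s) \<in> T" if "s \<in> sph m" for s
    proof (cases "d s \<in> A")
      case True
      then have "d s \<in> T" using dT that by blast
      then show ?thesis using F1(2) T by auto
    next
      case False
      then have "d s \<in> A' - A" using dT that T by blast
      then show ?thesis using F1(3) by blast
    qed
    show "T \<subseteq> topspace (subtopology X A)" using T A' AA' by auto
  qed (use T in \<open>auto simp: subT\<close>)
  have Fid: "F x = x" if "x \<in> A" for x using F(2) F1(2) AA' that by auto
  have FT: "F x \<in> T" if "x \<in> topspace X - A" for x using F(2,3) F1(3) that by (cases "x \<in> A'") auto
  have FX: "continuous_map X X F" using F(1) continuous_map_in_subtopology by blast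
  \<comment> \<open>On \<open>A\<close> the homotopy is constant, so points outside \<open>Z\<close>
    may get the whole space as carrier; contractibility is asked of \<open>Z\<close> alone.\<close>
  define C where "C = (\<lambda>x. if x \<in> Z then Z else topspace X)"
  have "homotopic_with (\<lambda>k. \<forall>x\<in>A. k x \<in> C x) (subtopology (subtopology X A') A) X id F"
  proof (rule homotopic_with_equal)
    show "\<forall>x\<in>A. id x \<in> C x" "\<forall>x\<in>A. F x \<in> C x"
      using Fid AA' A' by (auto simp: C_def)
    show "continuous_map (subtopology (subtopology X A') A) X id"
      by (intro continuous_map_from_subtopology continuous_map_id)
  qed (use Fid AA' A' in auto)
  note h0 = this
  have CZ: "C x = Z" if "x \<in> Z" for x using that by (simp add: C_def)
  have FZ: "F x \<in> Z" and xZ: "x \<in> Z" if "x \<in> topspace X - A" for x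
    using FT[OF that] Z that by blast+
  have cZ: "c s \<in> Z" if "s \<in> sph n" for s using that cT Z by blast
  have dZ: "d s \<in> Z" if "s \<in> sph m" for s using that dT Z A' by blast
  have "homotopic_with (\<lambda>k. \<forall>x\<in>topspace (subtopology X A'). k x \<in> C x) (subtopology X A') X id F"
    by (rule carrier_homotopy[OF c _ _ h0 Z(1)])
      (simp_all add: CZ FZ xZ cZ continuous_map_from_subtopology FX)
  then have h1: "homotopic_with (\<lambda>k. \<forall>x\<in>A'. k x \<in> C x) (subtopology X A') X id F"
    by (simp only: top)
  have xZ': "x \<in> topspace X - A" if "x \<in> topspace X - A'" for x using that AA' by blast
  have "homotopic_with (\<lambda>k. \<forall>x\<in>topspace X. k x \<in> C x) X X id F"
    by (rule carrier_homotopy[OF d _ _ h1 Z(1)])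
      (use xZ' FZ xZ CZ dZ FX in \<open>simp_all\<close>)
  then have "homotopic_with (\<lambda>_. True) X X F id"
    by (rule homotopic_with_symD[OF homotopic_with_mono]) simp
  moreover have "homotopic_with (\<lambda>_. True) (subtopology X A) (subtopology X A) (F \<circ> id) id"
    by (rule homotopic_with_equal) (use F(1) Fid in \<open>auto intro: continuous_map_from_subtopology\<close>)
  ultimately show ?thesis
    unfolding homotopy_equivalence_def using F(1)
    by (auto intro!: exI[of _ F] continuous_map_from_subtopology)
qed

text \<open>The cells have to correspond only up to a homotopy of pairs. This weak form of the
  hypothesis is reproduced for \<open>F'\<close>, so that \<open>F'\<close> can itself be fed into
  the lemma once \<open>h\<close> is known to have a left inverse.\<close>

lemma attach_left_inverse:
  assumes aX: "attached X A n c" and aL: "attached L B n d"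
    and F: "continuous_map X L F"
    and pr: "homotopic_with (\<lambda>k. \<forall>s\<in>sph n. k s \<in> B) (D_top n) L (\<lambda>p. F (c p)) d"
    and FA: "continuous_map (subtopology X A) (subtopology L B) F"
    and h: "continuous_map (subtopology L B) (subtopology X A) h"
    and k: "homotopic_with (\<lambda>_. True) (subtopology X A) (subtopology X A) id (h \<circ> F)"
  obtains F' where "continuous_map L X F'" "\<And>x. x \<in> B \<Longrightarrow> F' x = h x"
    "homotopic_with (\<lambda>k. \<forall>s\<in>sph n. k s \<in> A) (D_top n) X (\<lambda>p. F' (d p)) c"
    "homotopic_with (\<lambda>_. True) X X id (F' \<circ> F)"
proof -
  have AX: "A \<subseteq> topspace X" and BL: "B \<subseteq> topspace L"
    using attachedD(3)[OF aX] attachedD(3)[OF aL] .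
  have hA: "h b \<in> A" if "b \<in> B" for b
    using h that BL by (auto simp: continuous_map_def Pi_iff)
  have FB: "F x \<in> B" if "x \<in> A" for x
    using FA that AX by (auto simp: continuous_map_def Pi_iff)
  obtain e where e: "continuous_map (ID_top n) L e" "\<And>p. e (0, p) = F (c p)" "\<And>p. e (1, p) = d p"
    and eB: "\<And>t s. 0 \<le> t \<Longrightarrow> t \<le> 1 \<Longrightarrow> s \<in> sph n \<Longrightarrow> e (t, s) \<in> B"
    using pr unfolding homotopic_with_def by auto
  obtain K where K: "continuous_map (prod_topology I_top (subtopology X A)) (subtopology X A) K"
    "\<And>x. K (0, x) = x" "\<And>x. K (1, x) = h (F x)"
    using k unfolding homotopic_with_def by auto
  have KA: "K (t, x) \<in> A" if "0 \<le> t" "t \<le> 1" "x \<in> A" for t x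
    using K(1) that AX by (auto simp: continuous_map_def Pi_iff)
  have KX: "continuous_map (prod_topology I_top (subtopology X A)) X K"
    using K(1) continuous_map_in_subtopology by blast
  have cS: "continuous_map (S_top n) (subtopology X A) c"
    using continuous_map_from_subtopology_mono[OF attachedD(4)[OF aX] sph_subset] attachedD(5)[OF aX]
    by (auto simp: continuous_map_in_subtopology)
  have KS: "continuous_map (IS_top n) X (\<lambda>w. K (fst w, c (snd w)))"
  proof (rule continuous_map_compose'[OF _ KX])
    show "continuous_map (IS_top n) (prod_topology I_top (subtopology X A)) (\<lambda>w. (fst w, c (snd w)))"
      by (intro continuous_map_pairedI continuous_map_compose'[OF _ cS])
        (auto intro!: continuous_intros)
  qed
  obtain E1 where E1: "continuous_map (ID_top n) X E1" "\<And>p. p \<in> disk n \<Longrightarrow> E1 (0, p) = c p"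
    "\<And>t s. 0 \<le> t \<Longrightarrow> t \<le> 1 \<Longrightarrow> s \<in> sph n \<Longrightarrow> E1 (t, s) = K (t, c s)"
    using hep_disk[where G = c, OF attachedD(4)[OF aX] KS] K(2) by auto
  have end1: "continuous_map (D_top n) X (\<lambda>p. E (1, p))" if "continuous_map (ID_top n) X E" for E
    by (rule continuous_map_compose'[OF _ that]) (auto intro!: continuous_intros)
  have hX: "continuous_map (subtopology L B) X h"
    using h continuous_map_in_subtopology by blast
  have heS: "continuous_map (IS_top n) X (\<lambda>w. h (e w))"
  proof (rule continuous_map_compose'[OF _ hX])
    have "continuous_map (IS_top n) L e"
      by (rule continuous_map_from_subtopology_mono[OF e(1)]) (use sph_subset in auto)
    then show "continuous_map (IS_top n) (subtopology L B) e"
      using eB by (auto simp: continuous_map_in_subtopology)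
  qed
  \<comment> \<open>The cell is carried first along \<open>K\<close>, then along
    \<open>h \<circ> e\<close>: the second cylinder starts where the first one ends, and the
    boundary of its top is \<open>h \<circ> d\<close>.\<close>
  obtain E2 where E2: "continuous_map (ID_top n) X E2" "\<And>p. p \<in> disk n \<Longrightarrow> E2 (0, p) = E1 (1, p)"
    "\<And>t s. 0 \<le> t \<Longrightarrow> t \<le> 1 \<Longrightarrow> s \<in> sph n \<Longrightarrow> E2 (t, s) = h (e (t, s))"
    using hep_disk[where G = "\<lambda>p. E1 (1, p)", OF end1[OF E1(1)] heS] E1(3)[of 1] K(3) e(2) by auto
  let ?c3 = "\<lambda>p. E2 (1, p)"
  have c3: "continuous_map (D_top n) X ?c3" using end1[OF E2(1)] .
  have hd3: "h (d s) = ?c3 s" if "s \<in> sph n" for s using E2(3)[of 1 s] e(3) that by simp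
  let ?F' = "glue n d B h ?c3"
  have F': "continuous_map L X ?F'" by (rule continuous_map_glue[OF aL hX c3 hd3])
  have F'B: "?F' x = h x" if "x \<in> B" for x using that by (rule glue_base)
  have F'd: "?F' (d p) = ?c3 p" if "p \<in> disk n" for p
    using glue_cell[where f = h and g = ?c3, OF aL hd3 that] .
  have pairs: "homotopic_with (\<lambda>k. \<forall>s\<in>sph n. k s \<in> A) (D_top n) X (\<lambda>p. ?F' (d p)) c"
  proof -
    have "homotopic_with (\<lambda>k. \<forall>s\<in>sph n. k s \<in> A) (D_top n) X c (\<lambda>p. E1 (1, p))"
      by (subst homotopic_with)
        (use E1 KA attachedD(5)[OF aX] subsetD[OF sph_subset] in \<open>auto intro!: exI[of _ E1]\<close>)
    moreover have "homotopic_with (\<lambda>k. \<forall>s\<in>sph n. k s \<in> A) (D_top n) X (\<lambda>p. E1 (1, p)) (\<lambda>p. ?F' (d p))"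
      by (subst homotopic_with)
        (use E2 hA eB F'd subsetD[OF sph_subset] in \<open>auto intro!: exI[of _ E2]\<close>)
    ultimately show ?thesis
      by (rule homotopic_with_symD[OF homotopic_with_trans])
  qed
  \<comment> \<open>A halfway map: the base has undergone \<open>K\<close>, the cell only the first
    cylinder. The identity is homotopic to it through \<open>K\<close> and \<open>E1\<close>, and
    \<open>?F' \<circ> F\<close> is homotopic to it relative to \<open>A\<close>.\<close>
  let ?w = "glue n c A (\<lambda>x. h (F x)) (\<lambda>p. E1 (1, p))"
  have agw: "h (F (c s)) = E1 (1, s)" if "s \<in> sph n" for s
    using E1(3)[of 1 s] K(3) that by simp
  have wc: "?w (c p) = E1 (1, p)" if "p \<in> disk n" for p
    using glue_cell[where f = "\<lambda>x. h (F x)" and g = "\<lambda>p. E1 (1, p)", OF aX agw that] .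
  have idw: "homotopic_with (\<lambda>_. True) X X id ?w"
  proof -
    let ?h = "\<lambda>(t, x). glue n c A (\<lambda>x. K (t, x)) (\<lambda>p. E1 (t, p)) x"
    have hc: "?h (t, c p) = E1 (t, p)" if "0 \<le> t" "t \<le> 1" "p \<in> disk n" for t p
      using glue_cell[where f = "\<lambda>x. K (t, x)" and g = "\<lambda>p. E1 (t, p)", OF aX _ that(3)] E1(3) that
      by auto
    show ?thesis
    proof (rule homotopic_withI)
      show "continuous_map (prod_topology I_top X) X ?h"
        by (rule continuous_map_glue_prod[OF aX KX E1(1)]) (use E1 in auto)
      show "?h (0, x) = id x" if x: "x \<in> topspace X" for x
        by (rule attached_cases[OF aX x])
          (use hc[of 0] E1 K subsetD[OF odisk_subset] in \<open>auto simp: glue_base\<close>)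
      show "?h (1, x) = ?w x" if x: "x \<in> topspace X" for x
        by (rule attached_cases[OF aX x])
          (use hc[of 1] wc K subsetD[OF odisk_subset] in \<open>auto simp: glue_base\<close>)
    qed
  qed
  have F'F: "continuous_map X X (\<lambda>x. ?F' (F x))" using F F' by (rule continuous_map_compose')
  \<comment> \<open>The cylinders \<open>?F' \<circ> e\<close> and \<open>E2\<close> agree on the
    side and at the top, so their bottoms are homotopic relative to the sphere.\<close>
  have "homotopic_with (\<lambda>k. \<forall>s\<in>sph n. k s = ?F' (e (0, s))) (D_top n) X (\<lambda>p. ?F' (e (0, p))) (\<lambda>p. E2 (0, p))"
    by (rule hep_disk_unique_rev[OF continuous_map_compose'[OF e(1) F'] E2(1)])
      (use e F'd F'B E2 eB in auto)
  then have "homotopic_with (\<lambda>k. \<forall>s\<in>sph n. k s = ?F' (F (c s))) (D_top n) (subtopology X (topspace X))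
      (\<lambda>p. ?F' (F (c p))) (\<lambda>p. ?w (c p))"
    unfolding e(2) subtopology_topspace
    by (rule homotopic_with_eq) (use E2(2) wc subsetD[OF sph_subset] in auto)
  then have "homotopic_with (\<lambda>k. (\<forall>x\<in>A. k x = ?F' (F x)) \<and> (\<forall>x\<in>topspace X - A. k x \<in> topspace X))
      X X (\<lambda>x. ?F' (F x)) ?w"
    by (rule homotopic_rel_cell[OF aX F'F, rotated]) (use F'B FB in \<open>auto simp: glue_base\<close>)
  then have "homotopic_with (\<lambda>_. True) X X (\<lambda>x. ?F' (F x)) ?w"
    by (rule homotopic_with_mono) auto
  then have "homotopic_with (\<lambda>_. True) X X id (?F' \<circ> F)"
    unfolding o_def by (rule homotopic_with_trans[OF idw homotopic_with_symD])
  then show thesis using that F' F'B pairs by blast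
qed

text \<open>Both \<open>F\<close> and its left inverse have left inverses, so no coherence between the two homotopies
  of the given equivalence is needed.\<close>

theorem attach_equivalence:
  assumes aX: "attached X A n c" and aL: "attached L B n d"
    and g: "homotopy_equivalence (subtopology X A) (subtopology L B) g"
    and gc: "\<And>s. s \<in> sph n \<Longrightarrow> g (c s) = d s"
  shows "homotopy_equivalence X L (glue n c A g d)"
proof -
  let ?F = "glue n c A g d"
  obtain h where h: "continuous_map (subtopology L B) (subtopology X A) h"
    and hg: "homotopic_with (\<lambda>_. True) (subtopology X A) (subtopology X A) (h \<circ> g) id"
    and gh: "homotopic_with (\<lambda>_. True) (subtopology L B) (subtopology L B) (g \<circ> h) id"
    and gcont: "continuous_map (subtopology X A) (subtopology L B) g"
    using g by (auto simp: homotopy_equivalence_def)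
  have AX: "A \<subseteq> topspace X" and BL: "B \<subseteq> topspace L"
    using attachedD(3)[OF aX] attachedD(3)[OF aL] .
  have hA: "h b \<in> A" if "b \<in> B" for b
    using h that BL by (auto simp: continuous_map_def Pi_iff)
  have F: "continuous_map X L ?F"
    by (rule continuous_map_glue[OF aX _ attachedD(4)[OF aL] gc])
      (use gcont continuous_map_in_subtopology in blast)
  have FA: "continuous_map (subtopology X A) (subtopology L B) ?F"
    by (rule continuous_map_eq[OF gcont]) (simp add: glue_base)
  have pr: "homotopic_with (\<lambda>k. \<forall>s\<in>sph n. k s \<in> B) (D_top n) L (\<lambda>p. ?F (c p)) d"
    by (rule homotopic_with_equal)
      (use glue_cell[where f = g and g = d, OF aX gc] attachedD[OF aL] subsetD[OF sph_subset] F
        continuous_map_compose'[OF attachedD(4)[OF aX] F] in auto)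
  have k: "homotopic_with (\<lambda>_. True) (subtopology X A) (subtopology X A) id (h \<circ> ?F)"
    by (rule homotopic_with_eq[OF homotopic_with_symD[OF hg]]) (auto simp: glue_base)
  obtain F' where F': "continuous_map L X F'" "\<And>x. x \<in> B \<Longrightarrow> F' x = h x"
    "homotopic_with (\<lambda>k. \<forall>s\<in>sph n. k s \<in> A) (D_top n) X (\<lambda>p. F' (d p)) c"
    "homotopic_with (\<lambda>_. True) X X id (F' \<circ> ?F)"
    using attach_left_inverse[OF aX aL F pr FA h k] by blast
  have F'B: "continuous_map (subtopology L B) (subtopology X A) F'"
    by (rule continuous_map_eq[OF h]) (use F' in auto)
  have k': "homotopic_with (\<lambda>_. True) (subtopology L B) (subtopology L B) id (?F \<circ> F')"
    by (rule homotopic_with_eq[OF homotopic_with_symD[OF gh]]) (use F'(2) hA in \<open>auto simp: glue_base\<close>)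
  obtain F'' where F'': "continuous_map X L F''" "homotopic_with (\<lambda>_. True) L L id (F'' \<circ> F')"
    using attach_left_inverse[OF aL aX F'(1) F'(3) F'B FA k'] by blast
  have u1: "homotopic_with (\<lambda>_. True) X L ((F'' \<circ> F') \<circ> ?F) F''"
    using homotopic_with_compose_continuous_map_left[OF homotopic_with_symD[OF F'(4)] F''(1), of "\<lambda>_. True"]
    by (simp add: comp_assoc)
  have u2: "homotopic_with (\<lambda>_. True) X L ((F'' \<circ> F') \<circ> ?F) ?F"
    using homotopic_with_compose_continuous_map_right[OF homotopic_with_symD[OF F''(2)] F, of "\<lambda>_. True"]
    by simp
  \<comment> \<open>The triple composite is homotopic to both, which identifies the left inverse
    \<open>F''\<close> of \<open>F'\<close> with \<open>?F\<close> up to homotopy.\<close>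
  have "homotopic_with (\<lambda>_. True) X L ?F F''"
    by (rule homotopic_with_trans[OF homotopic_with_symD[OF u2] u1])
  then have "homotopic_with (\<lambda>_. True) L L (?F \<circ> F') (F'' \<circ> F')"
    by (rule homotopic_with_compose_continuous_map_right[OF _ F'(1)]) simp
  then have "homotopic_with (\<lambda>_. True) L L (?F \<circ> F') id"
    by (rule homotopic_with_trans[OF _ homotopic_with_symD[OF F''(2)]])
  then show ?thesis
    unfolding homotopy_equivalence_def using F F'(1) homotopic_with_symD[OF F'(4)]
    by (intro conjI exI[of _ F'])
qed

section \<open>Order complexes and acyclic carriers\<close>

text \<open>Realisation of the order complex by closed conditions: the support is a chain when
  coordinates at incomparable elements are never both nonzero. Closedness and compactness become
  immediate, and the sum 1 excludes an empty support.\<close>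

definition simplices :: "'b::order set \<Rightarrow> ('b \<Rightarrow> real) set" where
  "simplices W = {t. (\<forall>v. 0 \<le> t v) \<and> (\<forall>v. v \<notin> W \<longrightarrow> t v = 0) \<and>
     (\<forall>v w. \<not> (v \<le> w \<or> w \<le> v) \<longrightarrow> t v * t w = 0) \<and> (\<Sum>v\<in>W. t v) = 1}"

lemma geometric_realization_order_complex:
  assumes "finite W"
  shows "geometric_realization (order_complex W) = top_of_set (simplices W)"
proof -
  have "{t. (\<forall>v. 0 \<le> t v) \<and> {v. t v \<noteq> 0} \<in> order_complex W \<and> (\<Sum>v | t v \<noteq> 0. t v) = 1} = simplices W"
    (is "?L = _")
  proof (intro equalityI subsetI)
    fix t assume t: "t \<in> ?L"
    then have s: "{v. t v \<noteq> 0} \<subseteq> W" and ch: "Complete_Partial_Order.chain (\<le>) {v. t v \<noteq> 0}"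
      by (auto simp: order_complex_def)
    have "(\<Sum>v\<in>W. t v) = (\<Sum>v | t v \<noteq> 0. t v)"
      using s assms by (intro sum.mono_neutral_right) auto
    then show "t \<in> simplices W"
      using t s ch by (auto simp: simplices_def chain_def)
  next
    fix t assume t: "t \<in> simplices W"
    then have s: "{v. t v \<noteq> 0} \<subseteq> W"
      by (auto simp: simplices_def)
    have e: "(\<Sum>v\<in>W. t v) = (\<Sum>v | t v \<noteq> 0. t v)"
      using s assms by (intro sum.mono_neutral_right) auto
    have "{v. t v \<noteq> 0} \<noteq> {}"
    proof
      assume "{v. t v \<noteq> 0} = {}"
      then have "(\<Sum>v\<in>W. t v) = 0" by (simp add: e)
      then show False using t by (simp add: simplices_def)
    qed
    moreover have "finite {v. t v \<noteq> 0}" using s assms finite_subset by blast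
    moreover have "Complete_Partial_Order.chain (\<le>) {v. t v \<noteq> 0}"
      using t by (auto simp: simplices_def chain_def)
    ultimately show "t \<in> ?L"
      using t s e by (auto simp: simplices_def order_complex_def)
  qed
  then show ?thesis
    by (simp add: geometric_realization_def euclidean_product_topology)
qed

lemma closed_simplices: "closed (simplices W)"
proof -
  have ev: "continuous_on UNIV (\<lambda>t::'a\<Rightarrow>real. t v)" for v
    by (rule continuous_on_product_then_coordinatewise) (rule continuous_on_id)
  show ?thesis
    unfolding simplices_def
    by (intro closed_Collect_conj closed_Collect_all closed_Collect_imp open_Collect_const
      closed_Collect_le closed_Collect_eq continuous_intros ev)
qed

lemma Hausdorff_space_top_of_set_fun: "Hausdorff_space (top_of_set (S :: ('b \<Rightarrow> real) set))"
  by (intro Hausdorff_space_subtopology)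
    (simp add: euclidean_product_topology[symmetric] Hausdorff_space_product_topology)

lemma closed_singleton_fun: "closed {t :: 'b \<Rightarrow> real}"
  unfolding closed_closedin
  by (rule compactin_imp_closedin) (use Hausdorff_space_top_of_set_fun[of UNIV] in simp_all)

lemma compact_simplices:
  assumes "finite W"
  shows "compact (simplices W)"
proof -
  have c: "compact (PiE UNIV (\<lambda>_::'a. {0..1::real}))"
  proof -
    have "compactin (powertop_real UNIV) (PiE UNIV (\<lambda>_::'a. {0..1::real}))"
      by (subst compactin_PiE) auto
    then show ?thesis by (simp add: euclidean_product_topology)
  qed
  have sub: "simplices W \<subseteq> PiE UNIV (\<lambda>_. {0..1})"
  proof
    fix t assume t: "t \<in> simplices W"
    have "t v \<le> 1" for v
    proof (cases "v \<in> W")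
      case True
      have "t v \<le> (\<Sum>v\<in>W. t v)"
        using t assms True by (intro member_le_sum) (auto simp: simplices_def)
      then show ?thesis using t by (simp add: simplices_def)
    qed (use t in \<open>auto simp: simplices_def\<close>)
    then show "t \<in> PiE UNIV (\<lambda>_. {0..1})" using t by (auto simp: simplices_def)
  qed
  show ?thesis using c sub closed_simplices[of W] by (metis compact_Int_closed inf.absorb_iff2)
qed

lemma simplices_mono:
  assumes "finite W" "V \<subseteq> W"
  shows "simplices V \<subseteq> simplices W"
proof
  fix t assume t: "t \<in> simplices V"
  have "(\<Sum>v\<in>W. t v) = (\<Sum>v\<in>V. t v)"
    using assms t by (intro sum.mono_neutral_right) (auto simp: simplices_def)
  then show "t \<in> simplices W" using t assms by (auto simp: simplices_def)
qed

lemma simplices_restrict: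
  assumes "t \<in> simplices W" "finite W" "V \<subseteq> W" "\<And>v. v \<in> W - V \<Longrightarrow> t v = 0"
  shows "t \<in> simplices V"
proof -
  have "(\<Sum>v\<in>W. t v) = (\<Sum>v\<in>V. t v)"
    using assms by (intro sum.mono_neutral_right) auto
  then show ?thesis using assms by (auto simp: simplices_def)
qed

text \<open>The support is a chain, so its maximal element \<open>z\<close> is its largest. Every
  point thus lies in a piece on which a carried map is controlled.\<close>

lemma simplices_top:
  assumes t: "t \<in> simplices W" and "finite W"
  obtains z where "z \<in> W" "t \<in> simplices {v\<in>W. v \<le> z}"
proof -
  have fin: "finite {v\<in>W. t v \<noteq> 0}" using assms by simp
  have "{v\<in>W. t v \<noteq> 0} \<noteq> {}"
  proof
    assume "{v\<in>W. t v \<noteq> 0} = {}"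
    then have "(\<Sum>v\<in>W. t v) = 0" by (intro sum.neutral) blast
    then show False using t by (simp add: simplices_def)
  qed
  then obtain z where z: "z \<in> {v\<in>W. t v \<noteq> 0}" "\<And>v. v \<in> {v\<in>W. t v \<noteq> 0} \<Longrightarrow> z \<le> v \<Longrightarrow> v = z"
    using finite_has_maximal[OF fin] by blast
  have "t v = 0" if "v \<in> W - {v\<in>W. v \<le> z}" for v
  proof (rule ccontr)
    assume nz: "t v \<noteq> 0"
    then have "t v * t z \<noteq> 0" using z(1) by simp
    then have "v \<le> z \<or> z \<le> v" using t unfolding simplices_def by blast
    then show False using that z(2)[of v] nz by auto
  qed
  then have "t \<in> simplices {v\<in>W. v \<le> z}"
    by (intro simplices_restrict[OF t \<open>finite W\<close>]) auto
  then show thesis using that z(1) by blast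
qed

definition vertex :: "'b \<Rightarrow> 'b \<Rightarrow> real" where
  "vertex y = (\<lambda>v. if v = y then 1 else 0)"

definition cone_map :: "'b \<Rightarrow> real \<times> ('b \<Rightarrow> real) \<Rightarrow> 'b \<Rightarrow> real" where
  "cone_map y = (\<lambda>(u, t) v. (1 - u) * t v + u * vertex y v)"

lemma vertex_in: "finite W \<Longrightarrow> y \<in> W \<Longrightarrow> vertex y \<in> simplices W"
  by (auto simp: simplices_def vertex_def)

lemma cone_map_in:
  assumes t: "t \<in> simplices W" and "finite W" "y \<in> W" "0 \<le> u" "u \<le> 1"
    and top: "\<And>w. w \<in> W \<Longrightarrow> w \<le> y"
  shows "cone_map y (u, t) \<in> simplices W"
proof -
  have "(\<Sum>v\<in>W. cone_map y (u, t) v) = (1 - u) * (\<Sum>v\<in>W. t v) + u * (\<Sum>v\<in>W. vertex y v)"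
    by (simp add: cone_map_def sum.distrib sum_distrib_left)
  also have "\<dots> = 1" using t assms by (simp add: simplices_def vertex_def)
  finally have 1: "(\<Sum>v\<in>W. cone_map y (u, t) v) = 1" .
  have 2: "cone_map y (u, t) v * cone_map y (u, t) w = 0" if "\<not> (v \<le> w \<or> w \<le> v)" for v w
  proof (cases "v = y \<or> w = y")
    case True
    then have "(v = y \<and> w \<notin> W) \<or> (w = y \<and> v \<notin> W)" using that top by blast
    then show ?thesis using t that by (auto simp: cone_map_def simplices_def vertex_def)
  next
    case False
    then have "cone_map y (u, t) v * cone_map y (u, t) w = (1 - u) * (1 - u) * (t v * t w)"
      by (simp add: cone_map_def vertex_def)
    then show ?thesis using t that by (auto simp: simplices_def)
  qed
  show ?thesis
    using assms 1 2 by (auto simp: simplices_def cone_map_def vertex_def)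
qed

lemma continuous_on_cone_map: "continuous_on S (cone_map y)"
proof -
  have 1: "continuous_on S (\<lambda>w. snd w v)" for v
    by (rule continuous_on_product_then_coordinatewise) (intro continuous_intros)
  have "continuous_on S (\<lambda>w v. (1 - fst w) * snd w v + fst w * vertex y v)"
    by (intro continuous_on_coordinatewise_then_product continuous_intros 1)
  then show ?thesis by (simp add: cone_map_def case_prod_unfold)
qed

text \<open>The largest element \<open>y\<close> is comparable with all of \<open>W\<close>, so
  segments to its vertex stay in the realisation, which is a cone.\<close>

lemma contractible_simplices:
  assumes "finite W" "y \<in> W" and top: "\<And>w. w \<in> W \<Longrightarrow> w \<le> y"
  shows "contractible_space (top_of_set (simplices W))"
  unfolding contractible_space_def
proof (intro exI homotopic_withI)
  have "continuous_map (top_of_set ({0..1} \<times> simplices W)) (top_of_set (simplices W)) (cone_map y)"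
    using cone_map_in[OF _ assms(1,2) _ _ top] continuous_on_cone_map by auto
  then show "continuous_map (prod_topology I_top (top_of_set (simplices W))) (top_of_set (simplices W)) (cone_map y)"
    by simp
qed (auto simp: cone_map_def fun_eq_iff)

text \<open>A CW structure is encoded by its face poset: an element \<open>y\<close> of \<open>P\<close> is a closed cell, of
  dimension \<open>d y\<close> and with characteristic map \<open>c y\<close>.\<close>

locale cell_poset =
  fixes X :: "'a topology" and P :: "'a set set" and d :: "'a set \<Rightarrow> nat"
    and c :: "'a set \<Rightarrow> (nat \<Rightarrow> real) \<Rightarrow> 'a"
  assumes Hausdorff: "Hausdorff_space X" and finite_P: "finite P" and top: "topspace X = \<Union>P"
    and cont: "y \<in> P \<Longrightarrow> continuous_map (D_top (d y)) X (c y)"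
    and inj: "y \<in> P \<Longrightarrow> inj_on (c y) (odisk (d y))"
    and image: "y \<in> P \<Longrightarrow> c y ` disk (d y) = y"
    and boundary: "y \<in> P \<Longrightarrow> c y ` sph (d y) = \<Union>{z\<in>P. z < y}"
    and disjoint: "y \<in> P \<Longrightarrow> z \<in> P \<Longrightarrow> y \<noteq> z \<Longrightarrow> c y ` odisk (d y) \<inter> c z ` odisk (d z) = {}"
    and own_disjoint: "y \<in> P \<Longrightarrow> c y ` odisk (d y) \<inter> c y ` sph (d y) = {}"
    and dim_less: "y \<in> P \<Longrightarrow> z \<in> P \<Longrightarrow> z < y \<Longrightarrow> d z < d y"
    and attaching_map: "y \<in> P \<Longrightarrow>
      homotopy_equivalence (S_top (d y)) (subtopology X (c y ` sph (d y))) (c y)"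
begin

section \<open>Down-closed sets of cells and their bodies\<close>

definition downset :: "'a set set \<Rightarrow> bool" where
  "downset Q \<longleftrightarrow> Q \<subseteq> P \<and> (\<forall>y\<in>Q. \<forall>z\<in>P. z < y \<longrightarrow> z \<in> Q)"

abbreviation open_cell :: "'a set \<Rightarrow> 'a set" where
  "open_cell y \<equiv> c y ` odisk (d y)"

abbreviation body :: "'a set set \<Rightarrow> 'a topology" where
  "body Q \<equiv> subtopology X (\<Union>Q)"

lemma cell_decomp: "y \<in> P \<Longrightarrow> y = open_cell y \<union> \<Union>{z\<in>P. z < y}"
  using image[of y] boundary[of y] disk_Un[of "d y"] by blast

lemma cell_cases:
  assumes "y \<in> P" "x \<in> y"
  obtains "x \<in> open_cell y" | z where "z \<in> P" "z < y" "x \<in> z"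
proof -
  have "x \<in> open_cell y \<union> \<Union>{z\<in>P. z < y}" using assms cell_decomp[OF assms(1)] by simp
  then show thesis using that by blast
qed

lemma open_cell_nonempty: "open_cell y \<noteq> {}"
  using zero_in_odisk by blast

lemma in_open_cell: "y \<in> P \<Longrightarrow> x \<in> y \<Longrightarrow> \<exists>w\<in>P. w \<le> y \<and> x \<in> open_cell w"
proof (induction "d y" arbitrary: y rule: less_induct)
  case less
  show ?case
  proof (cases "x \<in> open_cell y")
    case False
    then obtain z where z: "z \<in> P" "z < y" "x \<in> z" using cell_decomp[OF less.prems(1)] less.prems(2) by blast
    then obtain w where "w \<in> P" "w \<le> z" "x \<in> open_cell w"
      using less.hyps[OF dim_less[OF less.prems(1)]] by blast
    then show ?thesis using z by (meson order.trans order_less_imp_le)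
  qed (use less in blast)
qed

text \<open>Inside \<open>z\<close> the point lies in the open cell of some face of
  \<open>z\<close>; disjointness of open cells identifies this face with \<open>y\<close>.\<close>

lemma open_cell_le: "y \<in> P \<Longrightarrow> z \<in> P \<Longrightarrow> x \<in> open_cell y \<Longrightarrow> x \<in> z \<Longrightarrow> y \<le> z"
  using in_open_cell[of z x] disjoint[of y] by blast

lemma closedin_cell: "y \<in> P \<Longrightarrow> closedin X y"
proof -
  assume y: "y \<in> P"
  have "compactin X (c y ` disk (d y))"
    using image_compactin[OF _ cont[OF y]] compact_disk by (simp add: compactin_subtopology)
  then show ?thesis using image[OF y] compactin_imp_closedin[OF Hausdorff] by simp
qed

lemma closedin_Union: "Q \<subseteq> P \<Longrightarrow> closedin X (\<Union>Q)"
  using finite_P closedin_cell finite_subset by (intro closedin_Union) blast+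

lemma Union_subset: "Q \<subseteq> P \<Longrightarrow> \<Union>Q \<subseteq> topspace X"
  using top by blast

lemma topspace_body [simp]: "Q \<subseteq> P \<Longrightarrow> topspace (body Q) = \<Union>Q"
  using Union_subset by auto

lemma body_body: "Q \<subseteq> R \<Longrightarrow> subtopology (body R) (\<Union>Q) = body Q"
  by (simp add: subtopology_subtopology Union_mono inf.absorb2)

text \<open>A point common to the open cell and the body of \<open>Q\<close> would make
  \<open>y\<close> a face of a member of \<open>Q\<close>, hence a member. The lemma translates
  growth of a down-closed set into \<open>attached\<close>.\<close>

lemma attached_cell:
  assumes Q: "downset Q" and y: "y \<in> P" "y \<notin> Q" "\<And>z. z \<in> P \<Longrightarrow> z < y \<Longrightarrow> z \<in> Q"
  shows "attached (body (insert y Q)) (\<Union>Q) (d y) (c y)"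
  unfolding attached_def
proof (intro conjI)
  have QP: "Q \<subseteq> P" using Q by (simp add: downset_def)
  show "Hausdorff_space (body (insert y Q))"
    by (rule Hausdorff_space_subtopology[OF Hausdorff])
  show "closedin (body (insert y Q)) (\<Union>Q)"
    by (rule closedin_subset_topspace[OF closedin_Union[OF QP]]) auto
  show "continuous_map (D_top (d y)) (body (insert y Q)) (c y)"
    using cont[OF y(1)] image[OF y(1)] by (auto simp: continuous_map_in_subtopology)
  show "c y ` sph (d y) \<subseteq> \<Union>Q" using boundary[OF y(1)] y(3) by blast
  show "inj_on (c y) (odisk (d y))" using inj y by blast
  have "open_cell y \<inter> \<Union>Q = {}"
  proof (rule ccontr)
    assume "open_cell y \<inter> \<Union>Q \<noteq> {}"
    then obtain x z where "x \<in> open_cell y" "z \<in> Q" "x \<in> z" by blast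
    then have "y \<le> z" using open_cell_le y QP by blast
    then show False using Q y \<open>z \<in> Q\<close> unfolding downset_def by (metis order_le_less)
  qed
  moreover have "\<Union>(insert y Q) = open_cell y \<union> \<Union>Q"
  proof -
    have "\<Union>{z\<in>P. z < y} \<subseteq> \<Union>Q" using y(3) by blast
    moreover have "y \<union> \<Union>Q = (open_cell y \<union> \<Union>{z\<in>P. z < y}) \<union> \<Union>Q"
      by (rule arg_cong[OF cell_decomp[OF y(1)], of "\<lambda>u. u \<union> \<Union>Q"])
    ultimately show ?thesis by auto
  qed
  moreover have "topspace (body (insert y Q)) = \<Union>(insert y Q)"
    using y QP by (intro topspace_body) simp
  ultimately show "open_cell y = topspace (body (insert y Q)) - \<Union>Q"
    by auto
qed

text \<open>The attaching map is an equivalence from the sphere to the boundary, so filling in the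
  disk leaves nothing. The carrier arguments use h-regularity only in this form.\<close>

lemma contractible_cell:
  assumes y: "y \<in> P"
  shows "contractible_space (subtopology X y)"
proof (rule contractible_attached)
  have sub: "c y ` sph (d y) \<subseteq> y" using image[OF y] sph_subset by blast
  show "attached (subtopology X y) (c y ` sph (d y)) (d y) (c y)"
    unfolding attached_def
  proof (intro conjI)
    show "Hausdorff_space (subtopology X y)"
      by (rule Hausdorff_space_subtopology[OF Hausdorff])
    show "closedin (subtopology X y) (c y ` sph (d y))"
      using boundary[OF y] closedin_Union[of "{z\<in>P. z < y}"] sub by (simp add: closedin_subset_topspace)
    show "continuous_map (D_top (d y)) (subtopology X y) (c y)"
      using cont[OF y] image[OF y] by (auto simp: continuous_map_in_subtopology)
    have "topspace (subtopology X y) = y" using Union_subset[of "{y}"] y by auto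
    then show "open_cell y = topspace (subtopology X y) - c y ` sph (d y)"
      using own_disjoint[OF y] image[OF y] disk_Un[of "d y"] by blast
  qed (use inj y in auto)
  show "homotopy_equivalence (S_top (d y)) (subtopology (subtopology X y) (c y ` sph (d y))) (c y)"
    using attaching_map[OF y] sub by (simp add: subtopology_subtopology inf.absorb2)
qed

lemma cell_nonempty: "y \<in> P \<Longrightarrow> y \<noteq> {}"
  using cell_decomp[of y] open_cell_nonempty[of y] by blast

lemma downset_subset: "downset Q \<Longrightarrow> Q \<subseteq> P"
  by (simp add: downset_def)

lemma downset_finite: "downset Q \<Longrightarrow> finite Q"
  using downset_subset finite_P finite_subset by blast

lemma downset_insert:
  "downset Q \<Longrightarrow> y \<in> P \<Longrightarrow> (\<And>z. z \<in> P \<Longrightarrow> z < y \<Longrightarrow> z \<in> Q) \<Longrightarrow> downset (insert y Q)"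
  unfolding downset_def by blast

text \<open>A maximal element is removed, which keeps the set down-closed and leaves all faces of
  that element in place.\<close>

lemma downset_induct [consumes 1, case_names empty insert]:
  assumes D: "downset D" and "Pr {}"
    and step: "\<And>Q y. downset Q \<Longrightarrow> y \<in> P \<Longrightarrow> y \<notin> Q \<Longrightarrow> (\<And>z. z \<in> P \<Longrightarrow> z < y \<Longrightarrow> z \<in> Q) \<Longrightarrow>
      insert y Q \<subseteq> D \<Longrightarrow> Pr Q \<Longrightarrow> Pr (insert y Q)"
  shows "Pr D"
proof -
  have "Pr Q" if "downset Q" "Q \<subseteq> D" for Q
    using that
  proof (induction "card Q" arbitrary: Q)
    case 0
    then show ?case using downset_finite assms(2) by simp
  next
    case (Suc n)
    have fin: "finite Q" using Suc.prems downset_finite by blast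
    then obtain y where y: "y \<in> Q" "\<And>z. z \<in> Q \<Longrightarrow> y \<le> z \<Longrightarrow> z = y"
      using finite_has_maximal[of Q] Suc.hyps(2) by (metis card.empty nat.distinct(1))
    let ?Q = "Q - {y}"
    have dQ: "downset ?Q"
      unfolding downset_def
    proof (intro conjI ballI impI)
      show "?Q \<subseteq> P" using Suc.prems downset_subset by blast
      fix z w assume "z \<in> ?Q" "w \<in> P" "w < z"
      then show "w \<in> ?Q" using Suc.prems(1) y unfolding downset_def by (metis DiffD1 DiffI order_less_imp_le singletonD less_irrefl)
    qed
    have "Pr (insert y ?Q)"
    proof (rule step[OF dQ])
      show "y \<in> P" using y Suc.prems downset_subset by blast
      show "z \<in> ?Q" if "z \<in> P" "z < y" for z
        using that Suc.prems(1) y(1) unfolding downset_def by blast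
      show "Pr ?Q" by (rule Suc.hyps(1)) (use Suc y fin dQ in auto)
    qed (use y Suc.prems in auto)
    then show ?case using y by (simp add: insert_absorb)
  qed
  then show ?thesis using D by blast
qed

text \<open>The smallest closed cell through the point; it is the carrier for comparing a self-map
  of a body with the identity. \<open>THE\<close> is legitimate because open cells are
  disjoint.\<close>

definition carrier :: "'a \<Rightarrow> 'a set" where
  "carrier x = (THE y. y \<in> P \<and> x \<in> open_cell y)"

lemma carrier_eq: "y \<in> P \<Longrightarrow> x \<in> open_cell y \<Longrightarrow> carrier x = y"
  unfolding carrier_def using disjoint by (intro the_equality) blast+

lemma carrier_subset:
  assumes "y \<in> P" "x \<in> y" shows "carrier x \<in> P" "carrier x \<subseteq> y" "x \<in> carrier x"
proof -
  obtain w where w: "w \<in> P" "w \<le> y" "x \<in> open_cell w" using in_open_cell assms by blast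
  then have "x \<in> w" using cell_decomp by blast
  then show "carrier x \<in> P" "carrier x \<subseteq> y" "x \<in> carrier x" using w carrier_eq by auto
qed

section \<open>Carried maps between a body and the realisation of its order complex\<close>

abbreviation lower :: "'a set \<Rightarrow> 'a set set" where
  "lower y \<equiv> {w\<in>P. w \<le> y}"

lemma finite_lower: "finite (lower y)"
  using finite_P by simp

lemma lower_subset: "downset Q \<Longrightarrow> y \<in> Q \<Longrightarrow> lower y \<subseteq> Q"
  unfolding downset_def by (auto simp: order_le_less)

text \<open>The carrier of a cell \<open>z\<close> is the realisation of the chains below
  \<open>z\<close>, a cone with apex \<open>z\<close>. Only the domain grows with \<open>Q\<close>;
  the target stays at \<open>D\<close>, so one target serves the whole induction.\<close>

lemma to_order_complex:
  assumes D: "downset D" and Q: "downset Q"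
  shows "Q \<subseteq> D \<Longrightarrow> \<exists>f. continuous_map (body Q) (top_of_set (simplices D)) f \<and>
    (\<forall>z\<in>Q. f ` z \<subseteq> simplices (lower z))"
  using Q
proof (induction rule: downset_induct)
  case empty
  show ?case by (auto intro!: exI[of _ undefined] simp: continuous_map_on_empty)
next
  case (insert Q y)
  have a: "attached (body (insert y Q)) (\<Union>Q) (d y) (c y)"
    using attached_cell insert.hyps by blast
  obtain f where f: "continuous_map (body Q) (top_of_set (simplices D)) f"
    "\<And>z. z \<in> Q \<Longrightarrow> f ` z \<subseteq> simplices (lower z)"
  proof -
    have "Q \<subseteq> D" using insert.prems by simp
    then show ?thesis using insert.IH that by blast
  qed
  have finD: "finite D" using D downset_finite by blast
  have lyD: "simplices (lower y) \<subseteq> simplices D"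
    using lower_subset[OF D] insert.prems finD by (intro simplices_mono) auto
  have QP: "insert y Q \<subseteq> P" using insert.hyps downset_subset by blast
  obtain F where F: "continuous_map (body (insert y Q)) (top_of_set (simplices D)) F"
    "\<And>x. x \<in> \<Union>Q \<Longrightarrow> F x = f x"
    "\<And>x. x \<in> topspace (body (insert y Q)) - \<Union>Q \<Longrightarrow> F x \<in> simplices (lower y)"
  proof (rule carrier_extension[where f = f and Y = "top_of_set (simplices D)" and Z = "simplices (lower y)", OF a])
    show "continuous_map (subtopology (body (insert y Q)) (\<Union>Q)) (top_of_set (simplices D)) f"
      by (subst body_body) (use f(1) in auto)
    have "contractible_space (top_of_set (simplices (lower y)))"
      using finite_lower insert.hyps by (intro contractible_simplices[of _ y]) auto
    then show "contractible_space (subtopology (top_of_set (simplices D)) (simplices (lower y)))"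
      using lyD by (simp only: subtopology_subtopology inf.absorb2)
    show "simplices (lower y) \<noteq> {}"
      using vertex_in[OF finite_lower, of y y] insert.hyps by auto
    show "f (c y s) \<in> simplices (lower y)" if "s \<in> sph (d y)" for s
    proof -
      have "c y s \<in> \<Union>{z\<in>P. z < y}" using boundary[OF insert.hyps(2)] that by auto
      then obtain z where z: "z \<in> P" "z < y" "c y s \<in> z" by blast
      then have "f (c y s) \<in> simplices (lower z)" using f(2) insert.hyps by blast
      moreover have "lower z \<subseteq> lower y" using z by auto
      ultimately show ?thesis using simplices_mono[OF finite_lower] by blast
    qed
  qed (use lyD in auto)
  have "F ` z \<subseteq> simplices (lower z)" if "z \<in> insert y Q" for z
  proof (cases "z \<in> Q")
    case True
    show ?thesis
    proof (rule image_subsetI)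
      fix x assume "x \<in> z"
      then show "F x \<in> simplices (lower z)"
        using F(2)[OF UnionI[OF True]] f(2)[OF True] by (auto simp: image_subset_iff)
    qed
  next
    case False
    then have z: "z = y" using that by blast
    show ?thesis
    proof
      fix t assume "t \<in> F ` z"
      then obtain x where x: "x \<in> y" "t = F x" using z by blast
      show "t \<in> simplices (lower z)"
      proof (cases "x \<in> \<Union>Q")
        case True
        then have "x \<notin> open_cell y" using attachedD(7)[OF a] by blast
        then obtain w where w: "w \<in> P" "w < y" "x \<in> w" using cell_cases[OF insert.hyps(2) x(1)] by blast
        then have "f x \<in> simplices (lower w)" using f(2) insert.hyps by blast
        moreover have "lower w \<subseteq> lower y" using w by auto
        ultimately have "f x \<in> simplices (lower y)" using simplices_mono[OF finite_lower] by blast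
        then show ?thesis using F(2)[OF True] x z by simp
      next
        case False
        then show ?thesis using F(3) x z topspace_body[OF QP] by auto
      qed
    qed
  qed
  then show ?case using F(1) by blast
qed

text \<open>The carrier of the chains below \<open>z\<close> is the closed cell \<open>z\<close>.
  The new vertex \<open>y\<close> is maximal, so the part added to the realisation is not a cell but
  a cone over the chains strictly below \<open>y\<close>; the map extends over it by a contraction
  of the closed cell \<open>y\<close>.\<close>

lemma from_order_complex:
  assumes Q: "downset Q"
  shows "\<exists>f. continuous_map (top_of_set (simplices Q)) X f \<and> (\<forall>z\<in>Q. f ` simplices (lower z) \<subseteq> z)"
  using Q
proof (induction rule: downset_induct)
  case empty
  have "simplices {} = ({} :: ('a set \<Rightarrow> real) set)" by (simp add: simplices_def)
  then show ?case by (auto intro!: exI[of _ undefined] simp: continuous_map_on_empty)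
next
  case (insert Q y)
  obtain f where f: "continuous_map (top_of_set (simplices Q)) X f"
    "\<And>z. z \<in> Q \<Longrightarrow> f ` simplices (lower z) \<subseteq> z"
    using insert.IH by blast
  have fin: "finite Q" "finite (insert y Q)" using insert.hyps downset_finite by auto
  let ?B = "{z\<in>P. z < y}"
  have finB: "finite ?B" and BQ: "?B \<subseteq> Q" using finite_P insert.hyps by auto
  have fB: "f t \<in> y" if tB: "t \<in> simplices ?B" for t
  proof -
    obtain z where z: "z \<in> ?B" "t \<in> simplices {v\<in>?B. v \<le> z}"
      using simplices_top[OF tB finB] by blast
    have "{v\<in>?B. v \<le> z} \<subseteq> lower z" by auto
    then have "t \<in> simplices (lower z)" using simplices_mono[OF finite_lower] z(2) by blast
    moreover have "z \<in> Q" "z \<subseteq> y" using BQ z(1) by auto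
    ultimately show ?thesis using f(2) by blast
  qed
  have yX: "y \<subseteq> topspace X" using top insert.hyps by blast
  obtain y0 k where k: "continuous_map (prod_topology I_top (subtopology X y)) (subtopology X y) k"
    "\<And>x. k (0, x) = x" "\<And>x. k (1, x) = y0"
    using contractible_cell[OF insert.hyps(2)] unfolding contractible_space_def homotopic_with_def by auto
  have ky: "k (u, x) \<in> y" if "0 \<le> u" "u \<le> 1" "x \<in> y" for u x
    using k(1) that yX by (auto simp: continuous_map_def Pi_iff)
  have y0: "y0 \<in> y" using ky[of 1] k(3) cell_nonempty insert.hyps by force
  \<comment> \<open>Projects a cone point to the base by dropping the coordinate at \<open>y\<close>
    and rescaling. At the apex, where \<open>t y = 1\<close>, division yields the zero function, on
    which \<open>f\<close> is unspecified; this is harmless as \<open>k (1, _)\<close> is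
    constant.\<close>
  define nrm :: "('a set \<Rightarrow> real) \<Rightarrow> 'a set \<Rightarrow> real"
    where "nrm = (\<lambda>t v. if v = y then 0 else t v / (1 - t y))"
  define F where "F = (\<lambda>t. if t y = 0 then f t else k (t y, f (nrm t)))"
  let ?G = "simplices (insert y Q)"
  have GQ: "simplices Q \<subseteq> ?G" by (rule simplices_mono[OF fin(2)]) auto
  have vG: "vertex y \<in> ?G" by (rule vertex_in[OF fin(2)]) auto
  have t_le: "t v \<le> 1" if "t \<in> ?G" for t v
  proof (cases "v \<in> insert y Q")
    case True
    have "t v \<le> (\<Sum>v\<in>insert y Q. t v)"
      using that fin(2) True by (intro member_le_sum) (auto simp: simplices_def)
    then show ?thesis using that by (simp add: simplices_def)
  qed (use that in \<open>auto simp: simplices_def\<close>)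
  have ty0: "t \<in> simplices Q" if "t \<in> ?G" "t y = 0" for t
    by (rule simplices_restrict[OF that(1) fin(2)]) (use that(2) in auto)
  have Qy0: "t y = 0" if "t \<in> simplices Q" for t
    using that insert.hyps by (simp add: simplices_def)
  have By0: "t y = 0" if "t \<in> simplices ?B" for t
    using that by (simp add: simplices_def)
  have below: "v \<in> ?B" if "t \<in> ?G" "t y \<noteq> 0" "t v \<noteq> 0" "v \<noteq> y" for t v
  proof -
    have v: "v \<in> Q" using that unfolding simplices_def by blast
    have "t v * t y \<noteq> 0" using that by simp
    then have "v \<le> y \<or> y \<le> v" using that(1) unfolding simplices_def by blast
    moreover have "\<not> y < v" using v insert.hyps(1,2,3) unfolding downset_def by blast
    ultimately show ?thesis using that(4) v insert.hyps(1) downset_subset by (auto simp: order_le_less)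
  qed
  have ty1: "t = vertex y" if t: "t \<in> ?G" "t y = 1" for t
  proof
    fix v
    have "(\<Sum>v\<in>Q. t v) = 0"
      using t fin insert.hyps by (simp add: simplices_def)
    moreover have "\<And>v. v \<in> Q \<Longrightarrow> 0 \<le> t v" using t by (simp add: simplices_def)
    ultimately have "\<And>v. v \<in> Q \<Longrightarrow> t v = 0" using sum_nonneg_eq_0_iff[OF fin(1)] by blast
    then show "t v = vertex y v" using t by (cases "v \<in> Q") (auto simp: vertex_def simplices_def)
  qed
  have nB: "nrm t \<in> simplices ?B" if t: "t \<in> ?G" "t y \<noteq> 0" "t y \<noteq> 1" for t
  proof -
    have ty: "t y < 1" using t_le[OF t(1), of y] t(3) by simp
    have "(\<Sum>v\<in>?B. t v) = (\<Sum>v\<in>Q. t v)"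
      using fin(1) BQ below[OF t(1,2)] insert.hyps(3) by (intro sum.mono_neutral_left) auto
    also have "\<dots> = 1 - t y" using t fin insert.hyps by (simp add: simplices_def)
    finally have s: "(\<Sum>v\<in>?B. t v) = 1 - t y" .
    have "(\<Sum>v\<in>?B. nrm t v) = (\<Sum>v\<in>?B. t v / (1 - t y))"
      by (rule sum.cong) (auto simp: nrm_def)
    also have "\<dots> = 1" using s ty by (simp add: sum_divide_distrib[symmetric])
    finally have 1: "(\<Sum>v\<in>?B. nrm t v) = 1" .
    have 2: "nrm t v * nrm t w = 0" if "\<not> (v \<le> w \<or> w \<le> v)" for v w
    proof -
      have "t v * t w = 0" using t(1) that unfolding simplices_def by blast
      then show ?thesis by (auto simp: nrm_def)
    qed
    have 3: "nrm t v = 0" if "v \<notin> ?B" for v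
      using below[OF t(1,2), of v] that by (auto simp: nrm_def)
    have 4: "0 \<le> nrm t v" for v using t(1) ty by (simp add: nrm_def simplices_def)
    show ?thesis unfolding simplices_def using 1 2 3 4 by blast
  qed
  have q: "cone_map y (u, b) \<in> ?G" if "0 \<le> u" "u \<le> 1" "b \<in> simplices ?B" for u b
  proof -
    have "?B \<subseteq> lower y" by auto
    then have "b \<in> simplices (lower y)" using simplices_mono[OF finite_lower] that by blast
    then have "cone_map y (u, b) \<in> simplices (lower y)"
      using that insert.hyps by (intro cone_map_in finite_lower) auto
    moreover have "lower y \<subseteq> insert y Q" using BQ by (auto simp: order_le_less)
    ultimately show ?thesis using simplices_mono[OF fin(2)] by blast
  qed
  have qy: "cone_map y (u, b) y = u" if "b \<in> simplices ?B" for u b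
    using By0[OF that] by (simp add: cone_map_def vertex_def)
  have qn: "nrm (cone_map y (u, b)) = b" if "b \<in> simplices ?B" "u \<noteq> 1" for u b
  proof
    fix v
    show "nrm (cone_map y (u, b)) v = b v"
    proof (cases "v = y")
      case True
      then show ?thesis using By0[OF that(1)] by (simp add: nrm_def)
    next
      case False
      then have "cone_map y (u, b) v = (1 - u) * b v" by (simp add: cone_map_def vertex_def)
      then show ?thesis using qy[OF that(1), of u] that(2) False by (simp add: nrm_def)
    qed
  qed
  have Fq: "F (cone_map y w) = k (fst w, f (snd w))" if wB: "w \<in> {0..1} \<times> simplices ?B" for w
  proof -
    obtain u b where w: "w = (u, b)" "b \<in> simplices ?B" "0 \<le> u" "u \<le> 1" using wB by auto
    consider "u = 0" | "u = 1" | "u \<noteq> 0" "u \<noteq> 1" by blast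
    then show ?thesis
    proof cases
      case 1
      then have "cone_map y w = b" by (simp add: w cone_map_def)
      then show ?thesis using k(2) 1 w By0 by (simp add: F_def)
    next
      case 2
      then show ?thesis using k(3) qy[OF w(2)] by (simp add: F_def w)
    next
      case 3
      then show ?thesis using qn[OF w(2)] qy[OF w(2)] by (simp add: F_def w)
    qed
  qed
  have FQ: "F t = f t" if "t \<in> simplices Q" for t
    using Qy0[OF that] by (simp add: F_def)
  have Fv: "F (vertex y) = y0" using k(3) by (simp add: F_def vertex_def)
  have closed_G: "closed ?G" "closed (simplices Q)"
    by (rule closed_simplices)+
  \<comment> \<open>The apex is a separate closed piece: if \<open>y\<close> is minimal, the base is
    empty and the cone parametrisation has no points that could cover it.\<close>
  have 1: "continuous_map (top_of_set (simplices Q \<union> {vertex y})) X F"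
  proof (rule continuous_map_pieces)
    show "closedin (top_of_set (simplices Q \<union> {vertex y})) (simplices Q)"
      using closed_G by (intro closed_subset) auto
    show "closed_map (top_of_set {vertex y}) (top_of_set (simplices Q \<union> {vertex y})) id"
      by (intro continuous_imp_closed_map) (auto simp: compact_space_subtopology Hausdorff_space_top_of_set_fun)
    show "topspace (top_of_set (simplices Q \<union> {vertex y})) \<subseteq> simplices Q \<union> id ` topspace (top_of_set {vertex y})"
      by auto
    have e: "subtopology (top_of_set (simplices Q \<union> {vertex y})) (simplices Q) = top_of_set (simplices Q)"
      by (simp add: subtopology_subtopology inf.absorb2 subset_insertI)
    show "continuous_map (subtopology (top_of_set (simplices Q \<union> {vertex y})) (simplices Q)) X F"
      unfolding e using f(1) by (rule continuous_map_eq) (use FQ in auto)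
    have "continuous_map (top_of_set {vertex y}) X (\<lambda>_. y0)" using y0 yX by auto
    then show "continuous_map (top_of_set {vertex y}) X (\<lambda>w. F (id w))"
      by (rule continuous_map_eq) (use Fv in auto)
  qed
  have 2: "continuous_map (top_of_set ?G) X F"
  proof (rule continuous_map_pieces)
    show "closedin (top_of_set ?G) (simplices Q \<union> {vertex y})"
      using closed_G GQ vG closed_singleton_fun by (intro closed_subset closed_Un) auto
    have "compact ({0..1::real} \<times> simplices ?B)"
      using compact_simplices[OF finB] by (intro compact_Times) auto
    then have "compact_space (top_of_set ({0..1::real} \<times> simplices ?B))"
      by (simp add: compact_space_subtopology)
    moreover have "continuous_map (top_of_set ({0..1} \<times> simplices ?B)) (top_of_set ?G) (cone_map y)"
      using q continuous_on_cone_map by auto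
    ultimately show "closed_map (top_of_set ({0..1} \<times> simplices ?B)) (top_of_set ?G) (cone_map y)"
      by (intro continuous_imp_closed_map) (auto simp: Hausdorff_space_top_of_set_fun)
    have "t \<in> cone_map y ` ({0..1} \<times> simplices ?B)" if t: "t \<in> ?G" "t \<notin> simplices Q" "t \<noteq> vertex y" for t
    proof -
      have nz: "t y \<noteq> 0" "t y \<noteq> 1" using ty0 ty1 t by blast+
      have "cone_map y (t y, nrm t) = t"
        using nz by (auto simp: cone_map_def nrm_def vertex_def fun_eq_iff)
      moreover have "(t y, nrm t) \<in> {0..1} \<times> simplices ?B"
      proof -
        have "0 \<le> t y" using t(1) by (simp add: simplices_def)
        then show ?thesis using nB[OF t(1) nz] t_le[OF t(1), of y] by simp
      qed
      ultimately show ?thesis by (intro image_eqI[of _ _ "(t y, nrm t)"]) simp_all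
    qed
    then show "topspace (top_of_set ?G) \<subseteq> simplices Q \<union> {vertex y} \<union>
        cone_map y ` topspace (top_of_set ({0..1} \<times> simplices ?B))" by auto
    have "subtopology (top_of_set ?G) (simplices Q \<union> {vertex y}) = top_of_set (simplices Q \<union> {vertex y})"
      using GQ vG by (simp only: subtopology_subtopology) (simp add: Int_absorb1)
    then show "continuous_map (subtopology (top_of_set ?G) (simplices Q \<union> {vertex y})) X F"
      using 1 by simp
    have fBc: "continuous_map (top_of_set (simplices ?B)) (subtopology X y) f"
      using continuous_map_from_subtopology_mono[OF f(1) simplices_mono[OF fin(1) BQ]] fB
      by (auto simp: continuous_map_in_subtopology)
    have "continuous_map (prod_topology I_top (top_of_set (simplices ?B))) (prod_topology I_top (subtopology X y))
        (\<lambda>w. (fst w, f (snd w)))"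
      by (intro continuous_map_pairedI continuous_map_fst continuous_map_compose'[OF continuous_map_snd fBc])
    from continuous_map_compose'[OF this k(1)]
    have "continuous_map (prod_topology I_top (top_of_set (simplices ?B))) X (\<lambda>w. k (fst w, f (snd w)))"
      using continuous_map_in_subtopology by blast
    then have "continuous_map (top_of_set ({0..1} \<times> simplices ?B)) X (\<lambda>w. k (fst w, f (snd w)))"
      by simp
    then show "continuous_map (top_of_set ({0..1} \<times> simplices ?B)) X (\<lambda>w. F (cone_map y w))"
      by (rule continuous_map_eq) (use Fq in auto)
  qed
  have "F ` simplices (lower z) \<subseteq> z" if z: "z \<in> insert y Q" for z
  proof (cases "z \<in> Q")
    case True
    have sub: "simplices (lower z) \<subseteq> simplices Q"
      using lower_subset[OF insert.hyps(1) True] by (rule simplices_mono[OF fin(1)])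
    show ?thesis
    proof (rule image_subsetI)
      fix t assume t: "t \<in> simplices (lower z)"
      then have "F t = f t" using FQ sub by blast
      then show "F t \<in> z" using f(2)[OF True] t by auto
    qed
  next
    case False
    then have zy: "z = y" using z by blast
    have lB: "lower y \<subseteq> insert y Q" using BQ by (auto simp: order_le_less)
    have "F t \<in> y" if t: "t \<in> simplices (lower y)" for t
    proof -
      have tG: "t \<in> ?G" using simplices_mono[OF fin(2) lB] t by blast
      consider "t y = 0" | "t y = 1" | "t y \<noteq> 0" "t y \<noteq> 1" by blast
      then show ?thesis
      proof cases
        case 1
        have "t \<in> simplices ?B"
          by (rule simplices_restrict[OF t finite_lower]) (use 1 in \<open>auto simp: order_le_less\<close>)
        then show ?thesis using 1 fB by (simp add: F_def)
      next
        case 2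
        then show ?thesis using k(3) y0 by (simp add: F_def)
      next
        case 3
        have "0 \<le> t y" using tG by (simp add: simplices_def)
        then show ?thesis using ky[OF _ t_le[OF tG] fB[OF nB[OF tG 3]]] 3 by (simp add: F_def)
      qed
    qed
    then show ?thesis using zy by blast
  qed
  then show ?case using 2 by blast
qed

text \<open>The composite of the two carried maps and the identity both send a point into its
  smallest closed cell. These cells are contractible, so the two maps are homotopic, which is
  domination by a contractible space.\<close>

theorem contractible_downset:
  assumes D: "downset D" and con: "contractible_complex (order_complex D)"
  shows "contractible_space (body D)" "D \<noteq> {}"
proof -
  have fin: "finite D" using D downset_finite by blast
  have con: "contractible_space (top_of_set (simplices D))" "simplices D \<noteq> {}"
    using con geometric_realization_order_complex[OF fin] by (auto simp: contractible_complex_def)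
  then show "D \<noteq> {}" by (auto simp: simplices_def)
  obtain f where f: "continuous_map (body D) (top_of_set (simplices D)) f"
    "\<And>z. z \<in> D \<Longrightarrow> f ` z \<subseteq> simplices (lower z)"
    using to_order_complex[OF D D] by blast
  obtain g where g: "continuous_map (top_of_set (simplices D)) X g"
    "\<And>z. z \<in> D \<Longrightarrow> g ` simplices (lower z) \<subseteq> z"
    using from_order_complex[OF D] by blast
  have gD: "continuous_map (top_of_set (simplices D)) (body D) g"
  proof -
    have "g t \<in> \<Union>D" if tD: "t \<in> simplices D" for t
    proof -
      obtain z where z: "z \<in> D" "t \<in> simplices {v\<in>D. v \<le> z}" using simplices_top[OF tD fin] by blast
      have "{v\<in>D. v \<le> z} \<subseteq> lower z" using D downset_subset by blast
      then have "t \<in> simplices (lower z)" using z(2) simplices_mono[OF finite_lower] by blast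
      then have "g t \<in> z" using g(2)[OF z(1)] by blast
      then show ?thesis using z(1) by blast
    qed
    then show ?thesis using g(1) by (auto simp: continuous_map_in_subtopology)
  qed
  have gf: "g (f x) \<in> carrier x" if "x \<in> \<Union>D" for x
  proof -
    obtain z where z: "z \<in> D" "x \<in> z" using \<open>x \<in> \<Union>D\<close> by blast
    then have zP: "z \<in> P" using D downset_subset by blast
    have "carrier x \<in> D"
      using carrier_subset[OF zP z(2)] D z(1) unfolding downset_def by (metis order_le_less)
    then show ?thesis using carrier_subset[OF zP z(2)] f(2) g(2) by blast
  qed
  have gfc: "continuous_map (body D) (body D) (\<lambda>x. g (f x))"
    using f(1) gD by (rule continuous_map_compose')
  have "Q \<subseteq> D \<Longrightarrow> homotopic_with (\<lambda>k. \<forall>x\<in>\<Union>Q. k x \<in> carrier x) (body Q) (body D) (\<lambda>x. g (f x)) (\<lambda>x. x)"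
    if "downset Q" for Q
    using that
  proof (induction rule: downset_induct)
    case empty
    then show ?case by (intro homotopic_with_equal) (auto simp: continuous_map_on_empty)
  next
    case (insert Q y)
    have a: "attached (body (insert y Q)) (\<Union>Q) (d y) (c y)"
      using attached_cell insert.hyps by blast
    have QP: "insert y Q \<subseteq> P" using insert.hyps downset_subset by blast
    have yD: "y \<in> D" "Q \<subseteq> D" using insert.prems by auto
    have sp: "subtopology (body (insert y Q)) (\<Union>Q) = body Q"
      using body_body[of Q "insert y Q"] by auto
    have op: "x \<in> open_cell y" if "x \<in> topspace (body (insert y Q)) - \<Union>Q" for x
      using attachedD(7)[OF a] that by blast
    have opy: "carrier x = y" "x \<in> y" "x \<in> \<Union>D" if "x \<in> topspace (body (insert y Q)) - \<Union>Q" for x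
      using carrier_eq[OF insert.hyps(2) op[OF that]] cell_decomp[OF insert.hyps(2)] op[OF that] yD by blast+
    have sD: "body (insert y Q) = subtopology (body D) (\<Union>(insert y Q))"
      using body_body[of "insert y Q" D] insert.prems by simp
    have "homotopic_with (\<lambda>k. \<forall>x\<in>topspace (body (insert y Q)). k x \<in> carrier x) (body (insert y Q)) (body D) (\<lambda>x. g (f x)) (\<lambda>x. x)"
    proof (rule carrier_homotopy[OF a, where Z = y])
      show "continuous_map (body (insert y Q)) (body D) (\<lambda>x. g (f x))"
        unfolding sD by (rule continuous_map_from_subtopology[OF gfc])
      have "continuous_map (body D) (body D) (\<lambda>x. x)" by simp
      then show "continuous_map (body (insert y Q)) (body D) (\<lambda>x. x)"
        unfolding sD by (rule continuous_map_from_subtopology)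
      show "homotopic_with (\<lambda>k. \<forall>x\<in>\<Union>Q. k x \<in> carrier x) (subtopology (body (insert y Q)) (\<Union>Q)) (body D)
         (\<lambda>x. g (f x)) (\<lambda>x. x)"
        unfolding sp using insert.IH yD by blast
      have "\<Union>D \<inter> y = y" using yD by blast
      then show "contractible_space (subtopology (body D) y)"
        using contractible_cell[OF insert.hyps(2)] by (simp add: subtopology_subtopology)
      show "carrier (c y s) \<subseteq> y" if "s \<in> sph (d y)" for s
        using carrier_subset(2)[OF insert.hyps(2)] image[OF insert.hyps(2)] that sph_subset by blast
      show "carrier x = y" "x \<in> y" if "x \<in> topspace (body (insert y Q)) - \<Union>Q" for x
        using opy[OF that] by auto
      show "g (f x) \<in> y" if "x \<in> topspace (body (insert y Q)) - \<Union>Q" for x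
        using gf[of x] opy[OF that] by auto
    qed
    then show ?case using topspace_body[OF QP] by simp
  qed
  from homotopic_with_mono[OF this[OF D order_refl], of "\<lambda>_. True"]
  have "homotopic_with (\<lambda>_. True) (body D) (body D) (g \<circ> f) id"
    by (simp add: o_def id_def)
  then show "contractible_space (body D)"
    using homotopy_dominated_contractibility[OF gD f(1) _ con(1)] by blast
qed

end

section \<open>Dimension of matched pairs\<close>

text \<open>The quotient map from the \<open>m\<close>-disk to the \<open>m\<close>-sphere that
  crushes the boundary to a pole. With \<open>N\<close> the squared norm, the height is
  \<open>2 * N - 1\<close>, and the factor \<open>2 * sqrt (1 - N)\<close> is forced by
  \<open>4 * N * (1 - N) + (2 * N - 1)^2 = 1\<close>.\<close>

definition collapse :: "nat \<Rightarrow> (nat \<Rightarrow> real) \<Rightarrow> nat \<Rightarrow> real" where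
  "collapse m p = (\<lambda>i. if i < m then 2 * sqrt (1 - (\<Sum>j<m. (p j)\<^sup>2)) * p i
     else if i = m then 2 * (\<Sum>j<m. (p j)\<^sup>2) - 1 else 0)"

definition north :: "nat \<Rightarrow> nat \<Rightarrow> real" where
  "north m = (\<lambda>i. if i = m then 1 else 0)"

lemma disk_iff: "p \<in> disk n \<longleftrightarrow> (\<forall>i\<ge>n. p i = 0) \<and> (\<Sum>j<n. (p j)\<^sup>2) \<le> 1"
  and odisk_iff: "p \<in> odisk n \<longleftrightarrow> (\<forall>i\<ge>n. p i = 0) \<and> (\<Sum>j<n. (p j)\<^sup>2) < 1"
  and sph_iff: "p \<in> sph n \<longleftrightarrow> (\<forall>i\<ge>n. p i = 0) \<and> (\<Sum>j<n. (p j)\<^sup>2) = 1"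
  by (simp_all add: disk_def odisk_def sph_def L2_set_le_1_iff L2_set_less_1_iff L2_set_eq_1_iff)

lemma collapse_in_sph:
  assumes "p \<in> disk m"
  shows "collapse m p \<in> sph (Suc m)"
proof -
  define N where "N = (\<Sum>j<m. (p j)\<^sup>2)"
  have N: "N \<le> 1" using assms by (simp add: disk_iff N_def)
  have "(\<Sum>j<m. (collapse m p j)\<^sup>2) = (\<Sum>j<m. 4 * (1 - N) * (p j)\<^sup>2)"
    using N by (intro sum.cong) (auto simp: collapse_def power_mult_distrib N_def)
  also have "\<dots> = 4 * (1 - N) * N" by (simp add: N_def sum_distrib_left)
  finally have "(\<Sum>j<Suc m. (collapse m p j)\<^sup>2) = 4 * (1 - N) * N + (2 * N - 1)\<^sup>2"
    by (simp add: collapse_def N_def)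
  also have "\<dots> = 1" by (simp add: power2_eq_square algebra_simps)
  finally show ?thesis by (simp add: sph_iff collapse_def)
qed

lemma collapse_sph: "s \<in> sph m \<Longrightarrow> collapse m s = north m"
  by (auto simp: collapse_def north_def sph_iff fun_eq_iff)

lemma inj_on_collapse: "inj_on (collapse m) (odisk m)"
proof (rule inj_onI)
  fix p q assume p: "p \<in> odisk m" and q: "q \<in> odisk m" and e: "collapse m p = collapse m q"
  have N: "(\<Sum>j<m. (p j)\<^sup>2) = (\<Sum>j<m. (q j)\<^sup>2)"
    using fun_cong[OF e, of m] by (simp add: collapse_def)
  have "sqrt (1 - (\<Sum>j<m. (q j)\<^sup>2)) \<noteq> 0" using q by (simp add: odisk_iff)
  then have "p i = q i" if "i < m" for i
    using fun_cong[OF e, of i] that N by (simp add: collapse_def)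
  then show "p = q" using p q by (auto simp: odisk_iff fun_eq_iff) (metis not_le)
qed

lemma collapse_odisk: "collapse m ` odisk m = sph (Suc m) - {north m}"
proof (intro equalityI subsetI)
  fix x assume "x \<in> collapse m ` odisk m"
  then obtain p where p: "p \<in> odisk m" "x = collapse m p" by blast
  then have "x m \<noteq> 1" by (auto simp: collapse_def odisk_iff)
  then show "x \<in> sph (Suc m) - {north m}"
    using p collapse_in_sph odisk_subset by (auto simp: north_def)
next
  fix x assume x: "x \<in> sph (Suc m) - {north m}"
  define w where "w = x m"
  have s: "(\<Sum>j<m. (x j)\<^sup>2) = 1 - w\<^sup>2" using x by (simp add: sph_iff w_def)
  moreover have "(\<Sum>j<m. (x j)\<^sup>2) \<ge> 0" by (simp add: sum_nonneg)
  ultimately have w2: "w\<^sup>2 \<le> 1" by simp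
  then have w1: "-1 \<le> w" "w \<le> 1" using abs_square_le_1[of w] by auto
  have "w \<noteq> 1"
  proof
    assume w: "w = 1"
    then have "(\<Sum>j<m. (x j)\<^sup>2) = 0" using s by simp
    then have "x j = 0" if "j < m" for j using that by (simp add: sum_nonneg_eq_0_iff)
    then have "x = north m"
      using x w by (auto simp: north_def fun_eq_iff sph_iff w_def) (metis Suc_leI linorder_neqE_nat)
    then show False using x by blast
  qed
  then have w: "w < 1" using w1 by simp
  \<comment> \<open>Inverting the formula: height \<open>w\<close> means squared norm
    \<open>(1 + w) / 2\<close>, so the square root in \<open>collapse\<close> must be
    \<open>r\<close>, and the other coordinates are divided by \<open>2 * r\<close>.\<close>
  define r where "r = sqrt (1 - (1 + w) / 2)"
  have r2: "r\<^sup>2 = (1 - w) / 2" and r: "r > 0" using w by (auto simp: r_def field_simps)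
  define p where "p = (\<lambda>i. if i < m then x i / (2 * r) else 0)"
  have "(\<Sum>j<m. (p j)\<^sup>2) = (\<Sum>j<m. (x j)\<^sup>2 / (4 * r\<^sup>2))"
    by (intro sum.cong) (auto simp: p_def power_divide power_mult_distrib)
  also have "\<dots> = (1 - w\<^sup>2) / (4 * r\<^sup>2)" by (simp add: sum_divide_distrib[symmetric] s)
  also have "\<dots> = (1 + w) / 2" unfolding r2 using w by (simp add: field_simps power2_eq_square)
  finally have N: "(\<Sum>j<m. (p j)\<^sup>2) = (1 + w) / 2" .
  then have "p \<in> odisk m" using w by (simp add: odisk_iff p_def)
  moreover have "collapse m p = x"
  proof
    have sr: "sqrt (1 - (\<Sum>j<m. (p j)\<^sup>2)) = r" by (simp add: N r_def)
    fix i
    consider "i < m" | "i = m" | "i > m" by linarith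
    then show "collapse m p i = x i"
    proof cases
      case 1
      then have "collapse m p i = 2 * r * (x i / (2 * r))"
        unfolding collapse_def sr by (simp add: p_def)
      then show ?thesis using r by simp
    next
      case 2
      then show ?thesis using N by (simp add: collapse_def w_def)
    qed (use x in \<open>auto simp: collapse_def sph_iff\<close>)
  qed
  ultimately show "x \<in> collapse m ` odisk m" by blast
qed

lemma north_in_sph: "north m \<in> sph (Suc m)"
  by (auto simp: north_def sph_iff if_distrib[of "\<lambda>u. u\<^sup>2"] sum.delta cong: if_cong)

lemma attached_sphere: "attached (S_top (Suc m)) {north m} m (collapse m)"
  unfolding attached_def
proof (intro conjI)
  show "Hausdorff_space (S_top (Suc m))" by (simp add: Hausdorff_space_subtopology)
  show "closedin (S_top (Suc m)) {north m}"
    using north_in_sph by (intro closed_subset) auto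
  have c: "continuous_on (disk m) (\<lambda>p. p i)" for i
    by (rule continuous_on_product_then_coordinatewise) (rule continuous_on_id)
  have "continuous_on (disk m) (\<lambda>p. collapse m p i)" for i
    by (cases "i < m"; cases "i = m") (auto simp: collapse_def intro!: continuous_intros c)
  then have "continuous_on (disk m) (collapse m)"
    by (rule continuous_on_coordinatewise_then_product)
  then show "continuous_map (D_top m) (S_top (Suc m)) (collapse m)"
    using collapse_in_sph by auto
qed (auto simp: collapse_sph collapse_odisk inj_on_collapse)

text \<open>Homology in degree \<open>k\<close> is nontrivial for \<open>nsphere k\<close> and
  trivial for \<open>nsphere m\<close>, so its identity cannot factor. As \<open>k > 0\<close>,
  reduced and unreduced groups coincide.\<close>

lemma sphere_not_dominated:
  assumes "m < k" and q: "continuous_map (nsphere k) (nsphere m) q" and s: "continuous_map (nsphere m) (nsphere k) s"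
  shows "\<not> homotopic_with (\<lambda>_. True) (nsphere k) (nsphere k) (s \<circ> q) id"
proof
  assume h: "homotopic_with (\<lambda>_. True) (nsphere k) (nsphere k) (s \<circ> q) id"
  let ?H = "\<lambda>j. homology_group (int k) (nsphere j)"
  have k0: "int k \<noteq> 0" "int k \<noteq> int m" using assms by auto
  have tm: "trivial_group (?H m)"
    using trivial_reduced_homology_group_nsphere[of "int k" m] k0 un_reduced_homology_group[OF k0(1), of "nsphere m"] by metis
  have "z = \<one>\<^bsub>?H k\<^esub>" if z: "z \<in> carrier (?H k)" for z
  proof -
    have "z = hom_induced (int k) (nsphere k) {} (nsphere k) {} id z"
      using hom_induced_id[OF z] by simp
    also have "\<dots> = hom_induced (int k) (nsphere k) {} (nsphere k) {} (s \<circ> q) z"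
      using homology_homotopy_empty[OF h] by simp
    also have "\<dots> = hom_induced (int k) (nsphere m) {} (nsphere k) {} s
        (hom_induced (int k) (nsphere k) {} (nsphere m) {} q z)"
      using hom_induced_compose_empty[OF q s] by simp
    also have "hom_induced (int k) (nsphere k) {} (nsphere m) {} q z = \<one>\<^bsub>?H m\<^esub>"
      using tm hom_induced_carrier[of "int k" "nsphere k" "{}" "nsphere m" "{}" q z]
      unfolding trivial_group_def by blast
    also have "hom_induced (int k) (nsphere m) {} (nsphere k) {} s \<one>\<^bsub>?H m\<^esub> = \<one>\<^bsub>?H k\<^esub>"
      by (rule hom_one[OF hom_induced_empty_hom]) (rule group_relative_homology_group)+
    finally show ?thesis .
  qed
  moreover have g: "group (?H k)" by (rule group_relative_homology_group)
  moreover have "\<one>\<^bsub>?H k\<^esub> \<in> carrier (?H k)"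
    by (rule monoid.one_closed[OF group.is_monoid[OF g]])
  ultimately have "trivial_group (?H k)"
    unfolding trivial_group_def by blast
  then show False
    using trivial_reduced_homology_group_nsphere[of "int k" k] un_reduced_homology_group[OF k0(1), of "nsphere k"] by metis
qed

context cell_poset
begin

text \<open>Up to homotopy the identity of the boundary sphere of \<open>y\<close> factors through the sphere obtained
  by collapsing the contractible complement of \<open>x\<close>, whose dimension is that of \<open>x\<close>.\<close>

theorem dim_admissible_edge:
  assumes x: "x \<in> P" and y: "y \<in> P" and xy: "x < y" and hasse: "\<not> (\<exists>z\<in>P. x < z \<and> z < y)"
    and con: "contractible_space (body ({z\<in>P. z < y} - {x}))" and ne: "{z\<in>P. z < y} - {x} \<noteq> {}"
  shows "d y = Suc (d x)"
proof (rule ccontr)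
  assume "d y \<noteq> Suc (d x)"
  moreover have "d x < d y" using dim_less x y xy by blast
  \<comment> \<open>With \<open>d y = Suc k\<close> the boundary sphere of \<open>y\<close> is
    \<open>nsphere k\<close>; what has to be refuted is \<open>d x < k\<close>.\<close>
  ultimately obtain k where k: "d y = Suc k" "d x < k"
    by (metis Suc_lessI less_imp_Suc_add less_Suc_eq old.nat.exhaust)
  let ?D = "{z\<in>P. z < y} - {x}"
  let ?A = "\<Union>?D"
  let ?N = "body {z\<in>P. z < y}"
  let ?m = "d x"
  have D: "downset ?D"
    unfolding downset_def using hasse x by (auto dest: order.strict_trans)
  have ins: "insert x ?D = {z\<in>P. z < y}" using x xy by blast
  have a: "attached ?N ?A ?m (c x)"
    using attached_cell[OF D x] xy unfolding ins by (auto dest: order.strict_trans)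
  have subN: "subtopology ?N ?A = body ?D"
    by (rule body_body) blast
  have AN: "?A \<subseteq> topspace ?N" using attachedD(3)[OF a] .
  \<comment> \<open>A contraction of the complement to \<open>a0\<close>, extended over the cell
    \<open>x\<close>, deforms the identity of the boundary into a map constant on the complement,
    which therefore factors through a sphere.\<close>
  obtain a0 H where H: "continuous_map (prod_topology I_top (body ?D)) (body ?D) H"
    "\<And>x. H (0, x) = x" "\<And>x. H (1, x) = a0"
    using con unfolding contractible_space_def homotopic_with_def by auto
  obtain z where z: "z \<in> ?D" using ne by blast
  then obtain b where b: "b \<in> z" using cell_nonempty by blast
  have topD: "topspace (body ?D) = ?A" by (rule topspace_body) blast
  have HA: "H (t, x) \<in> ?A" if "0 \<le> t" "t \<le> 1" "x \<in> ?A" for t x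
  proof -
    have "(t, x) \<in> topspace (prod_topology I_top (body ?D))"
      unfolding topspace_prod_topology topD using that by simp
    then have "H (t, x) \<in> topspace (body ?D)"
      by (rule funcset_mem[OF continuous_map_funspace[OF H(1)]])
    then show ?thesis unfolding topD .
  qed
  have "b \<in> ?A" using b z by blast
  then have a0: "a0 \<in> ?A" using HA[of 1 b] H(3)[of b] by simp
  have "continuous_map (prod_topology I_top (subtopology ?N ?A)) (subtopology ?N ?A) H"
    unfolding subN by (rule H(1))
  then have HN: "continuous_map (prod_topology I_top (subtopology ?N ?A)) ?N H"
    by (rule continuous_map_into_fulltopology)
  have H0: "H (0, v) = id v" for v using H(2) by simp
  have idN: "id (c x p) \<in> topspace ?N" if "p \<in> disk ?m" for p
    using attachedD(9)[OF a that] by (simp only: id_apply)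
  have HtN: "H (t, c x s) \<in> topspace ?N" if "0 \<le> t" "t \<le> 1" "s \<in> sph ?m" for t s
    by (rule subsetD[OF AN HA[OF that(1,2) attachedD(5)[OF a that(3)]]])
  obtain E where E: "continuous_map (prod_topology I_top ?N) ?N E"
    "\<And>v. v \<in> topspace ?N \<Longrightarrow> E (0, v) = id v"
    and EH: "\<And>t v. 0 \<le> t \<Longrightarrow> t \<le> 1 \<Longrightarrow> v \<in> ?A \<Longrightarrow> E (t, v) = H (t, v)"
    by (rule hep_attached[OF a continuous_map_id HN H0 idN HtN]) (assumption | rule that)+
  have E3: "E (1, v) = a0" if "v \<in> ?A" for v
    using EH[OF _ _ that, of 1] H(3) by simp
  let ?h = "\<lambda>x. E (1, x)"
  have idh: "homotopic_with (\<lambda>_. True) ?N ?N id ?h"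
    by (rule homotopic_withI[OF E(1)]) (use E in auto)
  then have h: "continuous_map ?N ?N ?h" using homotopic_with_imp_continuous_maps by blast
  \<comment> \<open>Here \<open>?q\<close> crushes the complement to the pole, while
    \<open>?s\<close> sends the pole to \<open>a0\<close> and the rest back through the cell
    \<open>x\<close>. Their composite is exactly \<open>?h\<close>.\<close>
  let ?q = "glue ?m (c x) ?A (\<lambda>_. north ?m) (collapse ?m)"
  let ?s = "glue ?m (collapse ?m) {north ?m} (\<lambda>_. a0) (\<lambda>p. ?h (c x p))"
  have q: "continuous_map ?N (S_top (Suc ?m)) ?q"
    by (rule continuous_map_glue[OF a]) (use north_in_sph attachedD(4)[OF attached_sphere] collapse_sph in auto)
  have hc: "continuous_map (D_top ?m) ?N (\<lambda>p. ?h (c x p))"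
    by (rule continuous_map_compose'[OF attachedD(4)[OF a] h])
  have hs: "a0 = ?h (c x s)" if "s \<in> sph ?m" for s
    using E3 attachedD(5)[OF a that] by simp
  have s: "continuous_map (S_top (Suc ?m)) ?N ?s"
    by (rule continuous_map_glue[OF attached_sphere _ hc hs]) (use a0 AN in auto)
  have sq: "?s (?q v) = ?h v" if v: "v \<in> topspace ?N" for v
  proof (rule attached_cases[OF a v])
    assume "v \<in> ?A"
    then show ?thesis using E3 by (simp add: glue_base)
  next
    fix p assume p: "p \<in> odisk ?m" "v = c x p"
    then have pd: "p \<in> disk ?m" using odisk_subset by blast
    have "?q v = collapse ?m p"
      unfolding p(2) by (rule glue_cell[OF a _ pd]) (simp add: collapse_sph)
    moreover have "?s (collapse ?m p) = ?h (c x p)"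
      using glue_cell[where f = "\<lambda>_. a0" and g = "\<lambda>p. ?h (c x p)", OF attached_sphere hs pd] .
    ultimately show ?thesis using p by simp
  qed
  have idsq: "homotopic_with (\<lambda>_. True) ?N ?N id (?s \<circ> ?q)"
    by (rule homotopic_with_eq[OF idh]) (use sq in auto)
  have "c y ` sph (d y) = \<Union>{z\<in>P. z < y}" using boundary y by blast
  then have "homotopy_equivalence (S_top (d y)) ?N (c y)"
    using attaching_map[OF y] by simp
  then obtain f' where f: "continuous_map (nsphere k) ?N (c y)" and f': "continuous_map ?N (nsphere k) f'"
    and ff: "homotopic_with (\<lambda>_. True) (nsphere k) (nsphere k) (f' \<circ> c y) id"
    unfolding homotopy_equivalence_def k(1) nsphere_eq by blast
  have "homotopic_with (\<lambda>_. True) (nsphere k) ?N (id \<circ> c y) ((?s \<circ> ?q) \<circ> c y)"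
    by (rule homotopic_with_compose_continuous_map_right[OF idsq f]) simp
  then have "homotopic_with (\<lambda>_. True) (nsphere k) (nsphere k) (f' \<circ> (id \<circ> c y)) (f' \<circ> ((?s \<circ> ?q) \<circ> c y))"
    by (rule homotopic_with_compose_continuous_map_left[OF _ f']) simp
  then have "homotopic_with (\<lambda>_. True) (nsphere k) (nsphere k) (f' \<circ> c y) ((f' \<circ> ?s) \<circ> (?q \<circ> c y))"
    by (simp add: comp_assoc)
  then have fin: "homotopic_with (\<lambda>_. True) (nsphere k) (nsphere k) ((f' \<circ> ?s) \<circ> (?q \<circ> c y)) id"
    by (rule homotopic_with_trans[OF homotopic_with_symD ff])
  have "continuous_map (nsphere k) (nsphere ?m) (?q \<circ> c y)"
    unfolding nsphere_eq[of ?m] by (rule continuous_map_compose[OF f q])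
  moreover have "continuous_map (nsphere ?m) (nsphere k) (f' \<circ> ?s)"
    unfolding nsphere_eq[of ?m] by (rule continuous_map_compose[OF s f'])
  ultimately show False using sphere_not_dominated[OF k(2)] fin by blast
qed

end

section \<open>Finite CW complexes\<close>

text \<open>\<open>odisk n\<close> is the full preimage of the open cell, and a closed map
  restricted to a full preimage stays closed.\<close>

lemma attached_homeomorphic:
  assumes a: "attached X A n c"
  shows "homeomorphic_map (top_of_set (odisk n)) (subtopology X (c ` odisk n)) c"
proof (rule bijective_closed_imp_homeomorphic_map)
  have sat: "{p \<in> topspace (D_top n). c p \<in> c ` odisk n} = odisk n"
    using attachedD(5,8)[OF a] disk_Un[of n] by fastforce
  have sub: "subtopology (D_top n) (odisk n) = top_of_set (odisk n)"
    using odisk_subset by (simp add: subtopology_subtopology inf.absorb2)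
  show "closed_map (top_of_set (odisk n)) (subtopology X (c ` odisk n)) c"
    using closed_map_restriction[OF attached_closed_map[OF a] sat] unfolding sub .
  have "continuous_map (top_of_set (odisk n)) X c"
    using continuous_map_from_subtopology_mono[OF attachedD(4)[OF a] odisk_subset] .
  then show "continuous_map (top_of_set (odisk n)) (subtopology X (c ` odisk n)) c"
    by (auto simp: continuous_map_in_subtopology)
  show "c ` topspace (top_of_set (odisk n)) = topspace (subtopology X (c ` odisk n))"
    using attachedD(7)[OF a] by auto
  show "inj_on c (topspace (top_of_set (odisk n)))"
    using attachedD(6)[OF a] by simp
qed

text \<open>With finitely many cells two clauses are automatic: all lower cells together witness
  closure-finiteness, and a set is the finite union of its traces on closed cells.\<close>

lemma finite_cw_complexI:
  assumes "Hausdorff_space (space_of K)" and top: "topspace (space_of K) = (\<Union>n. \<Union>(cells K n))"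
    and "\<And>m n e e'. e \<in> cells K m \<Longrightarrow> e' \<in> cells K n \<Longrightarrow> (m, e) \<noteq> (n, e') \<Longrightarrow> disjnt e e'"
    and "\<And>n e. e \<in> cells K n \<Longrightarrow> continuous_map (D_top n) (space_of K) (char_map K e)"
    and "\<And>n e. e \<in> cells K n \<Longrightarrow>
        homeomorphic_map (top_of_set (odisk n)) (subtopology (space_of K) e) (char_map K e)"
    and "\<And>n e. e \<in> cells K n \<Longrightarrow> char_map K e ` sph n \<subseteq> \<Union>(\<Union>m<n. cells K m)"
    and fin: "finite (\<Union>n. cells K n)"
  shows "finite_cw_complex K"
proof -
  have F: "\<exists>F. finite F \<and> F \<subseteq> (\<Union>m<n. cells K m) \<and>
      char_map K e ` topspace (bounding_sphere n) \<subseteq> \<Union>F" if "e \<in> cells K n" for n e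
  proof (intro exI conjI)
    show "finite (\<Union>m<n. cells K m)" by (rule finite_subset[OF _ fin]) blast
    show "char_map K e ` topspace (bounding_sphere n) \<subseteq> \<Union>(\<Union>m<n. cells K m)"
      using assms(6)[OF that] by (simp add: bounding_sphere_eq)
  qed simp
  have W: "closedin (space_of K) A"
    if "A \<subseteq> topspace (space_of K)" "\<forall>n. \<forall>e\<in>cells K n. closedin (space_of K) (A \<inter> closed_cell K e)" for A
  proof -
    have "A = \<Union>((\<lambda>e. A \<inter> closed_cell K e) ` (\<Union>n. cells K n))"
    proof (intro equalityI subsetI)
      fix x assume x: "x \<in> A"
      then have "x \<in> (\<Union>n. \<Union>(cells K n))" using that(1) top by (metis subsetD)
      then obtain n e where e: "e \<in> cells K n" "x \<in> e" by blast
      have "e \<subseteq> topspace (space_of K)" using e(1) top by blast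
      then have "x \<in> closed_cell K e" using closure_of_subset e(2) by blast
      then show "x \<in> \<Union>((\<lambda>e. A \<inter> closed_cell K e) ` (\<Union>n. cells K n))" using x e by blast
    qed blast
    moreover have "closedin (space_of K) (\<Union>((\<lambda>e. A \<inter> closed_cell K e) ` (\<Union>n. cells K n)))"
      using that(2) fin by (intro closedin_Union) auto
    ultimately show ?thesis by simp
  qed
  show ?thesis
    unfolding finite_cw_complex_def cw_complex_def closed_disk_eq open_disk_eq
    using assms(1-5) F W fin by (auto simp: closedin_Int)
qed

section \<open>The face poset of a finite h-regular complex\<close>

locale finite_cw =
  fixes K :: "'a cell_structure"
  assumes fcw: "finite_cw_complex K"
begin

lemma
  shows cw_Hausdorff: "Hausdorff_space (space_of K)"
    and cw_top: "topspace (space_of K) = (\<Union>n. \<Union>(cells K n))"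
    and cw_finite: "finite (\<Union>n. cells K n)"
  using fcw by (simp_all add: finite_cw_complex_def cw_complex_def)

lemma cw_disjoint: "e \<in> cells K m \<Longrightarrow> e' \<in> cells K n \<Longrightarrow> (m, e) \<noteq> (n, e') \<Longrightarrow> e \<inter> e' = {}"
  using fcw unfolding finite_cw_complex_def cw_complex_def disjnt_def by meson

lemma
  assumes "e \<in> cells K n"
  shows cw_cont: "continuous_map (D_top n) (space_of K) (char_map K e)"
    and cw_homeo: "homeomorphic_map (top_of_set (odisk n)) (subtopology (space_of K) e) (char_map K e)"
    and cw_sph: "char_map K e ` sph n \<subseteq> \<Union>(\<Union>m<n. cells K m)"
proof -
  have *: "continuous_map (D_top n) (space_of K) (char_map K e) \<and>
      homeomorphic_map (top_of_set (odisk n)) (subtopology (space_of K) e) (char_map K e) \<and>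
      (\<exists>F. finite F \<and> F \<subseteq> (\<Union>m<n. cells K m) \<and> char_map K e ` sph n \<subseteq> \<Union>F)"
    using fcw assms
    unfolding finite_cw_complex_def cw_complex_def closed_disk_eq open_disk_eq bounding_sphere_eq
    by (simp only: topspace_euclidean_subtopology)
  then show "continuous_map (D_top n) (space_of K) (char_map K e)"
    "homeomorphic_map (top_of_set (odisk n)) (subtopology (space_of K) e) (char_map K e)" by blast+
  from * obtain F where F: "F \<subseteq> (\<Union>m<n. cells K m)" "char_map K e ` sph n \<subseteq> \<Union>F" by blast
  show "char_map K e ` sph n \<subseteq> \<Union>(\<Union>m<n. cells K m)"
    using order_trans[OF F(2) Union_mono[OF F(1)]] .
qed

lemma cw_subset: "e \<in> cells K n \<Longrightarrow> e \<subseteq> topspace (space_of K)"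
  using cw_top by blast

lemma cw_image_odisk: "e \<in> cells K n \<Longrightarrow> char_map K e ` odisk n = e"
  using homeomorphic_imp_surjective_map[OF cw_homeo] cw_subset by fastforce

lemma cw_inj: "e \<in> cells K n \<Longrightarrow> inj_on (char_map K e) (odisk n)"
  using homeomorphic_imp_injective_map[OF cw_homeo] by fastforce

lemma cw_nonempty: "e \<in> cells K n \<Longrightarrow> e \<noteq> {}"
  using cw_image_odisk zero_in_odisk by blast

lemma cw_unique_dim: "e \<in> cells K n \<Longrightarrow> e \<in> cells K m \<Longrightarrow> n = m"
  using cw_disjoint[of e n e m] cw_nonempty by blast

lemma cw_sph_disjoint:
  assumes e: "e \<in> cells K n" and e': "e' \<in> cells K m" and "n \<le> m"
  shows "char_map K e ` sph n \<inter> e' = {}"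
proof (rule ccontr)
  assume "char_map K e ` sph n \<inter> e' \<noteq> {}"
  then obtain x where x: "x \<in> char_map K e ` sph n" "x \<in> e'" by blast
  then obtain k f where f: "k < n" "f \<in> cells K k" "x \<in> f" using cw_sph[OF e] by blast
  have "f \<inter> e' = {}" by (rule cw_disjoint[OF f(2) e']) (use f(1) assms(3) in auto)
  then show False using f(3) x(2) by blast
qed

lemma cw_closed_cell:
  assumes e: "e \<in> cells K n"
  shows "closed_cell K e = char_map K e ` disk n"
proof (rule closure_of_unique)
  show "e \<subseteq> char_map K e ` disk n" using cw_image_odisk[OF e] odisk_subset by blast
  have "compactin (space_of K) (char_map K e ` disk n)"
    using image_compactin[OF _ cw_cont[OF e]] compact_disk by (simp add: compactin_subtopology)
  then show "closedin (space_of K) (char_map K e ` disk n)"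
    using compactin_imp_closedin[OF cw_Hausdorff] by blast
  fix C assume C: "e \<subseteq> C" "closedin (space_of K) C"
  have "char_map K e ` (D_top n closure_of odisk n) \<subseteq> space_of K closure_of (char_map K e ` odisk n)"
    by (rule continuous_map_image_closure_subset[OF cw_cont[OF e]])
  moreover have "D_top n closure_of odisk n = disk n"
    using odisk_dense[of n] odisk_subset[of n] by (auto simp: closure_of_subtopology inf.absorb2)
  moreover have "space_of K closure_of e \<subseteq> C" using C closure_of_minimal by blast
  ultimately show "char_map K e ` disk n \<subseteq> C" using cw_image_odisk[OF e] by simp
qed

lemma cw_closed_cell_Un: "e \<in> cells K n \<Longrightarrow> closed_cell K e = e \<union> char_map K e ` sph n"
  using cw_closed_cell cw_image_odisk disk_Un by (metis image_Un)

text \<open>Outside \<open>e\<close> its closure consists of images of sphere points, which lie in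
  cells of smaller dimension.\<close>

lemma cw_meets:
  assumes e: "e \<in> cells K n" and e': "e' \<in> cells K m" and ne: "e' \<noteq> e"
    and x: "x \<in> e'" "x \<in> closed_cell K e"
  shows "m < n"
proof (rule ccontr)
  assume "\<not> m < n"
  then have "char_map K e ` sph n \<inter> e' = {}" by (intro cw_sph_disjoint[OF e e']) simp
  moreover have "e' \<inter> e = {}" using cw_disjoint[OF e' e] ne by blast
  ultimately show False using x cw_closed_cell_Un[OF e] by blast
qed

lemma cw_subset_closed: "e \<in> cells K n \<Longrightarrow> e \<subseteq> closed_cell K e"
  using cw_closed_cell_Un by blast

lemma cw_closed_cell_subset_dim:
  assumes e: "e \<in> cells K n" and e': "e' \<in> cells K m" and ne: "e' \<noteq> e"
    and sub: "closed_cell K e' \<subseteq> closed_cell K e"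
  shows "m < n"
proof -
  obtain x where "x \<in> e'" using cw_nonempty[OF e'] by blast
  then show ?thesis using cw_meets[OF e e' ne] cw_subset_closed[OF e'] sub by blast
qed

text \<open>Distinct cells with equal closures would each have smaller dimension than the other.
  Hence closed cells may stand for cells, and dimension and characteristic map are well defined on
  the face poset.\<close>

lemma cw_closed_cell_inj:
  assumes e: "e \<in> cells K n" and e': "e' \<in> cells K m" and eq: "closed_cell K e' = closed_cell K e"
  shows "e' = e \<and> m = n"
proof -
  have "e' = e"
  proof (rule ccontr)
    assume ne: "e' \<noteq> e"
    then have "m < n" using cw_closed_cell_subset_dim[OF e e'] eq by blast
    moreover have "n < m" using cw_closed_cell_subset_dim[OF e' e] eq ne by blast
    ultimately show False by simp
  qed
  then show ?thesis using e e' cw_unique_dim by blast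
qed

definition pick :: "'a set \<Rightarrow> nat \<times> 'a set" where
  "pick y = (SOME ne. snd ne \<in> cells K (fst ne) \<and> y = closed_cell K (snd ne))"

lemma pick_eq: "e \<in> cells K n \<Longrightarrow> pick (closed_cell K e) = (n, e)"
  unfolding pick_def
proof (rule some_equality)
  fix ne assume "e \<in> cells K n" "snd ne \<in> cells K (fst ne) \<and> closed_cell K e = closed_cell K (snd ne)"
  then show "ne = (n, e)" using cw_closed_cell_inj[of "snd ne" "fst ne" e n] by (auto simp: prod_eq_iff)
qed auto

definition cdim :: "'a set \<Rightarrow> nat" where "cdim y = fst (pick y)"
definition cmap :: "'a set \<Rightarrow> (nat \<Rightarrow> real) \<Rightarrow> 'a" where "cmap y = char_map K (snd (pick y))"

text \<open>The subcomplex condition puts every boundary point of a cell into a proper face;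
  conversely, a proper face misses the open cell for reasons of dimension.\<close>

lemma cell_poset_of_cw:
  assumes hr: "h_regular K"
  shows "cell_poset (space_of K) (face_poset K) cdim cmap"
proof -
  have P: "\<exists>n e. e \<in> cells K n \<and> y = closed_cell K e \<and> cdim y = n \<and> cmap y = char_map K e"
    if "y \<in> face_poset K" for y
    using that pick_eq unfolding face_poset_def cdim_def cmap_def by fastforce
  have less_dim: "m < n" if "e \<in> cells K n" "e' \<in> cells K m" "closed_cell K e' < closed_cell K e" for e e' n m
    using cw_closed_cell_subset_dim[OF that(1,2)] that(3) by auto
  show ?thesis
  proof
    show "Hausdorff_space (space_of K)" by (rule cw_Hausdorff)
    have "face_poset K = closed_cell K ` (\<Union>n. cells K n)" by (auto simp: face_poset_def)
    then show "finite (face_poset K)" using cw_finite by simp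
    show "topspace (space_of K) = \<Union>(face_poset K)"
    proof (intro equalityI subsetI)
      fix x assume "x \<in> topspace (space_of K)"
      then obtain n e where e: "e \<in> cells K n" "x \<in> e" unfolding cw_top by blast
      then show "x \<in> \<Union>(face_poset K)" using cw_subset_closed unfolding face_poset_def by blast
    next
      fix x assume "x \<in> \<Union>(face_poset K)"
      then show "x \<in> topspace (space_of K)"
        using closure_of_subset_topspace unfolding face_poset_def by fastforce
    qed
    fix y assume y: "y \<in> face_poset K"
    then obtain n e where e: "e \<in> cells K n" and ye: "y = closed_cell K e" "cdim y = n" "cmap y = char_map K e"
      using P by blast
    show "continuous_map (D_top (cdim y)) (space_of K) (cmap y)" using cw_cont[OF e] ye by simp
    show "inj_on (cmap y) (odisk (cdim y))" using cw_inj[OF e] ye by simp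
    show "cmap y ` disk (cdim y) = y" using cw_closed_cell[OF e] ye by simp
    have sphe: "char_map K e ` sph n \<inter> e = {}" by (rule cw_sph_disjoint[OF e e]) simp
    show "cmap y ` odisk (cdim y) \<inter> cmap y ` sph (cdim y) = {}"
      using sphe cw_image_odisk[OF e] ye by auto
    show "homotopy_equivalence (S_top (cdim y)) (subtopology (space_of K) (cmap y ` sph (cdim y))) (cmap y)"
      using hr e unfolding h_regular_def bounding_sphere_eq ye(2,3) by simp
    show "cmap y ` sph (cdim y) = \<Union>{z\<in>face_poset K. z < y}"
    proof (intro equalityI subsetI)
      fix x assume "x \<in> cmap y ` sph (cdim y)"
      then have x: "x \<in> char_map K e ` sph n" using ye by simp
      obtain F where F: "F \<subseteq> (\<Union>n. cells K n)" "closed_cell K e = \<Union>F" "\<And>f. f \<in> F \<Longrightarrow> closed_cell K f \<subseteq> closed_cell K e"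
        using hr e unfolding h_regular_def subcomplex_def by meson
      have "x \<in> closed_cell K e" using x cw_closed_cell_Un[OF e] by blast
      then obtain f m where f: "f \<in> F" "x \<in> f" "f \<in> cells K m" using F(1,2) by blast
      have "f \<noteq> e" using sphe x f by blast
      then have "closed_cell K f \<noteq> closed_cell K e" using cw_closed_cell_inj[OF e f(3)] by blast
      then have "closed_cell K f < y" using F(3)[OF f(1)] ye by blast
      moreover have "closed_cell K f \<in> face_poset K" using f unfolding face_poset_def by blast
      moreover have "x \<in> closed_cell K f" using f cw_subset_closed by blast
      ultimately show "x \<in> \<Union>{z\<in>face_poset K. z < y}" by blast
    next
      fix x assume "x \<in> \<Union>{z\<in>face_poset K. z < y}"
      then obtain z where z: "z \<in> face_poset K" "z < y" "x \<in> z" by blast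
      then obtain m f where f: "f \<in> cells K m" and zf: "z = closed_cell K f" using P by blast
      have m: "m < n" using less_dim[OF e f] z(2) zf ye by simp
      have "x \<notin> e"
      proof
        assume "x \<in> e"
        have "e \<noteq> f" using zf ye z(2) by auto
        then have "n < m" using cw_meets[OF f e] \<open>x \<in> e\<close> z(3) zf by blast
        then show False using m by simp
      qed
      moreover have "x \<in> closed_cell K e" using z ye by auto
      ultimately show "x \<in> cmap y ` sph (cdim y)" using cw_closed_cell_Un[OF e] ye by auto
    qed
    fix z assume z: "z \<in> face_poset K"
    then obtain m f where f: "f \<in> cells K m" and zf: "z = closed_cell K f" "cdim z = m" "cmap z = char_map K f"
      using P by blast
    show "cdim z < cdim y" if "z < y"
      using less_dim[OF e f] that zf ye by simp
    show "cmap y ` odisk (cdim y) \<inter> cmap z ` odisk (cdim z) = {}" if "y \<noteq> z"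
      using cw_disjoint[OF e f] cw_image_odisk[OF e] cw_image_odisk[OF f] that zf ye by auto
  qed
qed

end

text \<open>Fresh coordinates replace the quotient space: the new cell leaves \<open>T\<close> in
  directions in which \<open>T\<close> is zero, so the result is again a subset of a Euclidean
  space. The hypothesis on the image of \<open>f\<close> keeps it a CW complex.\<close>

theorem attach_euclidean:
  fixes L :: "(nat \<Rightarrow> real) cell_structure"
  assumes L: "finite_cw_complex L" and T: "space_of L = top_of_set T" and N: "T \<subseteq> topspace (Euclidean_space N)"
    and f: "continuous_map (S_top n) (top_of_set T) f" and sk: "f ` sph n \<subseteq> \<Union>(\<Union>m<n. cells L m)"
  obtains L' :: "(nat \<Rightarrow> real) cell_structure" and T' N' j where
    "finite_cw_complex L'" "space_of L' = top_of_set T'" "T' \<subseteq> topspace (Euclidean_space N')"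
    "attached (top_of_set T') T n j" "\<And>s. s \<in> sph n \<Longrightarrow> j s = f s"
    "cells L' = (cells L)(n := insert (j ` odisk n) (cells L n))"
    "\<And>m. j ` odisk n \<notin> cells L m"
proof -
  interpret finite_cw L using L by unfold_locales
  have Tz: "x i = 0" if "x \<in> T" "i \<ge> N" for x i
    using N that by (auto simp: topspace_Euclidean_space)
  have fT: "f s \<in> T" if "s \<in> sph n" for s using f that by auto
  have EN: "Euclidean_space N = top_of_set {x. \<forall>i\<ge>N. x i = 0}"
    by (simp add: Euclidean_space_def euclidean_product_topology)
  have "continuous_map (S_top n) (Euclidean_space N) f"
    using f N unfolding EN by (auto simp: topspace_Euclidean_space)
  then obtain u where u: "continuous_map (D_top n) (Euclidean_space N) u" "\<And>s. s \<in> sph n \<Longrightarrow> u s = f s"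
    by (rule disk_extension) (auto simp: topspace_Euclidean_space)
  \<comment> \<open>\<open>u\<close> fills \<open>f\<close> in the contractible space
    \<open>Euclidean_space N\<close>. The factor \<open>1 - L2_set p {..<n}\<close> makes the fresh
    coordinates vanish on the sphere; on the open disk it is positive, so coordinate
    \<open>N\<close> separates the cell from \<open>T\<close>, and dividing by it recovers
    \<open>p\<close>.\<close>
  define j where "j = (\<lambda>p i. if i < N then u p i else if i = N then 1 - L2_set p {..<n}
      else (1 - L2_set p {..<n}) * p (i - N - 1))"
  have js: "j s = f s" if "s \<in> sph n" for s
    using that u(2) Tz[OF fT[OF that]] by (auto simp: j_def sph_def fun_eq_iff)
  have jN: "j p N > 0" if "p \<in> odisk n" for p
    using that by (simp add: j_def odisk_def)
  have jz: "j p i = 0" if "p \<in> disk n" "i > N + n" for p i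
    using that by (auto simp: j_def disk_def)
  define T' where "T' = T \<union> j ` odisk n"
  have jT: "j ` odisk n \<inter> T = {}" using jN Tz by fastforce
  have T'N: "T' \<subseteq> topspace (Euclidean_space (Suc (N + n)))"
    using jz Tz odisk_subset[of n] by (auto simp: T'_def topspace_Euclidean_space)
  have jT': "j p \<in> T'" if "p \<in> disk n" for p
    using that js fT disk_Un[of n] by (auto simp: T'_def)
  have cj: "continuous_on (disk n) j"
  proof (rule continuous_on_coordinatewise_then_product)
    fix i
    have "continuous_on (disk n) u" using u(1) unfolding EN by simp
    then have 1: "continuous_on (disk n) (\<lambda>p. u p i)"
      by (rule continuous_on_product_then_coordinatewise)
    have 2: "continuous_on (disk n) (\<lambda>p. p k)" for k
      by (rule continuous_on_product_then_coordinatewise) (rule continuous_on_id)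
    consider "i < N" | "i = N" | "i > N" by linarith
    then show "continuous_on (disk n) (\<lambda>p. j p i)"
      by cases (auto simp: j_def intro!: continuous_intros 1 2)
  qed
  have att: "attached (top_of_set T') T n j"
    unfolding attached_def
  proof (intro conjI)
    show "Hausdorff_space (top_of_set T')" by (simp add: Hausdorff_space_subtopology)
    have "T = T' \<inter> {x. x N = 0}" using jN Tz by (force simp: T'_def)
    moreover have "closed {x::nat \<Rightarrow> real. x N = 0}"
      by (intro closed_Collect_eq continuous_intros continuous_on_product_then_coordinatewise)
    ultimately show "closedin (top_of_set T') T" by (metis closedin_closed_Int)
    show "continuous_map (D_top n) (top_of_set T') j" using cj jT' by auto
    show "j ` sph n \<subseteq> T" using js fT by auto
    show "j ` odisk n = topspace (top_of_set T') - T" using jT by (auto simp: T'_def)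
    show "inj_on j (odisk n)"
    proof (rule inj_onI)
      fix p q assume p: "p \<in> odisk n" and q: "q \<in> odisk n" and e: "j p = j q"
      have 1: "L2_set p {..<n} = L2_set q {..<n}" using fun_cong[OF e, of N] by (simp add: j_def)
      show "p = q"
      proof
        fix i show "p i = q i"
          using fun_cong[OF e, of "Suc (N + i)"] 1 q by (simp add: j_def odisk_def)
      qed
    qed
  qed
  let ?e = "j ` odisk n"
  let ?cm = "(char_map L)(?e := j)"
  define L' where "L' = \<lparr>space_of = top_of_set T', cells = (cells L)(n := insert ?e (cells L n)), char_map = ?cm\<rparr>"
  have ene: "?e \<noteq> {}" using zero_in_odisk by blast
  have subT: "e \<subseteq> T" if "e \<in> cells L m" for e m using cw_subset[OF that] T by simp
  have nc: "?e \<notin> cells L m" for m using subT[of ?e m] jT ene by blast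
  have cells': "e \<in> cells L' m \<longleftrightarrow> e \<in> cells L m \<or> (m = n \<and> e = ?e)" for e m
    by (auto simp: L'_def)
  have cm: "char_map L' e = char_map L e" if "e \<in> cells L m" for e m
    using nc that by (auto simp: L'_def)
  have cme: "char_map L' ?e = j" by (simp add: L'_def)
  have sp: "space_of L' = top_of_set T'" by (simp add: L'_def)
  have TT': "T \<subseteq> T'" by (simp add: T'_def)
  have Ttop: "T = (\<Union>m. \<Union>(cells L m))" using cw_top T by simp
  have "finite_cw_complex L'"
  proof (rule finite_cw_complexI)
    show "Hausdorff_space (space_of L')" using sp attachedD(1)[OF att] by simp
    show "topspace (space_of L') = (\<Union>m. \<Union>(cells L' m))"
    proof (intro equalityI subsetI)
      fix x assume "x \<in> topspace (space_of L')"
      then have "x \<in> T \<or> x \<in> ?e" by (simp add: sp T'_def)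
      then show "x \<in> (\<Union>m. \<Union>(cells L' m))"
        using cells' Ttop by blast
    next
      fix x assume "x \<in> (\<Union>m. \<Union>(cells L' m))"
      then obtain m e where e: "e \<in> cells L' m" "x \<in> e" by blast
      from e(1) consider "e \<in> cells L m" | "e = ?e" unfolding cells' by (elim disjE conjE)
      then have "x \<in> T \<or> x \<in> ?e"
        by cases (use subT e(2) in \<open>auto dest: subsetD\<close>)
      then show "x \<in> topspace (space_of L')" by (simp add: sp T'_def)
    qed
    have "(\<Union>m. cells L' m) \<subseteq> insert ?e (\<Union>m. cells L m)" using cells' by blast
    then show "finite (\<Union>m. cells L' m)" using cw_finite finite_subset by blast
    fix m e assume e: "e \<in> cells L' m"
    show "disjnt e e'" if e': "e' \<in> cells L' k" "(m, e) \<noteq> (k, e')" for k e'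
    proof -
      have old: "g \<inter> ?e = {}" if "g \<in> cells L i" for g i using subT[OF that] jT by blast
      from e[unfolded cells'] e'(1)[unfolded cells']
      consider "e \<in> cells L m" "e' \<in> cells L k" | "e \<in> cells L m" "e' = ?e" | "e = ?e" "e' \<in> cells L k"
        | "m = n" "k = n" "e = ?e" "e' = ?e" by argo
      then have "e \<inter> e' = {}"
      proof cases
        case 1
        then show ?thesis using cw_disjoint e'(2) by simp
      next
        case 2
        then show ?thesis using old by simp
      next
        case 3
        then show ?thesis using old[of e'] by (simp add: Int_commute)
      qed (use e'(2) in simp)
      then show ?thesis by (simp add: disjnt_def)
    qed
    show "continuous_map (D_top m) (space_of L') (char_map L' e)"
    proof (cases "e \<in> cells L m")
      case True
      then show ?thesis using cw_cont[OF True] TT' unfolding cm[OF True] T sp by auto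
    next
      case False
      then have "m = n" "e = ?e" using e cells' by auto
      then show ?thesis using attachedD(4)[OF att] cme sp by simp
    qed
    show "homeomorphic_map (top_of_set (odisk m)) (subtopology (space_of L') e) (char_map L' e)"
    proof (cases "e \<in> cells L m")
      case True
      have "subtopology (top_of_set T') e = subtopology (top_of_set T) e"
        using subT[OF True] TT' by (simp add: subtopology_subtopology inf.absorb2)
      then show ?thesis using cw_homeo[OF True] unfolding cm[OF True] T sp by simp
    next
      case False
      then have "m = n" "e = ?e" using e cells' by auto
      then show ?thesis using attached_homeomorphic[OF att] cme sp by simp
    qed
    show "char_map L' e ` sph m \<subseteq> \<Union>(\<Union>k<m. cells L' k)"
    proof (cases "e \<in> cells L m")
      case True
      have "\<Union>(\<Union>k<m. cells L k) \<subseteq> \<Union>(\<Union>k<m. cells L' k)"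
        by (intro Union_mono UN_mono) (auto simp: cells')
      then show ?thesis using cw_sph[OF True] unfolding cm[OF True] by (rule order_trans[rotated])
    next
      case False
      then have me: "m = n" "e = ?e" using e cells' by auto
      have "j ` sph n = f ` sph n" using js by auto
      moreover have "\<Union>(\<Union>k<n. cells L k) \<subseteq> \<Union>(\<Union>k<n. cells L' k)"
        by (intro Union_mono UN_mono) (auto simp: cells')
      ultimately show ?thesis using sk unfolding me cme by simp
    qed
  qed
  then show thesis
    using that[OF _ sp T'N att js] nc by (simp add: L'_def)
qed

section \<open>Stages of the Morse filtration\<close>

definition euclidean_cw :: "(nat \<Rightarrow> real) cell_structure \<Rightarrow> bool" where
  "euclidean_cw L \<longleftrightarrow> finite_cw_complex L \<and>
     (\<exists>T N. space_of L = top_of_set T \<and> T \<subseteq> topspace (Euclidean_space N))"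

lemma homotopy_equivalent_space_iff:
  "X homotopy_equivalent_space Y \<longleftrightarrow> (\<exists>f. homotopy_equivalence X Y f)"
  unfolding homotopy_equivalent_space_def homotopy_equivalence_def by blast

lemma empty_euclidean_cw:
  "euclidean_cw \<lparr>space_of = top_of_set {}, cells = (\<lambda>_. {}), char_map = undefined\<rparr>"
  unfolding euclidean_cw_def
  by (intro conjI finite_cw_complexI exI[of _ "{}"]) (auto simp: Hausdorff_space_subtopology)

locale morse_cell_poset = cell_poset +
  fixes M :: "('a set \<times> 'a set) set"
  assumes admissible: "admissible_morse_matching P M"
begin

lemma M_edge: "(x, y) \<in> M \<Longrightarrow> x \<in> P \<and> y \<in> P \<and> x < y \<and> \<not> (\<exists>z\<in>P. x < z \<and> z < y)"
  using admissible
  unfolding admissible_morse_matching_def morse_matching_def matching_def hasse_edges_def by blast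

lemma M_unique:
  assumes "(x, y) \<in> M" "(x', y') \<in> M" "{x, y} \<inter> {x', y'} \<noteq> {}"
  shows "x = x'" "y = y'"
proof -
  have "(x, y) \<noteq> (x', y') \<longrightarrow> disjnt {x, y} {x', y'}"
    using admissible assms(1,2)
    unfolding admissible_morse_matching_def morse_matching_def matching_def by blast
  then show "x = x'" "y = y'" using assms(3) by (auto simp: disjnt_def)
qed

abbreviation rest :: "'a set \<Rightarrow> 'a set \<Rightarrow> 'a set set" where
  "rest x y \<equiv> {z\<in>P. z < y} - {x}"

text \<open>If \<open>x\<close> were a face of some member \<open>z\<close>, then \<open>z\<close>
  would lie strictly between \<open>x\<close> and \<open>y\<close>.\<close>

lemma downset_rest: "(x, y) \<in> M \<Longrightarrow> downset (rest x y)"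
  using M_edge[of x y] unfolding downset_def by (auto dest: order.strict_trans)

lemma contractible_rest:
  assumes "(x, y) \<in> M"
  shows "contractible_space (body (rest x y))" "rest x y \<noteq> {}"
proof -
  have "contractible_complex (order_complex (rest x y))"
    using admissible assms
    unfolding admissible_morse_matching_def admissible_edge_def strictly_below_def by blast
  then show "contractible_space (body (rest x y))" "rest x y \<noteq> {}"
    using contractible_downset[OF downset_rest[OF assms]] by blast+
qed

lemma dim_M:
  assumes "(x, y) \<in> M"
  shows "d y = Suc (d x)"
proof -
  have e: "x \<in> P" "y \<in> P" "x < y" "\<not> (\<exists>z\<in>P. x < z \<and> z < y)"
    using M_edge[OF assms] by simp_all
  show ?thesis by (rule dim_admissible_edge[OF e contractible_rest[OF assms]])
qed

text \<open>The boundary of a critical \<open>p\<close>-cell lies in the stage \<open>Q' p\<close> introduced below, whose model has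
  dimension less than \<open>p\<close>: this is why no cellular approximation is needed.\<close>

definition Q :: "nat \<Rightarrow> 'a set set" where
  "Q p = {y\<in>P. d y < p \<and> (\<forall>y'. (y, y') \<in> M \<longrightarrow> d y' < p)}"

definition pairs :: "nat \<Rightarrow> ('a set \<times> 'a set) set" where
  "pairs p = {(x, y). (x, y) \<in> M \<and> d y = p}"

text \<open>\<open>R\<close> records the pairs already added: \<open>stage p {}\<close> is
  \<open>Q p\<close>, and \<open>stage p (pairs p)\<close> consists of all cells of dimension below
  \<open>p\<close> and the \<open>p\<close>-cells that are upper elements of pairs.\<close>

definition stage :: "nat \<Rightarrow> ('a set \<times> 'a set) set \<Rightarrow> 'a set set" where
  "stage p R = Q p \<union> fst ` R \<union> snd ` R"

abbreviation Q' :: "nat \<Rightarrow> 'a set set" where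
  "Q' p \<equiv> stage p (pairs p)"

definition crit :: "nat \<Rightarrow> 'a set set" where
  "crit p = {y\<in>critical_points P M. d y = p}"

lemma pairsD:
  assumes "(x, y) \<in> pairs p"
  shows "(x, y) \<in> M \<and> d y = p \<and> Suc (d x) = p \<and> x \<in> P \<and> y \<in> P \<and> x < y"
proof -
  have m: "(x, y) \<in> M" and p: "d y = p" using assms by (simp_all add: pairs_def)
  show ?thesis using M_edge[OF m] dim_M[OF m] m p by simp
qed

lemma stageE:
  assumes "y \<in> stage p R"
  obtains "y \<in> Q p" | x where "(y, x) \<in> R" | x where "(x, y) \<in> R"
  using assms unfolding stage_def by force

section \<open>Exhaustion of the poset by dimension\<close>

lemma finite_M: "finite M"
proof (rule finite_subset)
  show "M \<subseteq> P \<times> P" using M_edge by auto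
qed (use finite_P in simp)

lemma finite_pairs: "finite (pairs p)"
  by (rule finite_subset[OF _ finite_M]) (auto simp: pairs_def)

lemma stage_subset: "R \<subseteq> pairs p \<Longrightarrow> stage p R \<subseteq> P"
  unfolding stage_def Q_def using pairsD by fastforce

text \<open>Such a cell is missing from \<open>Q p\<close> only if its upper partner has dimension
  at least \<open>p\<close>; as dimensions in a pair are consecutive, the partner has dimension
  exactly \<open>p\<close>.\<close>

lemma low_in_Q': "z \<in> P \<Longrightarrow> d z < p \<Longrightarrow> z \<in> Q' p"
proof (cases "\<exists>y'. (z, y') \<in> M")
  case True
  assume z: "z \<in> P" "d z < p"
  from True obtain y' where y': "(z, y') \<in> M" by blast
  then have "d y' = p \<or> d y' < p" using dim_M z(2) by fastforce
  then show ?thesis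
  proof
    assume "d y' = p"
    then have "(z, y') \<in> pairs p" using y' by (simp add: pairs_def)
    then show ?thesis unfolding stage_def by force
  next
    assume "d y' < p"
    moreover have "y'' = y'" if "(z, y'') \<in> M" for y'' using M_unique(2)[OF that y'] by simp
    ultimately show ?thesis using z unfolding stage_def Q_def by blast
  qed
next
  case False
  assume "z \<in> P" "d z < p"
  then show ?thesis using False unfolding stage_def Q_def by blast
qed

lemma downset_Q: "downset (Q p)"
  unfolding downset_def
proof (intro conjI ballI impI)
  show "Q p \<subseteq> P" by (auto simp: Q_def)
  fix y z assume y: "y \<in> Q p" and z: "z \<in> P" "z < y"
  have "d z < d y" "d y < p" using dim_less z y by (auto simp: Q_def)
  then show "z \<in> Q p" using z dim_M unfolding Q_def by fastforce
qed

lemma downset_Q': "downset (Q' p)"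
  unfolding downset_def
proof (intro conjI ballI impI)
  show "Q' p \<subseteq> P" by (rule stage_subset) simp
  fix y z assume y: "y \<in> Q' p" and z: "z \<in> P" "z < y"
  have "y \<in> P" "d y \<le> p" using y pairsD unfolding stage_def Q_def by fastforce+
  then have "d z < p" using dim_less[of y z] z by simp
  then show "z \<in> Q' p" using low_in_Q' z by blast
qed

lemma Q_0: "Q 0 = {}"
  by (simp add: Q_def)

text \<open>A \<open>p\<close>-cell in \<open>Q (Suc p)\<close> is not matched upwards, since its
  partner would have dimension \<open>Suc p\<close>; so it is critical or the upper element of a
  pair.\<close>

lemma Q_Suc: "Q (Suc p) = Q' p \<union> crit p"
proof (intro equalityI subsetI)
  fix y assume y: "y \<in> Q (Suc p)"
  then have yP: "y \<in> P" "d y \<le> p" by (auto simp: Q_def)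
  show "y \<in> Q' p \<union> crit p"
  proof (cases "d y < p")
    case False
    then have dy: "d y = p" using yP by simp
    show ?thesis
    proof (cases "y \<in> critical_points P M")
      case False
      then obtain a b where ab: "(a, b) \<in> M" "y = a \<or> y = b"
        using yP unfolding critical_points_def by blast
      have "y \<noteq> a"
      proof
        assume "y = a"
        then have "d b < Suc p" "d b = Suc (d y)" using y dim_M[OF ab(1)] ab(1) by (auto simp: Q_def)
        then show False using dy by simp
      qed
      then have "(a, y) \<in> pairs p" using ab dy by (simp add: pairs_def)
      then show ?thesis unfolding stage_def by force
    qed (use dy in \<open>simp add: crit_def\<close>)
  qed (use low_in_Q' yP in blast)
next
  fix y assume "y \<in> Q' p \<union> crit p"
  then consider "y \<in> Q p" | x where "(y, x) \<in> pairs p" | x where "(x, y) \<in> pairs p" | "y \<in> crit p"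
    unfolding stage_def by force
  then show "y \<in> Q (Suc p)"
  proof cases
    case 1
    then show ?thesis unfolding Q_def by fastforce
  next
    case (2 x)
    note yx = pairsD[OF this]
    have "x' = x" if "(y, x') \<in> M" for x' using M_unique(2)[OF that, of y x] yx by simp
    then show ?thesis using yx unfolding Q_def by auto
  next
    case (3 x)
    note xy = pairsD[OF this]
    have False if "(y, x') \<in> M" for x' using M_unique(1)[OF that, of x y] xy by simp
    then show ?thesis using xy unfolding Q_def by auto
  next
    case 4
    then show ?thesis unfolding crit_def critical_points_def Q_def by fastforce
  qed
qed

text \<open>A missing face \<open>z\<close> of \<open>y\<close> other than \<open>x\<close> is the
  lower element of a remaining pair \<open>(z, b)\<close>, which gives a directed path from
  \<open>y\<close> down to \<open>z\<close> and up to \<open>b\<close>. By acyclicity some remaining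
  \<open>y\<close> reaches no remaining upper cell, so nothing is missing below it.\<close>

lemma next_pair:
  assumes R: "R \<subseteq> pairs p" "R \<noteq> pairs p"
  obtains x y where "(x, y) \<in> pairs p - R" "rest x y \<subseteq> stage p R"
proof -
  define S where "S = pairs p - R"
  let ?H = "modified_hasse P M"
  have finH: "finite ?H"
  proof (rule finite_subset)
    show "?H \<subseteq> P \<times> P" using M_edge unfolding modified_hasse_def hasse_edges_def by auto
  qed (use finite_P in simp)
  have "acyclic ?H" using admissible by (simp add: admissible_morse_matching_def morse_matching_def)
  then have "wf ((?H\<inverse>)\<^sup>+)" using finite_acyclic_wf_converse[OF finH] wf_trancl by blast
  moreover obtain y1 where "y1 \<in> snd ` S" using R unfolding S_def by blast
  \<comment> \<open>The well-founded relation is reversed reachability, so a minimal element is an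
    upper cell from which no remaining one can be reached.\<close>
  ultimately obtain y where y: "y \<in> snd ` S" and ymax: "\<And>y'. (y', y) \<in> (?H\<inverse>)\<^sup>+ \<Longrightarrow> y' \<notin> snd ` S"
    by (rule wfE_min) blast
  obtain x where xy: "(x, y) \<in> S" using y by force
  then have xyp: "(x, y) \<in> pairs p" by (simp add: S_def)
  note xyD = pairsD[OF xyp]
  have "rest x y \<subseteq> stage p R"
  proof (rule subsetI, rule ccontr)
    fix z assume z: "z \<in> rest x y" "z \<notin> stage p R"
    then have dz: "d z < p" using dim_less[of y z] xyD by auto
    then have "z \<in> Q' p" using low_in_Q' z(1) by blast
    then obtain a b where ab: "(a, b) \<in> S" "z = a \<or> z = b"
    proof (cases rule: stageE)
      case 1
      then show thesis using z(2) by (simp add: stage_def)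
    next
      case (2 b)
      then have "(z, b) \<notin> R" using z(2) by (force simp: stage_def)
      then show thesis using that[of z b] 2 by (simp add: S_def)
    next
      case (3 a)
      then have "(a, z) \<notin> R" using z(2) by (force simp: stage_def)
      then show thesis using that[of a z] 3 by (simp add: S_def)
    qed
    have abp: "(a, b) \<in> pairs p" using ab(1) by (simp add: S_def)
    note abD = pairsD[OF abp]
    have za: "z = a" using ab(2) abD dz by auto
    have "\<not> (\<exists>w\<in>P. z < w \<and> w < y)"
    proof
      assume "\<exists>w\<in>P. z < w \<and> w < y"
      then obtain w where "w \<in> P" "z < w" "w < y" by blast
      then have "d z < d w" "d w < d y" using dim_less z(1) xyD by auto
      then show False using abD xyD za by simp
    qed
    then have "(z, y) \<in> hasse_edges P" using z(1) xyD unfolding hasse_edges_def by blast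
    moreover have "(z, y) \<notin> M" using M_unique(1)[of z y x y] xyD z(1) by auto
    ultimately have "(y, z) \<in> ?H" by (simp add: modified_hasse_def)
    moreover have "(z, b) \<in> ?H" using abD za by (simp add: modified_hasse_def)
    ultimately have "(b, y) \<in> (?H\<inverse>)\<^sup>+" by (meson converse_iff r_into_trancl trancl_into_trancl)
    then show False using ymax ab(1) by force
  qed
  then show thesis using that xy by (simp add: S_def)
qed

text \<open>An elementary expansion with \<open>T\<close> the body of \<open>rest x y\<close>,
  contractible by admissibility, and \<open>Z\<close> the closed cell \<open>y\<close>, contractible
  by h-regularity.\<close>

lemma pair_expansion:
  assumes U: "downset U" and xy: "(x, y) \<in> M" and new: "x \<notin> U" "y \<notin> U" and sub: "rest x y \<subseteq> U"
  shows "downset (insert y (insert x U))"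
    and "body U homotopy_equivalent_space body (insert y (insert x U))"
proof -
  note e = M_edge[OF xy]
  have xlow: "z \<in> U" if "z \<in> P" "z < x" for z
  proof -
    have "z \<in> rest x y" using that e by (auto dest: order.strict_trans)
    then show ?thesis using sub by blast
  qed
  have ylow: "z \<in> insert x U" if "z \<in> P" "z < y" for z using sub that by blast
  have Ux: "downset (insert x U)" using downset_insert[OF U _ xlow] e by blast
  show Uy: "downset (insert y (insert x U))" using downset_insert[OF Ux _ ylow] e by blast
  have ynew: "y \<notin> insert x U" using new e by auto
  let ?X = "body (insert y (insert x U))"
  have yP: "y \<in> P" and xP: "x \<in> P" using e by auto
  have ay: "attached ?X (\<Union>(insert x U)) (d y) (c y)"
    by (rule attached_cell[OF Ux yP ynew ylow])
  have ax: "attached (body (insert x U)) (\<Union>U) (d x) (c x)"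
    by (rule attached_cell[OF U xP new(1) xlow])
  have bx: "subtopology ?X (\<Union>(insert x U)) = body (insert x U)" by (rule body_body) blast
  have bU: "subtopology ?X (\<Union>U) = body U" by (rule body_body) blast
  have bT: "subtopology ?X (\<Union>(rest x y)) = body (rest x y)" by (rule body_body) (use sub in blast)
  have by': "subtopology ?X y = subtopology X y"
    by (simp add: subtopology_subtopology inf.absorb2)
  have "homotopy_equivalence (subtopology ?X (\<Union>U)) ?X id"
  proof (rule elementary_expansion[OF ay, where n = "d x" and c = "c x" and T = "\<Union>(rest x y)" and Z = y])
    show "attached (subtopology ?X (\<Union>(insert x U))) (\<Union>U) (d x) (c x)" unfolding bx by (rule ax)
    show "contractible_space (subtopology ?X (\<Union>(rest x y)))"
      unfolding bT by (rule contractible_rest[OF xy])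
    obtain z where "z \<in> rest x y" using contractible_rest(2)[OF xy] by blast
    then show "\<Union>(rest x y) \<noteq> {}" using cell_nonempty[of z] by blast
    show "\<Union>(rest x y) \<subseteq> \<Union>U" using sub by (rule Union_mono)
    show "contractible_space (subtopology ?X y)" unfolding by' by (rule contractible_cell[OF yP])
    show "\<Union>(rest x y) \<subseteq> y" by auto
    have "x \<subseteq> y" using e by (simp add: less_le)
    then show "topspace ?X - \<Union>U \<subseteq> y" by auto
    show "c x ` sph (d x) \<subseteq> \<Union>(rest x y)"
    proof -
      have "{z\<in>P. z < x} \<subseteq> rest x y" using e by (auto dest: order.strict_trans)
      then show ?thesis unfolding boundary[OF xP] by (rule Union_mono)
    qed
    \<comment> \<open>A point of \<open>x\<close> is in the open cell or in a proper face of
      \<open>x\<close>, and proper faces of \<open>x\<close> belong to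
      \<open>rest x y\<close>.\<close>
    show "c y ` sph (d y) \<subseteq> \<Union>(rest x y) \<union> (\<Union>(insert x U) - \<Union>U)"
    proof
      fix v assume "v \<in> c y ` sph (d y)"
      then have "v \<in> \<Union>{z\<in>P. z < y}" using boundary[OF yP] by simp
      then obtain z where z: "z \<in> P" "z < y" "v \<in> z" by blast
      show "v \<in> \<Union>(rest x y) \<union> (\<Union>(insert x U) - \<Union>U)"
      proof (cases "z = x")
        case True
        then have "v \<in> x" using z(3) by simp
        from cell_cases[OF xP this] show ?thesis
        proof cases
          case 1
          then have "v \<notin> \<Union>U" using attachedD(7)[OF ax] by blast
          then show ?thesis using \<open>v \<in> x\<close> by blast
        next
          case (2 w)
          then have "w \<in> rest x y" using e by (auto dest: order.strict_trans)
          then show ?thesis using 2(3) by blast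
        qed
      next
        case False
        then have "z \<in> rest x y" using z by blast
        then show ?thesis using z(3) by blast
      qed
    qed
  qed
  then show "body U homotopy_equivalent_space ?X"
    unfolding bU homotopy_equivalent_space_iff by blast
qed

lemma stage_equivalent:
  "R \<subseteq> pairs p \<Longrightarrow> downset (stage p R) \<Longrightarrow> body (stage p R) homotopy_equivalent_space body (Q' p)"
proof (induction "card (pairs p - R)" arbitrary: R rule: less_induct)
  case less
  show ?case
  proof (cases "R = pairs p")
    case True
    then show ?thesis by (simp add: homotopy_equivalent_space_refl)
  next
    case False
    then obtain x y where xy: "(x, y) \<in> pairs p - R" and low: "rest x y \<subseteq> stage p R"
      using next_pair less.prems(1) by blast
    have xyp: "(x, y) \<in> pairs p" using xy by simp
    note D = pairsD[OF xyp]
    have R_unique: "(x', y') \<in> R \<Longrightarrow> {x, y} \<inter> {x', y'} = {}" for x' y'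
      using M_unique[of x y x' y'] D xy less.prems(1) pairsD by blast
    have xn: "x \<notin> stage p R"
    proof
      assume "x \<in> stage p R"
      then show False
      proof (cases rule: stageE)
        case 1
        then show False using D by (auto simp: Q_def)
      next
        case (2 b)
        then show False using R_unique[of x b] by simp
      next
        case (3 a)
        then show False using R_unique[of a x] by simp
      qed
    qed
    have yn: "y \<notin> stage p R"
    proof
      assume "y \<in> stage p R"
      then show False
      proof (cases rule: stageE)
        case 1
        then show False using D by (auto simp: Q_def)
      next
        case (2 b)
        then show False using R_unique[of y b] by simp
      next
        case (3 a)
        then show False using R_unique[of a y] by simp
      qed
    qed
    have ext: "stage p (insert (x, y) R) = insert y (insert x (stage p R))"
      by (auto simp: stage_def)
    have M: "(x, y) \<in> M" using D by blast
    have 1: "body (stage p R) homotopy_equivalent_space body (stage p (insert (x, y) R))"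
      unfolding ext by (rule pair_expansion(2)[OF less.prems(2) M xn yn low])
    have "card (pairs p - insert (x, y) R) < card (pairs p - R)"
      by (rule psubset_card_mono) (use finite_pairs xy in auto)
    then have "body (stage p (insert (x, y) R)) homotopy_equivalent_space body (Q' p)"
      by (rule less.hyps)
        (use xyp less.prems(1) pair_expansion(1)[OF less.prems(2) M xn yn low] in \<open>auto simp: ext\<close>)
    then show ?thesis using 1 homotopy_eqv_trans by blast
  qed
qed

section \<open>Construction of the model\<close>

lemma critD: "y \<in> crit p \<Longrightarrow> y \<in> P \<and> d y = p"
  by (auto simp: crit_def critical_points_def)

lemma crit_notin: "y \<in> crit p \<Longrightarrow> y \<notin> Q' p"
  by (auto elim!: stageE simp: crit_def critical_points_def Q_def pairs_def)

text \<open>That \<open>g'\<close> extends \<open>g\<close> is the essential invariant: the boundary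
  of each critical \<open>p\<close>-cell lies in the body of \<open>Q' p\<close>, which
  \<open>g\<close> maps into cells of dimension below \<open>p\<close>. So attaching maps stay in
  the lower skeleton even after other \<open>p\<close>-cells have been added.\<close>

lemma attach_critical:
  assumes L: "euclidean_cw L" and g: "homotopy_equivalence (body (Q' p)) (space_of L) g"
    and low: "\<forall>m\<ge>p. cells L m = {}" and "finite C"
  shows "C \<subseteq> crit p \<Longrightarrow> \<exists>L' g'. euclidean_cw L' \<and>
    homotopy_equivalence (body (Q' p \<union> C)) (space_of L') g' \<and> (\<forall>x\<in>\<Union>(Q' p). g' x = g x) \<and>
    (\<forall>m. m \<noteq> p \<longrightarrow> cells L' m = cells L m) \<and> cells L' p \<approx> C"
  using \<open>finite C\<close>
proof (induction C rule: finite_induct)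
  case empty
  show ?case using L g low by (intro exI[of _ L] exI[of _ g]) auto
next
  case (insert y C)
  have "C \<subseteq> crit p" using insert.prems by simp
  from insert.IH[OF this]
  obtain L1 g1 where L1: "euclidean_cw L1" and g1: "homotopy_equivalence (body (Q' p \<union> C)) (space_of L1) g1"
    and gg': "\<forall>x\<in>\<Union>(Q' p). g1 x = g x"
    and cells1': "\<forall>m. m \<noteq> p \<longrightarrow> cells L1 m = cells L m" and C: "cells L1 p \<approx> C"
    by (elim exE conjE)
  note gg = gg'[rule_format] and cells1 = cells1'[rule_format]
  obtain T N where T: "space_of L1 = top_of_set T" "T \<subseteq> topspace (Euclidean_space N)"
    and fin: "finite_cw_complex L1"
    using L1 unfolding euclidean_cw_def by blast
  have yc: "y \<in> crit p" using insert.prems by blast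
  note yD = critD[OF yc]
  have zlow: "z \<in> Q' p" if "z \<in> P" "z < y" for z
    using low_in_Q' dim_less[of y z] that yD by auto
  have dU: "downset (Q' p \<union> C)"
    unfolding downset_def
  proof (intro conjI ballI impI)
    show "Q' p \<union> C \<subseteq> P" using downset_subset[OF downset_Q'] insert.prems critD by blast
    fix w z assume w: "w \<in> Q' p \<union> C" and z: "z \<in> P" "z < w"
    show "z \<in> Q' p \<union> C"
    proof (cases "w \<in> Q' p")
      case True
      then show ?thesis using downset_Q'[of p] z unfolding downset_def by blast
    next
      case False
      then have "w \<in> P" "d w = p" using w insert.prems critD by auto
      then show ?thesis using low_in_Q' dim_less[of w z] z by auto
    qed
  qed
  have ynew: "y \<notin> Q' p \<union> C" using crit_notin[OF yc] insert.hyps by blast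
  have yP: "y \<in> P" using yD by blast
  let ?X = "body (insert y (Q' p \<union> C))"
  have "attached ?X (\<Union>(Q' p \<union> C)) (d y) (c y)"
    by (rule attached_cell[OF dU yP ynew]) (use zlow in blast)
  then have ay: "attached ?X (\<Union>(Q' p \<union> C)) p (c y)" using yD by simp
  have bd: "c y s \<in> \<Union>(Q' p)" if "s \<in> sph p" for s
  proof -
    have "{z\<in>P. z < y} \<subseteq> Q' p" using zlow by blast
    then have "\<Union>{z\<in>P. z < y} \<subseteq> \<Union>(Q' p)" by (rule Union_mono)
    moreover have "c y s \<in> \<Union>{z\<in>P. z < y}" using boundary[OF yP] yD that by blast
    ultimately show ?thesis by blast
  qed
  have bU: "subtopology ?X (\<Union>(Q' p \<union> C)) = body (Q' p \<union> C)" by (rule body_body) blast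
  have g1c: "continuous_map (body (Q' p \<union> C)) (top_of_set T) g1"
    using g1 T(1) by (simp add: homotopy_equivalence_def)
  have cyS: "continuous_map (S_top p) (body (Q' p \<union> C)) (c y)"
  proof -
    have "continuous_map (S_top p) ?X (c y)"
      using continuous_map_from_subtopology_mono[OF attachedD(4)[OF ay] sph_subset] .
    then have "continuous_map (S_top p) (subtopology ?X (\<Union>(Q' p \<union> C))) (c y)"
      using attachedD(5)[OF ay] by (auto simp: continuous_map_in_subtopology)
    then show ?thesis unfolding bU .
  qed
  let ?f = "\<lambda>s. g1 (c y s)"
  have f: "continuous_map (S_top p) (top_of_set T) ?f" by (rule continuous_map_compose'[OF cyS g1c])
  have sk: "?f ` sph p \<subseteq> \<Union>(\<Union>m<p. cells L1 m)"
  proof (rule image_subsetI)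
    fix s assume s: "s \<in> sph p"
    interpret L0: finite_cw L using L by unfold_locales (simp add: euclidean_cw_def)
    have "topspace (body (Q' p)) = \<Union>(Q' p)" by (rule topspace_body[OF downset_subset[OF downset_Q']])
    then have "g (c y s) \<in> topspace (space_of L)"
      using g bd[OF s] by (auto simp: homotopy_equivalence_def continuous_map_def Pi_iff)
    then obtain m e where e: "e \<in> cells L m" "g (c y s) \<in> e" unfolding L0.cw_top by blast
    then have "m < p" using low by (cases "m < p") auto
    then show "?f s \<in> \<Union>(\<Union>m<p. cells L1 m)" using e cells1[of m] gg[OF bd[OF s]] by auto
  qed
  obtain L2 :: "(nat \<Rightarrow> real) cell_structure" and T2 N2 j where L2: "finite_cw_complex L2" "space_of L2 = top_of_set T2"
      "T2 \<subseteq> topspace (Euclidean_space N2)"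
    and aj: "attached (top_of_set T2) T p j" and js: "\<And>s. s \<in> sph p \<Longrightarrow> j s = ?f s"
    and cells2: "cells L2 = (cells L1)(p := insert (j ` odisk p) (cells L1 p))"
    and jn: "\<And>m. j ` odisk p \<notin> cells L1 m"
    by (rule attach_euclidean[OF fin T f sk]) (rule that; assumption)
  have sT: "subtopology (top_of_set T2) T = top_of_set T"
    using attachedD(3)[OF aj] by (simp add: subtopology_subtopology inf.absorb2)
  have he: "homotopy_equivalence (subtopology ?X (\<Union>(Q' p \<union> C))) (subtopology (top_of_set T2) T) g1"
    unfolding bU sT using g1 T(1) by simp
  have g2: "homotopy_equivalence ?X (space_of L2) (glue p (c y) (\<Union>(Q' p \<union> C)) g1 j)"
    unfolding L2(2) by (rule attach_equivalence[OF ay aj he]) (simp add: js)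
  show ?case
  proof (intro exI conjI)
    show "euclidean_cw L2" unfolding euclidean_cw_def using L2 by blast
    show "homotopy_equivalence (body (Q' p \<union> insert y C)) (space_of L2) (glue p (c y) (\<Union>(Q' p \<union> C)) g1 j)"
      using g2 by simp
    show "\<forall>x\<in>\<Union>(Q' p). glue p (c y) (\<Union>(Q' p \<union> C)) g1 j x = g x"
      using gg by (auto simp: glue_def)
    show "\<forall>m. m \<noteq> p \<longrightarrow> cells L2 m = cells L m" using cells1 by (simp add: cells2)
    show "cells L2 p \<approx> insert y C"
      using insert_eqpoll_cong[OF C jn[of p] insert.hyps(2)] by (simp add: cells2)
  qed
qed

text \<open>Absence of model cells in dimensions \<open>p\<close> and above is carried through the
  induction, since the next attachments rely on it. Passing from \<open>Q p\<close> to
  \<open>Q' p\<close> changes the equivalence but not the model.\<close>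

lemma stage_model:
  "\<exists>L. euclidean_cw L \<and> body (Q p) homotopy_equivalent_space space_of L \<and>
    (\<forall>m<p. cells L m \<approx> crit m) \<and> (\<forall>m\<ge>p. cells L m = {})"
proof (induction p)
  case 0
  let ?L = "\<lparr>space_of = top_of_set {}, cells = (\<lambda>_. {}), char_map = undefined\<rparr> :: (nat \<Rightarrow> real) cell_structure"
  have "body (Q 0) homotopy_equivalent_space space_of ?L"
    unfolding homotopy_equivalent_space_def
    by (intro exI conjI) (auto simp: Q_0 continuous_map_on_empty homotopic_on_emptyI)
  then show ?case using empty_euclidean_cw by (intro exI[of _ ?L]) auto
next
  case (Suc p)
  then obtain L where L: "euclidean_cw L" "body (Q p) homotopy_equivalent_space space_of L"
    "\<And>m. m < p \<Longrightarrow> cells L m \<approx> crit m" "\<And>m. m \<ge> p \<Longrightarrow> cells L m = {}" by blast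
  have "body (Q p) homotopy_equivalent_space body (Q' p)"
    using stage_equivalent[of "{}" p] downset_Q[of p] by (simp add: stage_def)
  then have "body (Q' p) homotopy_equivalent_space space_of L"
    using L(2) homotopy_equivalent_space_sym homotopy_eqv_trans by blast
  then obtain g where g: "homotopy_equivalence (body (Q' p)) (space_of L) g"
    unfolding homotopy_equivalent_space_iff by blast
  have "finite (crit p)" by (rule finite_subset[OF _ finite_P]) (auto simp: critD)
  moreover have "\<forall>m\<ge>p. cells L m = {}" using L(4) by blast
  ultimately have "\<exists>L' g'. euclidean_cw L' \<and>
    homotopy_equivalence (body (Q' p \<union> crit p)) (space_of L') g' \<and> (\<forall>x\<in>\<Union>(Q' p). g' x = g x) \<and>
    (\<forall>m. m \<noteq> p \<longrightarrow> cells L' m = cells L m) \<and> cells L' p \<approx> crit p"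
    by (intro attach_critical[OF L(1) g]) simp_all
  then
  obtain L' g' where L'1: "euclidean_cw L'"
    and L'2: "homotopy_equivalence (body (Q' p \<union> crit p)) (space_of L') g'"
    and L'3: "\<forall>m. m \<noteq> p \<longrightarrow> cells L' m = cells L m" and L'4: "cells L' p \<approx> crit p"
    by (elim exE conjE)
  note L' = L'1 L'2 L'3[rule_format] L'4
  show ?case
  proof (intro exI[of _ L'] conjI allI impI)
    show "body (Q (Suc p)) homotopy_equivalent_space space_of L'"
      unfolding Q_Suc homotopy_equivalent_space_iff using L'(2) by blast
    show "cells L' m \<approx> crit m" if "m < Suc p" for m
      using L' L(3)[of m] that by (cases "m = p") auto
    show "cells L' m = {}" if "Suc p \<le> m" for m
      using L'(3)[of m] L(4)[of m] that by simp
  qed (rule L'(1))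
qed

theorem morse_model:
  "\<exists>L. euclidean_cw L \<and> X homotopy_equivalent_space space_of L \<and> (\<forall>m. cells L m \<approx> crit m)"
proof -
  obtain p where p: "\<And>y. y \<in> P \<Longrightarrow> d y < p"
  proof -
    have "finite (d ` P)" using finite_P by simp
    then obtain k where "\<And>n. n \<in> d ` P \<Longrightarrow> n \<le> k" unfolding finite_nat_set_iff_bounded_le by blast
    then show thesis using that[of "Suc k"] by (simp add: less_Suc_eq_le)
  qed
  \<comment> \<open>\<open>p\<close> exceeds all dimensions, including those of upper
    partners.\<close>
  have "Q p = P" using p M_edge unfolding Q_def by blast
  then have bQ: "body (Q p) = X" by (simp add: top[symmetric])
  obtain L where L: "euclidean_cw L" "X homotopy_equivalent_space space_of L"
    "\<And>m. m < p \<Longrightarrow> cells L m \<approx> crit m" "\<And>m. m \<ge> p \<Longrightarrow> cells L m = {}"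
    using stage_model[of p] unfolding bQ by blast
  have "cells L m \<approx> crit m" for m
  proof (cases "m < p")
    case False
    then have "crit m = {}" using critD p by fastforce
    then show ?thesis using L(4)[of m] False by simp
  qed (rule L(3))
  then show ?thesis using L by blast
qed

end

theorem corollary4p2:
  fixes K :: "'a cell_structure"
    and M :: "('a set \<times> 'a set) set"
  assumes "finite_cw_complex K"
    and "h_regular K"
    and "admissible_morse_matching (face_poset K) M"
  shows "\<exists>L :: (nat \<Rightarrow> real) cell_structure.
           finite_cw_complex L \<and>
           space_of K homotopy_equivalent_space space_of L \<and>
           (\<forall>p. cells L p \<approx> critical_cells K M p)"
proof -
  interpret finite_cw K using assms(1) by unfold_locales
  interpret cell_poset "space_of K" "face_poset K" cdim cmap
    by (rule cell_poset_of_cw[OF assms(2)])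
  interpret morse_cell_poset "space_of K" "face_poset K" cdim cmap M
    using assms(3) by unfold_locales
  obtain L where L: "euclidean_cw L" "space_of K homotopy_equivalent_space space_of L"
    "\<And>p. cells L p \<approx> crit p" using morse_model by blast
  \<comment> \<open>\<open>crit\<close> consists of closed cells, \<open>critical_cells\<close> of
    open ones; taking closures is injective on cells.\<close>
  have "crit p \<approx> critical_cells K M p" for p
  proof -
    have "inj_on (closed_cell K) (critical_cells K M p)"
      using cw_closed_cell_inj unfolding critical_cells_def by (intro inj_onI) blast
    then have "closed_cell K ` critical_cells K M p \<approx> critical_cells K M p"
      by (rule inj_on_image_eqpoll_self)
    moreover have "crit p = closed_cell K ` critical_cells K M p"
    proof (intro equalityI subsetI)
      fix y assume y: "y \<in> crit p"
      then have "y \<in> face_poset K" using critD by blast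
      then obtain n e where e: "e \<in> cells K n" "y = closed_cell K e"
        unfolding face_poset_def by blast
      then have "n = p" using y pick_eq[OF e(1)] by (simp add: crit_def cdim_def)
      then show "y \<in> closed_cell K ` critical_cells K M p"
        using e y unfolding critical_cells_def crit_def by blast
    next
      fix y assume "y \<in> closed_cell K ` critical_cells K M p"
      then obtain e where e: "e \<in> cells K p" "closed_cell K e \<in> critical_points (face_poset K) M"
        "y = closed_cell K e" unfolding critical_cells_def by blast
      then show "y \<in> crit p" using pick_eq[OF e(1)] by (simp add: crit_def cdim_def)
    qed
    ultimately show ?thesis by simp
  qed
  then have "cells L p \<approx> critical_cells K M p" for p using L(3) eqpoll_trans by blast
  then show ?thesis using L unfolding euclidean_cw_def by blast
qed

end
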